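(* Let $k$ be a field and let $\mathscr C$ be a nonempty skeletal finite connected EI category which is free and projective over $k$. Let $\underline{k}$ be the trivial module over the category algebra $k\mathscr C$. Then the following statements hold. (1) If $\mathscr C$ has a smallest object $z$ such that $\mathrm{Hom}_{\mathscr C}(z,x)$ has only one $\mathrm{Aut}_{\mathscr C}(z)$-orbit for each object $x$, then $\underline{k}$ is Gorenstein-projective. (2) Assume that $\mathrm{Aut}_{\mathscr C}(x)$ acts freely on $\mathrm{Hom}_{\mathscr C}(x,y)$ for any objects $x$ and $y$. If $\underline{k}$ is Gorenstein-projective, then $\mathscr C$ has a smallest object $z$ such that $\mathrm{Hom}_{\mathscr C}(z,x)$ has only one $\mathrm{Aut}_{\mathscr C}(z)$-orbit for each object $x$.
   Context: A category is finite if it has only finitely many morphisms (hence finitely many objects). It is skeletal if any two distinct objects are non-isomorphic. A finite EI category is a finite category in which every endomorphism is an isomorphism; so $\mathrm{Hom}_{\mathscr C}(x,x)=\mathrm{Aut}_{\mathscr C}(x)$ is a finite group for each object $x$. The group $\mathrm{Aut}_{\mathscr C}(x)$ acts on $\mathrm{Hom}_{\mathscr C}(x,y)$ on the right by composition $\alpha\mapsto\alpha\circ g$. $\mathscr C$ is connected if for any two distinct objects $x,y$ there is a sequence of objects $x=x_0,x_1,\dots,x_m=y$ such that for each $0\le i\le m-1$ either $\mathrm{Hom}_{\mathscr C}(x_i,x_{i+1})$ or $\mathrm{Hom}_{\mathscr C}(x_{i+1},x_i)$ is nonempty. An object $z$ is a smallest object if $\mathrm{Hom}_{\mathscr C}(z,x)\neq\emptyset$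 for each object $x$. A morphism $\alpha:x\to y$ is unfactorizable if it is a non-isomorphism and whenever $\alpha=\gamma\circ\beta$, either $\beta$ or $\gamma$ is an isomorphism. A (skeletal) finite EI category $\mathscr C$ is free if it satisfies the Unique Factorization Property: whenever a non-isomorphism $\alpha:x\to y$ has two decompositions into unfactorizable morphisms $x=x_0\xrightarrow{\alpha_1}x_1\to\cdots\xrightarrow{\alpha_m}x_m=y$ and $x=y_0\xrightarrow{\beta_1}y_1\to\cdots\xrightarrow{\beta_n}y_n=y$, then $m=n$, $x_i=y_i$ for all $i$, and there are $h_i\in\mathrm{Aut}_{\mathscr C}(x_i)$, $1\le i\le n-1$, with $\beta_1=h_1\circ\alpha_1$, $\beta_i=h_i\circ\alpha_i\circ h_{i-1}^{-1}$ for $2\le i\le n-1$, and $\beta_n=\alpha_n\circ h_{n-1}^{-1}$. $\mathscr C$ is projective over $k$ if for all objects $x,y$ the $k\mathrm{Aut}_{\mathscr C}(y)$-$k\mathrm{Aut}_{\mathscr C}(x)$-bimodule $k\mathrm{Hom}_{\mathscr C}(x,y)$ is projective as a left module and projective as a right module. The category algebra $k\mathscr C$ has as $k$-basis the morphisms of $\mathscr C$, with product $\alpha*\beta=\alpha\circ\beta$ if composable and $0$ otherwise. Covariant functors from $\mathscr C$ to the category of finite dimensional $k$-vector spaces are identified with finite dimensional left $k\mathscr C$-modules via the standard equivalence $F\mapsto\bigoplus_x F(x)$. The trivial module $\underline{k}$ corresponds to the constant functor with $\underline{k}(x)=k$ for all objects $x$ and $\underline{k}(\alpha)=\mathrm{Id}_k$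 for all morphisms $\alpha$. For a finite dimensional $k$-algebra $A$, write $(-)^*$ for $\mathrm{Hom}_A(-,A)$ or $\mathrm{Hom}_{A^{\mathrm{op}}}(-,A)$. A finite dimensional left $A$-module $G$ is Gorenstein-projective if $\mathrm{Ext}^i_A(G,A)=0=\mathrm{Ext}^i_{A^{\mathrm{op}}}(G^*,A)$ for all $i\ge1$ and the evaluation map $G\to G^{**}$ is bijective. *)

theory Defs
  imports "HOL-Algebra.Elementary_Groups" "HOL-Algebra.Module"
begin

section \<open>Modules over arbitrary rings\<close>

text \<open>
  The library locale \<^locale>\<open>module\<close> is restricted to commutative rings.  We keep its record type
  (the fields \<^const>\<open>mult\<close> and \<^const>\<open>one\<close> of a module that is not an algebra are irrelevant and
  left undefined).  Right modules are left modules over the opposite ring.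
\<close>

locale left_module = R?: ring R + M?: abelian_group M
  for R :: "('a, 'b) ring_scheme" (structure) and M :: "('a, 'm, 'c) module_scheme" (structure) +
  assumes smult_closed:
      "\<lbrakk>a \<in> carrier R; x \<in> carrier M\<rbrakk> \<Longrightarrow> a \<odot>\<^bsub>M\<^esub> x \<in> carrier M"
    and smult_l_distr:
      "\<lbrakk>a \<in> carrier R; b \<in> carrier R; x \<in> carrier M\<rbrakk> \<Longrightarrow>
        (a \<oplus> b) \<odot>\<^bsub>M\<^esub> x = a \<odot>\<^bsub>M\<^esub> x \<oplus>\<^bsub>M\<^esub> b \<odot>\<^bsub>M\<^esub> x"
    and smult_r_distr:
      "\<lbrakk>a \<in> carrier R; x \<in> carrier M; y \<in> carrier M\<rbrakk> \<Longrightarrow>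
        a \<odot>\<^bsub>M\<^esub> (x \<oplus>\<^bsub>M\<^esub> y) = a \<odot>\<^bsub>M\<^esub> x \<oplus>\<^bsub>M\<^esub> a \<odot>\<^bsub>M\<^esub> y"
    and smult_assoc:
      "\<lbrakk>a \<in> carrier R; b \<in> carrier R; x \<in> carrier M\<rbrakk> \<Longrightarrow>
        (a \<otimes> b) \<odot>\<^bsub>M\<^esub> x = a \<odot>\<^bsub>M\<^esub> (b \<odot>\<^bsub>M\<^esub> x)"
    and smult_one:
      "x \<in> carrier M \<Longrightarrow> \<one> \<odot>\<^bsub>M\<^esub> x = x"

definition op_ring :: "('a, 'b) ring_scheme \<Rightarrow> ('a, 'b) ring_scheme" where
  "op_ring R = R\<lparr>mult := \<lambda>a b. b \<otimes>\<^bsub>R\<^esub> a\<rparr>"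

definition regular_module :: "('a, 'b) ring_scheme \<Rightarrow> ('a, 'a) module" where
  "regular_module R =
     \<lparr>carrier = carrier R, mult = undefined, one = undefined, zero = \<zero>\<^bsub>R\<^esub>, add = add R,
      smult = mult R\<rparr>"

definition free_module :: "('a, 'b) ring_scheme \<Rightarrow> 'i set \<Rightarrow> ('a, 'i \<Rightarrow> 'a) module" where
  "free_module R I =
     \<lparr>carrier = {v. (\<forall>i. v i \<in> carrier R) \<and> (\<forall>i. i \<notin> I \<longrightarrow> v i = \<zero>\<^bsub>R\<^esub>) \<and> finite {i. v i \<noteq> \<zero>\<^bsub>R\<^esub>}},
      mult = undefined, one = undefined, zero = (\<lambda>i. \<zero>\<^bsub>R\<^esub>), add = (\<lambda>v w i. v i \<oplus>\<^bsub>R\<^esub> w i),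
      smult = (\<lambda>a v i. a \<otimes>\<^bsub>R\<^esub> v i)\<rparr>"

text \<open>
  Homomorphisms are extensional (undefined off the carrier), so that distinct elements of
  \<open>mod_hom R M N\<close> are distinct maps \<open>M \<rightarrow> N\<close>.
\<close>

definition mod_hom ::
  "('a, 'b) ring_scheme \<Rightarrow> ('a, 'm, 'c) module_scheme \<Rightarrow> ('a, 'n, 'd) module_scheme \<Rightarrow> ('m \<Rightarrow> 'n) set"
  where
  "mod_hom R M N = {f \<in> carrier M \<rightarrow>\<^sub>E carrier N.
     (\<forall>x \<in> carrier M. \<forall>y \<in> carrier M. f (x \<oplus>\<^bsub>M\<^esub> y) = f x \<oplus>\<^bsub>N\<^esub> f y) \<and>
     (\<forall>a \<in> carrier R. \<forall>x \<in> carrier M. f (a \<odot>\<^bsub>M\<^esub> x) = a \<odot>\<^bsub>N\<^esub> f x)}"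

text \<open>
  Projective = direct summand of a free module.  Letting the basis range over subsets of the type
  of elements of \<open>P\<close> loses nothing: a projective \<open>P\<close> is a summand of the free module on its carrier.
\<close>

definition projective_module ::
  "('a, 'b) ring_scheme \<Rightarrow> ('a, 'm, 'c) module_scheme \<Rightarrow> bool" where
  "projective_module R P \<longleftrightarrow> left_module R P \<and>
     (\<exists>(I :: 'm set) s r. s \<in> mod_hom R P (free_module R I) \<and> r \<in> mod_hom R (free_module R I) P \<and>
        (\<forall>x \<in> carrier P. r (s x) = x))"

section \<open>Extension groups\<close>

definition projective_resolution ::
  "('a, 'b) ring_scheme \<Rightarrow> ('a, 'm, 'c) module_scheme \<Rightarrow>
   (nat \<Rightarrow> ('a, 'p) module) \<Rightarrow> (nat \<Rightarrow> 'p \<Rightarrow> 'p) \<Rightarrow> ('p \<Rightarrow> 'm) \<Rightarrow> bool" where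
  "projective_resolution R M P d e \<longleftrightarrow>
     (\<forall>n. projective_module R (P n)) \<and>
     e \<in> mod_hom R (P 0) M \<and> (\<forall>n. d n \<in> mod_hom R (P (Suc n)) (P n)) \<and>
     e ` carrier (P 0) = carrier M \<and>
     d 0 ` carrier (P 1) = {x \<in> carrier (P 0). e x = \<zero>\<^bsub>M\<^esub>} \<and>
     (\<forall>n. d (Suc n) ` carrier (P (Suc (Suc n))) = {x \<in> carrier (P (Suc n)). d n x = \<zero>\<^bsub>P n\<^esub>})"

definition hom_group ::
  "('a, 'b) ring_scheme \<Rightarrow> ('a, 'm, 'c) module_scheme \<Rightarrow> ('a, 'n, 'd) module_scheme \<Rightarrow> ('m \<Rightarrow> 'n) monoid"
  where
  "hom_group R M N =
     \<lparr>carrier = mod_hom R M N,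
      mult = (\<lambda>f g. \<lambda>x \<in> carrier M. f x \<oplus>\<^bsub>N\<^esub> g x),
      one = (\<lambda>x \<in> carrier M. \<zero>\<^bsub>N\<^esub>)\<rparr>"

definition cocycles ::
  "('a, 'b) ring_scheme \<Rightarrow> (nat \<Rightarrow> ('a, 'p) module) \<Rightarrow> (nat \<Rightarrow> 'p \<Rightarrow> 'p) \<Rightarrow>
   ('a, 'n, 'd) module_scheme \<Rightarrow> nat \<Rightarrow> ('p \<Rightarrow> 'n) set" where
  "cocycles R P d N i =
     {f \<in> mod_hom R (P i) N. \<forall>x \<in> carrier (P (Suc i)). f (d i x) = \<zero>\<^bsub>N\<^esub>}"

fun coboundaries ::
  "('a, 'b) ring_scheme \<Rightarrow> (nat \<Rightarrow> ('a, 'p) module) \<Rightarrow> (nat \<Rightarrow> 'p \<Rightarrow> 'p) \<Rightarrow>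
   ('a, 'n, 'd) module_scheme \<Rightarrow> nat \<Rightarrow> ('p \<Rightarrow> 'n) set" where
  "coboundaries R P d N 0 = {\<lambda>x \<in> carrier (P 0). \<zero>\<^bsub>N\<^esub>}"
| "coboundaries R P d N (Suc i) =
     (\<lambda>g. compose (carrier (P (Suc i))) g (d i)) ` mod_hom R (P i) N"

definition hom_cohomology ::
  "('a, 'b) ring_scheme \<Rightarrow> (nat \<Rightarrow> ('a, 'p) module) \<Rightarrow> (nat \<Rightarrow> 'p \<Rightarrow> 'p) \<Rightarrow>
   ('a, 'n, 'd) module_scheme \<Rightarrow> nat \<Rightarrow> ('p \<Rightarrow> 'n) set monoid" where
  "hom_cohomology R P d N i =
     (hom_group R (P i) N)\<lparr>carrier := cocycles R P d N i\<rparr> Mod coboundaries R P d N i"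

text \<open>
  The terms of the resolution are chosen with elements of type \<^typ>\<open>nat \<Rightarrow> 'a\<close>, which accommodates
  the free modules of finite rank and their submodules.  A suitable resolution exists whenever
  \<open>R\<close> is left Noetherian (in particular, a finite dimensional algebra) and \<open>M\<close> is finitely
  generated; these are the only cases in which \<open>Ext\<close> is used.
\<close>

definition Ext ::
  "('a, 'b) ring_scheme \<Rightarrow> ('a, 'm, 'c) module_scheme \<Rightarrow> ('a, 'n, 'd) module_scheme \<Rightarrow> nat \<Rightarrow>
   ((nat \<Rightarrow> 'a) \<Rightarrow> 'n) set monoid" where
  "Ext R M N i =
     (case (SOME (P, d). \<exists>e. projective_resolution R M P d e) of
        (P, d) \<Rightarrow> hom_cohomology R P d N i)"

section \<open>Gorenstein-projective modules\<close>

text \<open>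
  \<open>dual R M\<close> is \<open>Hom_R(M, R)\<close> with its right \<open>R\<close>-action \<open>(f a)(m) = f(m) a\<close>, written as a left module
  over \<open>op_ring R\<close>.  As \<open>op_ring (op_ring R) = R\<close>, the module \<open>dual (op_ring R) (dual R M)\<close> is the
  bidual as a left \<open>R\<close>-module.
\<close>

definition dual :: "('a, 'b) ring_scheme \<Rightarrow> ('a, 'm, 'c) module_scheme \<Rightarrow> ('a, 'm \<Rightarrow> 'a) module" where
  "dual R M =
     \<lparr>carrier = mod_hom R M (regular_module R), mult = undefined, one = undefined,
      zero = (\<lambda>x \<in> carrier M. \<zero>\<^bsub>R\<^esub>),
      add = (\<lambda>f g. \<lambda>x \<in> carrier M. f x \<oplus>\<^bsub>R\<^esub> g x),
      smult = (\<lambda>a f. \<lambda>x \<in> carrier M. f x \<otimes>\<^bsub>R\<^esub> a)\<rparr>"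

definition evaluation_map ::
  "('a, 'b) ring_scheme \<Rightarrow> ('a, 'm, 'c) module_scheme \<Rightarrow> 'm \<Rightarrow> ('m \<Rightarrow> 'a) \<Rightarrow> 'a" where
  "evaluation_map R M = (\<lambda>x \<in> carrier M. \<lambda>f \<in> carrier (dual R M). f x)"

text \<open>
  An algebra over a field \<open>'k\<close> is represented by the record \<^typ>\<open>('k, 'a) module\<close>; the field acts on
  an \<open>A\<close>-module through \<open>c \<mapsto> c \<odot> \<one>\<close>.
\<close>

definition finite_dimensional_module ::
  "('k::field, 'a, 'b) module_scheme \<Rightarrow> ('a, 'm, 'c) module_scheme \<Rightarrow> bool" where
  "finite_dimensional_module A M \<longleftrightarrow> left_module A M \<and>
     (\<exists>S. finite S \<and> S \<subseteq> carrier M \<and>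
        (\<forall>x \<in> carrier M. \<exists>c :: 'm \<Rightarrow> 'k.
           x = (\<Oplus>\<^bsub>M\<^esub>s \<in> S. (c s \<odot>\<^bsub>A\<^esub> \<one>\<^bsub>A\<^esub>) \<odot>\<^bsub>M\<^esub> s)))"

definition gorenstein_projective ::
  "('k::field, 'a, 'b) module_scheme \<Rightarrow> ('a, 'm, 'c) module_scheme \<Rightarrow> bool" where
  "gorenstein_projective A G \<longleftrightarrow>
     finite_dimensional_module A G \<and>
     (\<forall>i \<ge> 1. trivial_group (Ext A G (regular_module A) i)) \<and>
     (\<forall>i \<ge> 1. trivial_group (Ext (op_ring A) (dual A G) (regular_module (op_ring A)) i)) \<and>
     bij_betw (evaluation_map A G) (carrier G) (carrier (dual (op_ring A) (dual A G)))"

section \<open>Finite EI categories\<close>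

record ('o, 'm) cat =
  Obj :: "'o set"
  Arr :: "'m set"
  Dom :: "'m \<Rightarrow> 'o"
  Cod :: "'m \<Rightarrow> 'o"
  Ident :: "'o \<Rightarrow> 'm"
  Comp :: "'m \<Rightarrow> 'm \<Rightarrow> 'm"  (infixl \<open>\<cdot>\<index>\<close> 70)

definition Hom :: "('o, 'm) cat \<Rightarrow> 'o \<Rightarrow> 'o \<Rightarrow> 'm set" where
  "Hom C x y = {f \<in> Arr C. Dom C f = x \<and> Cod C f = y}"

locale category =
  fixes C :: "('o, 'm) cat" (structure)
  assumes dom_obj: "f \<in> Arr C \<Longrightarrow> Dom C f \<in> Obj C"
    and cod_obj: "f \<in> Arr C \<Longrightarrow> Cod C f \<in> Obj C"
    and ident_hom: "x \<in> Obj C \<Longrightarrow> Ident C x \<in> Hom C x x"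
    and comp_hom: "\<lbrakk>f \<in> Hom C x y; g \<in> Hom C y z\<rbrakk> \<Longrightarrow> g \<cdot> f \<in> Hom C x z"
    and comp_ident_right: "f \<in> Hom C x y \<Longrightarrow> f \<cdot> Ident C x = f"
    and comp_ident_left: "f \<in> Hom C x y \<Longrightarrow> Ident C y \<cdot> f = f"
    and comp_assoc:
      "\<lbrakk>f \<in> Hom C w x; g \<in> Hom C x y; h \<in> Hom C y z\<rbrakk> \<Longrightarrow> h \<cdot> (g \<cdot> f) = (h \<cdot> g) \<cdot> f"

definition inverse_arrows :: "('o, 'm) cat \<Rightarrow> 'm \<Rightarrow> 'm \<Rightarrow> bool" where
  "inverse_arrows C f g \<longleftrightarrow> f \<in> Arr C \<and> g \<in> Hom C (Cod C f) (Dom C f) \<and>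
     g \<cdot>\<^bsub>C\<^esub> f = Ident C (Dom C f) \<and> f \<cdot>\<^bsub>C\<^esub> g = Ident C (Cod C f)"

definition iso_arrow :: "('o, 'm) cat \<Rightarrow> 'm \<Rightarrow> bool" where
  "iso_arrow C f \<longleftrightarrow> (\<exists>g. inverse_arrows C f g)"

definition Inverse :: "('o, 'm) cat \<Rightarrow> 'm \<Rightarrow> 'm" where
  "Inverse C f = (THE g. inverse_arrows C f g)"

definition Aut :: "('o, 'm) cat \<Rightarrow> 'o \<Rightarrow> 'm monoid" where
  "Aut C x = \<lparr>carrier = {f \<in> Hom C x x. iso_arrow C f}, mult = Comp C, one = Ident C x\<rparr>"

definition finite_category :: "('o, 'm) cat \<Rightarrow> bool" where
  "finite_category C \<longleftrightarrow> category C \<and> finite (Arr C)"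

definition finite_EI_category :: "('o, 'm) cat \<Rightarrow> bool" where
  "finite_EI_category C \<longleftrightarrow> finite_category C \<and> (\<forall>x \<in> Obj C. \<forall>f \<in> Hom C x x. iso_arrow C f)"

definition skeletal :: "('o, 'm) cat \<Rightarrow> bool" where
  "skeletal C \<longleftrightarrow>
     (\<forall>x \<in> Obj C. \<forall>y \<in> Obj C. x \<noteq> y \<longrightarrow> \<not> (\<exists>f \<in> Hom C x y. iso_arrow C f))"

definition connected_category :: "('o, 'm) cat \<Rightarrow> bool" where
  "connected_category C \<longleftrightarrow>
     (\<forall>x \<in> Obj C. \<forall>y \<in> Obj C. x \<noteq> y \<longrightarrow>
        (\<exists>m (p :: nat \<Rightarrow> 'o). p 0 = x \<and> p m = y \<and> (\<forall>i \<le> m. p i \<in> Obj C) \<and>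
           (\<forall>i < m. Hom C (p i) (p (Suc i)) \<noteq> {} \<or> Hom C (p (Suc i)) (p i) \<noteq> {})))"

definition smallest_object :: "('o, 'm) cat \<Rightarrow> 'o \<Rightarrow> bool" where
  "smallest_object C z \<longleftrightarrow> z \<in> Obj C \<and> (\<forall>x \<in> Obj C. Hom C z x \<noteq> {})"

definition aut_orbits :: "('o, 'm) cat \<Rightarrow> 'o \<Rightarrow> 'o \<Rightarrow> 'm set set" where
  "aut_orbits C x y = (\<lambda>f. (\<lambda>g. f \<cdot>\<^bsub>C\<^esub> g) ` carrier (Aut C x)) ` Hom C x y"

definition aut_acts_freely :: "('o, 'm) cat \<Rightarrow> 'o \<Rightarrow> 'o \<Rightarrow> bool" where
  "aut_acts_freely C x y \<longleftrightarrow>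
     (\<forall>f \<in> Hom C x y. \<forall>g \<in> carrier (Aut C x). f \<cdot>\<^bsub>C\<^esub> g = f \<longrightarrow> g = Ident C x)"

definition unfactorizable :: "('o, 'm) cat \<Rightarrow> 'm \<Rightarrow> bool" where
  "unfactorizable C f \<longleftrightarrow> f \<in> Arr C \<and> \<not> iso_arrow C f \<and>
     (\<forall>g \<in> Arr C. \<forall>h \<in> Arr C. Dom C h = Cod C g \<and> f = h \<cdot>\<^bsub>C\<^esub> g \<longrightarrow>
        iso_arrow C g \<or> iso_arrow C h)"

text \<open>\<open>path_comp C x a n\<close> is the composite of \<open>a 1, \<dots>, a n\<close>, starting at the object \<open>x\<close>.\<close>

primrec path_comp :: "('o, 'm) cat \<Rightarrow> 'o \<Rightarrow> (nat \<Rightarrow> 'm) \<Rightarrow> nat \<Rightarrow> 'm" where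
  "path_comp C x a 0 = Ident C x"
| "path_comp C x a (Suc n) = a (Suc n) \<cdot>\<^bsub>C\<^esub> path_comp C x a n"

definition unfactorizable_decomposition ::
  "('o, 'm) cat \<Rightarrow> 'm \<Rightarrow> nat \<Rightarrow> (nat \<Rightarrow> 'o) \<Rightarrow> (nat \<Rightarrow> 'm) \<Rightarrow> bool" where
  "unfactorizable_decomposition C f m x a \<longleftrightarrow>
     1 \<le> m \<and> x 0 = Dom C f \<and> x m = Cod C f \<and>
     (\<forall>i \<in> {1..m}. a i \<in> Hom C (x (i - 1)) (x i) \<and> unfactorizable C (a i)) \<and>
     path_comp C (x 0) a m = f"

text \<open>
  The Unique Factorization Property.  For \<open>n = 1\<close> there are no \<open>h\<^sub>i\<close>, and the two decompositions
  coincide because both consist of the given morphism alone.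
\<close>

definition free_category :: "('o, 'm) cat \<Rightarrow> bool" where
  "free_category C \<longleftrightarrow>
     (\<forall>f \<in> Arr C. \<not> iso_arrow C f \<longrightarrow>
        (\<forall>m n x y a b.
           unfactorizable_decomposition C f m x a \<and> unfactorizable_decomposition C f n y b \<longrightarrow>
           m = n \<and> (\<forall>i \<le> n. x i = y i) \<and>
           (2 \<le> n \<longrightarrow>
             (\<exists>h. (\<forall>i \<in> {1..n - 1}. h i \<in> carrier (Aut C (x i))) \<and>
                b 1 = h 1 \<cdot>\<^bsub>C\<^esub> a 1 \<and>
                (\<forall>i \<in> {2..n - 1}. b i = h i \<cdot>\<^bsub>C\<^esub> a i \<cdot>\<^bsub>C\<^esub> Inverse C (h (i - 1))) \<and>
                b n = a n \<cdot>\<^bsub>C\<^esub> Inverse C (h (n - 1))))))"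

section \<open>Category algebras\<close>

text \<open>
  For a finite set \<open>S\<close>, the vector space with basis \<open>S\<close> consists of the functions vanishing off \<open>S\<close>.
  All index sets below are finite when the category is.
\<close>

definition linear_span :: "'s set \<Rightarrow> ('s \<Rightarrow> 'k::field) set" where
  "linear_span S = {v. \<forall>s. s \<notin> S \<longrightarrow> v s = 0}"

definition category_algebra :: "('o, 'm) cat \<Rightarrow> ('k::field, 'm \<Rightarrow> 'k) module" where
  "category_algebra C =
     \<lparr>carrier = linear_span (Arr C),
      mult = (\<lambda>a b h. \<Sum>(f, g) | f \<in> Arr C \<and> g \<in> Arr C \<and> Dom C f = Cod C g \<and> f \<cdot>\<^bsub>C\<^esub> g = h. a f * b g),
      one = (\<lambda>h. if h \<in> Ident C ` Obj C then 1 else 0),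
      zero = (\<lambda>h. 0),
      add = (\<lambda>a b h. a h + b h),
      smult = (\<lambda>c a h. c * a h)\<rparr>"

definition group_algebra :: "('g, 'b) monoid_scheme \<Rightarrow> ('k::field, 'g \<Rightarrow> 'k) module" where
  "group_algebra G =
     \<lparr>carrier = linear_span (carrier G),
      mult = (\<lambda>a b h. \<Sum>(f, g) | f \<in> carrier G \<and> g \<in> carrier G \<and> f \<otimes>\<^bsub>G\<^esub> g = h. a f * b g),
      one = (\<lambda>h. if h = \<one>\<^bsub>G\<^esub> then 1 else 0),
      zero = (\<lambda>h. 0),
      add = (\<lambda>a b h. a h + b h),
      smult = (\<lambda>c a h. c * a h)\<rparr>"

definition hom_left_module ::
  "('o, 'm) cat \<Rightarrow> 'o \<Rightarrow> 'o \<Rightarrow> ('m \<Rightarrow> 'k::field, 'm \<Rightarrow> 'k) module" where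
  "hom_left_module C x y =
     \<lparr>carrier = linear_span (Hom C x y), mult = undefined, one = undefined,
      zero = (\<lambda>h. 0),
      add = (\<lambda>v w h. v h + w h),
      smult = (\<lambda>a v h. \<Sum>(g, f) | g \<in> carrier (Aut C y) \<and> f \<in> Hom C x y \<and> g \<cdot>\<^bsub>C\<^esub> f = h. a g * v f)\<rparr>"

definition hom_right_module ::
  "('o, 'm) cat \<Rightarrow> 'o \<Rightarrow> 'o \<Rightarrow> ('m \<Rightarrow> 'k::field, 'm \<Rightarrow> 'k) module" where
  "hom_right_module C x y =
     \<lparr>carrier = linear_span (Hom C x y), mult = undefined, one = undefined,
      zero = (\<lambda>h. 0),
      add = (\<lambda>v w h. v h + w h),
      smult = (\<lambda>a v h. \<Sum>(f, g) | f \<in> Hom C x y \<and> g \<in> carrier (Aut C x) \<and> f \<cdot>\<^bsub>C\<^esub> g = h. v f * a g)\<rparr>"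

definition projective_category :: "'k::field itself \<Rightarrow> ('o, 'm) cat \<Rightarrow> bool" where
  "projective_category k C \<longleftrightarrow>
     (\<forall>x \<in> Obj C. \<forall>y \<in> Obj C.
        projective_module (group_algebra (Aut C y) :: ('k, 'm \<Rightarrow> 'k) module) (hom_left_module C x y) \<and>
        projective_module (op_ring (group_algebra (Aut C x) :: ('k, 'm \<Rightarrow> 'k) module))
          (hom_right_module C x y))"

text \<open>
  The module \<open>\<Oplus>\<^sub>x F(x)\<close> of the constant functor \<open>F\<close> with value \<open>k\<close>: a morphism \<open>f : x \<rightarrow> y\<close> maps the
  summand at \<open>x\<close> identically to the summand at \<open>y\<close> and kills the other summands.
\<close>

definition trivial_module :: "('o, 'm) cat \<Rightarrow> ('m \<Rightarrow> 'k::field, 'o \<Rightarrow> 'k) module" where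
  "trivial_module C =
     \<lparr>carrier = linear_span (Obj C), mult = undefined, one = undefined,
      zero = (\<lambda>y. 0),
      add = (\<lambda>v w y. v y + w y),
      smult = (\<lambda>a v y. \<Sum>f | f \<in> Arr C \<and> Cod C f = y. a f * v (Dom C f))\<rparr>"

end

theory Submission
  imports Defs Complex_Main "HOL-Library.Function_Algebras"
begin

text \<open>
  Let \<open>k\<close> be the field, \<open>A\<close> the category algebra and \<open>T\<close> the trivial module.  For an object \<open>z\<close>, let \<open>G\<close> be
  its automorphism group and \<open>e\<close> its identity, which is an idempotent of \<open>A\<close>.
  
  \<^bold>\<open>Existence of a smallest object \<open>z\<close> with one orbit everywhere is sufficient.\<close>
  In a skeletal EI category nothing but \<open>G\<close> maps to \<open>z\<close>, so that \<open>e A = e A e\<close> is the group algebra \<open>k G\<close>.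
  As each \<open>Hom(z, x)\<close> is a single orbit, the tensor product of \<open>A e\<close> with the trivial \<open>k G\<close>-module is
  \<open>T\<close>; and \<open>A e\<close> is projective as a right \<open>k G\<close>-module, because projectivity of \<open>k Hom(z, x)\<close> forces
  the orders of the stabilizers to be invertible in \<open>k\<close> (\<open>stabilizer_invertible\<close>).  Hence tensoring with
  \<open>A e\<close> carries a free resolution of the trivial \<open>k G\<close>-module to a resolution of \<open>T\<close> by powers of \<open>A e\<close>,
  and homomorphisms from its terms to \<open>A\<close> are homomorphisms over \<open>k G\<close> to \<open>e A = k G\<close>.  As \<open>k G\<close> is
  self-injective, \<open>Ext(T, A)\<close> vanishes in positive degrees.  The dual of \<open>T\<close> is the one-dimensional right
  module at \<open>z\<close> on which \<open>G\<close> acts trivially; its resolution by powers of \<open>e A\<close> and the injectivity of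
  the \<open>k G\<close>-module \<open>A e\<close> give the vanishing on the other side.  Both cases are instances of one lemma
  (\<open>Ext_regular_trivial\<close>) on a ring with an idempotent, applied to \<open>A\<close> and to its opposite, which is
  the algebra of the opposite category.  Since \<open>Ext\<close> is computed from an unspecified resolution,
  \<open>Ext_trivial\<close> transports the vanishing from one resolution to any other.  Finally, an element of the
  bidual of \<open>T\<close> is given by an element of \<open>A e\<close> that is constant on every \<open>Hom(z, x)\<close>, and such elements
  correspond to the elements of \<open>T\<close> (\<open>evaluation_bijective\<close>).
  
  \<^bold>\<open>Existence of such an object is necessary.\<close>
  If \<open>T\<close> is Gorenstein-projective, then it is torsionless, so that some homomorphism to \<open>A\<close> does not
  vanish at a given object.  Such a homomorphism is a family of vectors \<open>b x\<close>, supported on the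
  morphisms to \<open>x\<close>, with \<open>f \<cdot> b x = b y\<close> for each \<open>f : x \<rightarrow> y\<close>.  Unique factorization and free
  actions make every morphism monic (\<open>monic\<close>), so that composition with \<open>f\<close> does not cancel coefficients.
  If \<open>z\<close> is the domain of a morphism in one of the supports, then by connectedness every support
  contains a morphism from \<open>z\<close>; hence \<open>z\<close> is a smallest object.  As \<open>b x = f \<cdot> b z\<close> for
  every \<open>f : z \<rightarrow> x\<close>, and the part of \<open>b z\<close> with domain \<open>z\<close> is supported on \<open>G\<close>, a morphism from \<open>z\<close> in the
  support of \<open>b x\<close> lies in the orbit of every such \<open>f\<close>.
\<close>

section \<open>Homomorphisms of modules\<close>

lemma mod_hom_closed: "f \<in> mod_hom R M N \<Longrightarrow> x \<in> carrier M \<Longrightarrow> f x \<in> carrier N"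
  by (auto simp: mod_hom_def)

lemma mod_hom_add: "f \<in> mod_hom R M N \<Longrightarrow> x \<in> carrier M \<Longrightarrow> y \<in> carrier M \<Longrightarrow>
   f (x \<oplus>\<^bsub>M\<^esub> y) = f x \<oplus>\<^bsub>N\<^esub> f y"
  by (auto simp: mod_hom_def)

lemma mod_hom_smult: "f \<in> mod_hom R M N \<Longrightarrow> a \<in> carrier R \<Longrightarrow> x \<in> carrier M \<Longrightarrow>
   f (a \<odot>\<^bsub>M\<^esub> x) = a \<odot>\<^bsub>N\<^esub> f x"
  by (auto simp: mod_hom_def)

lemma mod_hom_restrictI:
  assumes "left_module R M"
    and "\<And>x. x \<in> carrier M \<Longrightarrow> f x \<in> carrier N"
    and "\<And>x y. x \<in> carrier M \<Longrightarrow> y \<in> carrier M \<Longrightarrow> f (x \<oplus>\<^bsub>M\<^esub> y) = f x \<oplus>\<^bsub>N\<^esub> f y"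
    and "\<And>a x. a \<in> carrier R \<Longrightarrow> x \<in> carrier M \<Longrightarrow> f (a \<odot>\<^bsub>M\<^esub> x) = a \<odot>\<^bsub>N\<^esub> f x"
  shows "restrict f (carrier M) \<in> mod_hom R M N"
proof -
  interpret left_module R M by fact
  show ?thesis using assms(2-4) smult_closed by (auto simp: mod_hom_def)
qed

lemma mod_hom_compose:
  assumes "left_module R M" "f \<in> mod_hom R M N" "g \<in> mod_hom R N L"
  shows "compose (carrier M) g f \<in> mod_hom R M L"
  unfolding compose_def
  by (rule mod_hom_restrictI[OF assms(1)])
    (simp_all add: mod_hom_closed[OF assms(2)] mod_hom_closed[OF assms(3)]
      mod_hom_add[OF assms(2)] mod_hom_add[OF assms(3)] mod_hom_smult[OF assms(2)] mod_hom_smult[OF assms(3)])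

lemma mod_hom_eqI:
  assumes "f \<in> mod_hom R M N" "g \<in> mod_hom R M N" "\<And>x. x \<in> carrier M \<Longrightarrow> f x = g x"
  shows "f = g"
  using assms by (auto simp: mod_hom_def intro: PiE_ext)

context left_module
begin

lemma smult_zero_left: "x \<in> carrier M \<Longrightarrow> \<zero>\<^bsub>R\<^esub> \<odot>\<^bsub>M\<^esub> x = \<zero>\<^bsub>M\<^esub>"
  using smult_l_distr[of "\<zero>\<^bsub>R\<^esub>" "\<zero>\<^bsub>R\<^esub>" x] smult_closed[of "\<zero>\<^bsub>R\<^esub>" x] M.add.l_cancel_one'[of "\<zero>\<^bsub>R\<^esub> \<odot>\<^bsub>M\<^esub> x" "\<zero>\<^bsub>R\<^esub> \<odot>\<^bsub>M\<^esub> x"]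
  by simp

lemma smult_zero_right: "a \<in> carrier R \<Longrightarrow> a \<odot>\<^bsub>M\<^esub> \<zero>\<^bsub>M\<^esub> = \<zero>\<^bsub>M\<^esub>"
  using smult_r_distr[of a "\<zero>\<^bsub>M\<^esub>" "\<zero>\<^bsub>M\<^esub>"] smult_closed[of a "\<zero>\<^bsub>M\<^esub>"] M.add.l_cancel_one'[of "a \<odot>\<^bsub>M\<^esub> \<zero>\<^bsub>M\<^esub>" "a \<odot>\<^bsub>M\<^esub> \<zero>\<^bsub>M\<^esub>"]
  by simp

lemma smult_finsum:
  assumes "a \<in> carrier R" "F \<in> J \<rightarrow> carrier M"
  shows "a \<odot>\<^bsub>M\<^esub> finsum M F J = finsum M (\<lambda>j. a \<odot>\<^bsub>M\<^esub> F j) J"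
proof (cases "finite J")
  case True
  from this assms show ?thesis
    by (induction J) (auto simp: smult_zero_right smult_r_distr smult_closed Pi_iff)
qed (use assms in \<open>auto simp: smult_zero_right\<close>)

lemma mod_hom_zero:
  assumes "abelian_group N" "f \<in> mod_hom R M N"
  shows "f \<zero>\<^bsub>M\<^esub> = \<zero>\<^bsub>N\<^esub>"
proof -
  interpret N: abelian_group N by fact
  show ?thesis
    using mod_hom_add[OF assms(2), of "\<zero>\<^bsub>M\<^esub>" "\<zero>\<^bsub>M\<^esub>"] mod_hom_closed[OF assms(2), of "\<zero>\<^bsub>M\<^esub>"]
      N.add.l_cancel_one'[of "f \<zero>\<^bsub>M\<^esub>" "f \<zero>\<^bsub>M\<^esub>"] by simp
qed

lemma mod_hom_finsum:
  assumes N: "abelian_group N" and f: "f \<in> mod_hom R M N" and F: "F \<in> J \<rightarrow> carrier M"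
  shows "f (finsum M F J) = finsum N (\<lambda>j. f (F j)) J"
proof -
  interpret N: abelian_group N by fact
  show ?thesis
  proof (cases "finite J")
    case True
    from this F show ?thesis
      by (induction J) (auto simp: mod_hom_zero[OF N f] mod_hom_add[OF f] mod_hom_closed[OF f] Pi_iff)
  qed (auto simp: mod_hom_zero[OF N f])
qed

lemma mod_hom_diff:
  assumes N: "abelian_group N" and f: "f \<in> mod_hom R M N" and "x \<in> carrier M" "y \<in> carrier M"
  shows "f (x \<ominus>\<^bsub>M\<^esub> y) = f x \<ominus>\<^bsub>N\<^esub> f y"
proof -
  interpret N: abelian_group N by fact
  have "f (x \<ominus>\<^bsub>M\<^esub> y) \<oplus>\<^bsub>N\<^esub> f y = f x"
    using assms(3,4) mod_hom_add[OF f, of "x \<ominus>\<^bsub>M\<^esub> y" y] by (simp add: M.minus_eq M.a_assoc M.l_neg)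
  then show ?thesis
    using assms(3,4) mod_hom_closed[OF f]
    by (metis M.minus_closed N.add.inv_solve_right N.minus_eq)
qed

lemma smult_diff:
  assumes "a \<in> carrier R" "x \<in> carrier M" "y \<in> carrier M"
  shows "a \<odot>\<^bsub>M\<^esub> (x \<ominus>\<^bsub>M\<^esub> y) = a \<odot>\<^bsub>M\<^esub> x \<ominus>\<^bsub>M\<^esub> a \<odot>\<^bsub>M\<^esub> y"
proof -
  have "a \<odot>\<^bsub>M\<^esub> (x \<ominus>\<^bsub>M\<^esub> y) \<oplus>\<^bsub>M\<^esub> a \<odot>\<^bsub>M\<^esub> y = a \<odot>\<^bsub>M\<^esub> x"
    using assms smult_r_distr[of a "x \<ominus>\<^bsub>M\<^esub> y" y] by (simp add: M.minus_eq M.a_assoc M.l_neg)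
  then show ?thesis using assms smult_closed
    by (metis M.minus_closed M.add.inv_solve_right M.minus_eq)
qed

end

lemma mod_hom_pointwise_add:
  assumes M: "left_module R M" and N: "left_module R N"
    and f: "f \<in> mod_hom R M N" and g: "g \<in> mod_hom R M N"
  shows "(\<lambda>x\<in>carrier M. f x \<oplus>\<^bsub>N\<^esub> g x) \<in> mod_hom R M N"
proof -
  interpret N: left_module R N by fact
  show ?thesis
    by (rule mod_hom_restrictI[OF M])
      (simp_all add: mod_hom_closed[OF f] mod_hom_closed[OF g] mod_hom_add[OF f] mod_hom_add[OF g]
        mod_hom_smult[OF f] mod_hom_smult[OF g] N.smult_r_distr N.M.a_ac)
qed

lemma mod_hom_pointwise_diff:
  assumes M: "left_module R M" and N: "left_module R N"
    and f: "f \<in> mod_hom R M N" and g: "g \<in> mod_hom R M N"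
  shows "(\<lambda>x\<in>carrier M. f x \<ominus>\<^bsub>N\<^esub> g x) \<in> mod_hom R M N"
proof -
  interpret N: left_module R N by fact
  show ?thesis
  proof (rule mod_hom_restrictI[OF M])
    fix a x assume "a \<in> carrier R" "x \<in> carrier M"
    then show "f (a \<odot>\<^bsub>M\<^esub> x) \<ominus>\<^bsub>N\<^esub> g (a \<odot>\<^bsub>M\<^esub> x) = a \<odot>\<^bsub>N\<^esub> (f x \<ominus>\<^bsub>N\<^esub> g x)"
      by (simp add: mod_hom_smult[OF f] mod_hom_smult[OF g] N.smult_diff mod_hom_closed[OF f] mod_hom_closed[OF g])
  qed (simp_all add: mod_hom_closed[OF f] mod_hom_closed[OF g] mod_hom_add[OF f] mod_hom_add[OF g]
        N.M.minus_eq N.M.minus_add N.M.a_ac)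
qed

lemma mod_hom_id: "left_module R M \<Longrightarrow> (\<lambda>x\<in>carrier M. x) \<in> mod_hom R M M"
  by (rule mod_hom_restrictI) auto

lemma left_module_regular:
  assumes "ring R" shows "left_module R (regular_module R)"
proof -
  interpret ring R by fact
  have "abelian_group (regular_module R)"
    by (rule abelian_groupI) (auto simp: regular_module_def a_ac intro: l_neg)
  then show ?thesis
    by (intro left_module.intro left_module_axioms.intro assms)
      (auto simp: regular_module_def l_distr r_distr m_assoc)
qed

lemma left_module_free:
  assumes "ring R" shows "left_module R (free_module R I)"
proof -
  interpret ring R by fact
  have fin: "finite {i. v i \<oplus>\<^bsub>R\<^esub> w i \<noteq> \<zero>\<^bsub>R\<^esub>}"
    if "finite {i. v i \<noteq> \<zero>\<^bsub>R\<^esub>}" "finite {i. w i \<noteq> \<zero>\<^bsub>R\<^esub>}" for v w :: "'c \<Rightarrow> 'a"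
    by (rule finite_subset[OF _ finite_UnI[OF that]]) (auto simp: l_zero)
  have fin2: "finite {i. a \<otimes>\<^bsub>R\<^esub> v i \<noteq> \<zero>\<^bsub>R\<^esub>}"
    if "finite {i. v i \<noteq> \<zero>\<^bsub>R\<^esub>}" "a \<in> carrier R" for v :: "'c \<Rightarrow> 'a" and a
    by (rule finite_subset[OF _ that(1)]) (use that(2) in auto)
  have "abelian_group (free_module R I)"
  proof (rule abelian_groupI)
    fix v assume v: "v \<in> carrier (free_module R I)"
    have "(\<lambda>i. \<ominus>\<^bsub>R\<^esub> v i) \<in> carrier (free_module R I)"
      using v by (auto simp: free_module_def elim!: finite_subset[rotated])
    moreover have "(\<lambda>i. \<ominus>\<^bsub>R\<^esub> v i) \<oplus>\<^bsub>free_module R I\<^esub> v = \<zero>\<^bsub>free_module R I\<^esub>"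
      using v by (auto simp: free_module_def l_neg)
    ultimately show "\<exists>w\<in>carrier (free_module R I). w \<oplus>\<^bsub>free_module R I\<^esub> v = \<zero>\<^bsub>free_module R I\<^esub>" by blast
  qed (auto simp: free_module_def fin a_ac)
  then show ?thesis
    by (intro left_module.intro left_module_axioms.intro assms)
      (auto simp: free_module_def fin2 l_distr r_distr m_assoc)
qed

lemma left_module_submodule:
  assumes M: "left_module R M" and Z: "Z \<subseteq> carrier M" "\<zero>\<^bsub>M\<^esub> \<in> Z"
    and add: "\<And>x y. x \<in> Z \<Longrightarrow> y \<in> Z \<Longrightarrow> x \<oplus>\<^bsub>M\<^esub> y \<in> Z"
    and smult: "\<And>a x. a \<in> carrier R \<Longrightarrow> x \<in> Z \<Longrightarrow> a \<odot>\<^bsub>M\<^esub> x \<in> Z"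
  shows "left_module R (M\<lparr>carrier := Z\<rparr>)"
proof -
  interpret M: left_module R M by fact
  note sub = subsetD[OF Z(1)]
  have neg: "\<exists>y\<in>Z. y \<oplus>\<^bsub>M\<^esub> x = \<zero>\<^bsub>M\<^esub>" if x: "x \<in> Z" for x
  proof
    have "(\<ominus>\<^bsub>R\<^esub> \<one>\<^bsub>R\<^esub>) \<odot>\<^bsub>M\<^esub> x \<oplus>\<^bsub>M\<^esub> x = (\<ominus>\<^bsub>R\<^esub> \<one>\<^bsub>R\<^esub> \<oplus>\<^bsub>R\<^esub> \<one>\<^bsub>R\<^esub>) \<odot>\<^bsub>M\<^esub> x"
      using sub[OF x] by (subst M.smult_l_distr) (simp_all add: M.smult_one)
    then show "(\<ominus>\<^bsub>R\<^esub> \<one>\<^bsub>R\<^esub>) \<odot>\<^bsub>M\<^esub> x \<oplus>\<^bsub>M\<^esub> x = \<zero>\<^bsub>M\<^esub>"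
      using sub[OF x] by (simp add: M.R.l_neg M.smult_zero_left)
  qed (use smult x in simp)
  have "abelian_group (M\<lparr>carrier := Z\<rparr>)"
    by (rule abelian_groupI) (use Z add neg in \<open>auto simp: sub M.M.a_ac\<close>)
  then show ?thesis
    by (intro left_module.intro left_module_axioms.intro M.ring_axioms)
      (auto simp: sub smult M.smult_l_distr M.smult_r_distr M.smult_assoc M.smult_one)
qed

section \<open>Projective modules\<close>

definition unit_vector :: "('a, 'b) ring_scheme \<Rightarrow> 'i \<Rightarrow> 'i \<Rightarrow> 'a" where
  "unit_vector R i = (\<lambda>j. if j = i then \<one>\<^bsub>R\<^esub> else \<zero>\<^bsub>R\<^esub>)"

lemma unit_vector_closed:
  assumes "ring R" "i \<in> I" shows "unit_vector R i \<in> carrier (free_module R I)"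
proof -
  interpret ring R by fact
  have "finite {j. unit_vector R i j \<noteq> \<zero>\<^bsub>R\<^esub>}"
    by (rule finite_subset[of _ "{i}"]) (auto simp: unit_vector_def)
  then show ?thesis using assms(2) by (auto simp: free_module_def unit_vector_def)
qed

lemma free_module_hom_expand:
  assumes R: "ring R" and Y: "left_module R Y" and u: "u \<in> mod_hom R (free_module R I) Y"
    and "finite J" "J \<subseteq> I" "v \<in> carrier (free_module R I)" "{i. v i \<noteq> \<zero>\<^bsub>R\<^esub>} \<subseteq> J"
  shows "u v = finsum Y (\<lambda>i. v i \<odot>\<^bsub>Y\<^esub> u (unit_vector R i)) J"
  using assms(4-)
proof (induction J arbitrary: v rule: finite_induct)
  interpret R: ring R by fact
  interpret F: left_module R "free_module R I" by (rule left_module_free[OF R])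
  interpret Y: left_module R Y by fact
  {
    case empty
    then have "v = \<zero>\<^bsub>free_module R I\<^esub>" by (auto simp: free_module_def)
    then show ?case using F.mod_hom_zero[OF Y.M.abelian_group_axioms u] by simp
  next
    case (insert j J)
    define w where "w = v(j := \<zero>\<^bsub>R\<^esub>)"
    have sub: "{i. w i \<noteq> \<zero>\<^bsub>R\<^esub>} \<subseteq> {i. v i \<noteq> \<zero>\<^bsub>R\<^esub>}" by (auto simp: w_def)
    have w: "w \<in> carrier (free_module R I)"
      using insert.prems finite_subset[OF sub] by (auto simp: free_module_def w_def)
    have vc: "v i \<in> carrier R" for i using insert.prems by (auto simp: free_module_def)
    have e: "unit_vector R i \<in> carrier (free_module R I)" if "i \<in> I" for i
      using unit_vector_closed[OF R that] .
    have j: "j \<in> I" using insert.prems by auto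
    have v: "v = v j \<odot>\<^bsub>free_module R I\<^esub> unit_vector R j \<oplus>\<^bsub>free_module R I\<^esub> w"
      using vc by (auto simp: free_module_def w_def unit_vector_def)
    have "u v = v j \<odot>\<^bsub>Y\<^esub> u (unit_vector R j) \<oplus>\<^bsub>Y\<^esub> u w"
      apply (subst v)
      using w e[OF j] vc
      by (subst mod_hom_add[OF u]) (auto simp: mod_hom_smult[OF u] F.smult_closed)
    also have "u w = finsum Y (\<lambda>i. w i \<odot>\<^bsub>Y\<^esub> u (unit_vector R i)) J"
      by (rule insert.IH[OF _ w]) (use insert.prems in \<open>auto simp: w_def split: if_splits\<close>)
    also have "\<dots> = finsum Y (\<lambda>i. v i \<odot>\<^bsub>Y\<^esub> u (unit_vector R i)) J"
      using insert.hyps insert.prems vc e mod_hom_closed[OF u] Y.smult_closed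
      by (intro Y.M.finsum_cong') (auto simp: w_def)
    also have "v j \<odot>\<^bsub>Y\<^esub> u (unit_vector R j) \<oplus>\<^bsub>Y\<^esub> \<dots> = finsum Y (\<lambda>i. v i \<odot>\<^bsub>Y\<^esub> u (unit_vector R i)) (insert j J)"
      using insert.hyps insert.prems vc e mod_hom_closed[OF u] Y.smult_closed
      by (subst Y.M.finsum_insert) auto
    finally show ?case .
  }
qed

lemma free_module_hom_exists:
  assumes R: "ring R" and X: "left_module R X" and x: "\<And>i. i \<in> I \<Longrightarrow> x i \<in> carrier X"
  shows "\<exists>h \<in> mod_hom R (free_module R I) X. \<forall>i \<in> I. h (unit_vector R i) = x i"
proof -
  interpret R: ring R by fact
  interpret F: left_module R "free_module R I" by (rule left_module_free[OF R])
  interpret X: left_module R X by fact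
  define h where "h v = finsum X (\<lambda>i. v i \<odot>\<^bsub>X\<^esub> x i) {i. v i \<noteq> \<zero>\<^bsub>R\<^esub>}" for v
  have expand: "h v = finsum X (\<lambda>i. v i \<odot>\<^bsub>X\<^esub> x i) J"
    if "v \<in> carrier (free_module R I)" "finite J" "{i. v i \<noteq> \<zero>\<^bsub>R\<^esub>} \<subseteq> J" "J \<subseteq> I" for v J
    unfolding h_def using that x
    by (intro X.M.add.finprod_mono_neutral_cong_left)
      (auto simp: X.smult_zero_left free_module_def intro!: X.smult_closed)
  have supp: "finite {i. v i \<noteq> \<zero>\<^bsub>R\<^esub>}" "{i. v i \<noteq> \<zero>\<^bsub>R\<^esub>} \<subseteq> I" "\<And>i. v i \<in> carrier R"
    if "v \<in> carrier (free_module R I)" for v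
    using that by (auto simp: free_module_def)
  have "restrict h (carrier (free_module R I)) \<in> mod_hom R (free_module R I) X"
  proof (rule mod_hom_restrictI[OF F.left_module_axioms])
    fix v assume v: "v \<in> carrier (free_module R I)"
    show "h v \<in> carrier X" unfolding h_def using supp[OF v] x
      by (intro X.M.finsum_closed) (auto intro!: X.smult_closed)
  next
    fix v w assume v: "v \<in> carrier (free_module R I)" and w: "w \<in> carrier (free_module R I)"
    let ?J = "{i. v i \<noteq> \<zero>\<^bsub>R\<^esub>} \<union> {i. w i \<noteq> \<zero>\<^bsub>R\<^esub>}"
    have J: "finite ?J" "?J \<subseteq> I" using supp[OF v] supp[OF w] by auto
    have "h (v \<oplus>\<^bsub>free_module R I\<^esub> w) = finsum X (\<lambda>i. (v i \<oplus>\<^bsub>R\<^esub> w i) \<odot>\<^bsub>X\<^esub> x i) ?J"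
      using v w by (subst expand[OF _ J(1) _ J(2)]) (auto simp: free_module_def intro: finite_subset[OF _ J(1)])
    also have "\<dots> = finsum X (\<lambda>i. v i \<odot>\<^bsub>X\<^esub> x i \<oplus>\<^bsub>X\<^esub> w i \<odot>\<^bsub>X\<^esub> x i) ?J"
      using J x supp[OF v] supp[OF w]
      by (intro X.M.finsum_cong') (auto simp: X.smult_l_distr intro!: X.smult_closed X.M.a_closed)
    also have "\<dots> = h v \<oplus>\<^bsub>X\<^esub> h w"
      using J x supp[OF v] supp[OF w]
      by (subst X.M.finsum_addf) (auto simp: expand[OF v J(1) _ J(2)] expand[OF w J(1) _ J(2)] intro!: X.smult_closed)
    finally show "h (v \<oplus>\<^bsub>free_module R I\<^esub> w) = h v \<oplus>\<^bsub>X\<^esub> h w" .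
  next
    fix a v assume a: "a \<in> carrier R" and v: "v \<in> carrier (free_module R I)"
    let ?J = "{i. v i \<noteq> \<zero>\<^bsub>R\<^esub>}"
    have "h (a \<odot>\<^bsub>free_module R I\<^esub> v) = finsum X (\<lambda>i. (a \<otimes>\<^bsub>R\<^esub> v i) \<odot>\<^bsub>X\<^esub> x i) ?J"
      using supp[OF v] a F.smult_closed[OF a v]
      by (subst expand[of _ ?J]) (auto simp: free_module_def)
    also have "\<dots> = finsum X (\<lambda>i. a \<odot>\<^bsub>X\<^esub> (v i \<odot>\<^bsub>X\<^esub> x i)) ?J"
      using x supp[OF v] a by (intro X.M.finsum_cong') (auto simp: X.smult_assoc intro!: X.smult_closed)
    also have "\<dots> = a \<odot>\<^bsub>X\<^esub> h v"
      unfolding h_def using x supp[OF v] a by (subst X.smult_finsum) (auto intro!: X.smult_closed)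
    finally show "h (a \<odot>\<^bsub>free_module R I\<^esub> v) = a \<odot>\<^bsub>X\<^esub> h v" .
  qed
  moreover have "h (unit_vector R i) = x i" if "i \<in> I" for i
    using that x unit_vector_closed[OF R that]
    by (subst expand[of _ "{i}"]) (auto simp: unit_vector_def X.smult_one X.smult_closed)
  ultimately show ?thesis by (intro bexI[of _ "restrict h (carrier (free_module R I))"]) (auto simp: unit_vector_closed[OF R])
qed

lemma projective_module_left_module: "projective_module R P \<Longrightarrow> left_module R P"
  by (simp add: projective_module_def)

text \<open>
  Choose preimages for the images of a basis of the free module of which \<open>P\<close> is a summand.
\<close>

lemma projective_lift:
  fixes P :: "('a, 'm, 'c) module_scheme"
  assumes P: "projective_module R P" and X: "left_module R X" and Y: "left_module R Y"
    and f: "f \<in> mod_hom R P Y" and g: "g \<in> mod_hom R X Y"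
    and im: "f ` carrier P \<subseteq> g ` carrier X"
  shows "\<exists>h \<in> mod_hom R P X. \<forall>p \<in> carrier P. g (h p) = f p"
proof -
  interpret P: left_module R P using P by (rule projective_module_left_module)
  interpret X: left_module R X by fact
  interpret Y: left_module R Y by fact
  have R: "ring R" by (rule P.ring_axioms)
  obtain I :: "'m set" and s r where s: "s \<in> mod_hom R P (free_module R I)"
    and r: "r \<in> mod_hom R (free_module R I) P" and rs: "\<And>x. x \<in> carrier P \<Longrightarrow> r (s x) = x"
    using P unfolding projective_module_def by blast
  interpret F: left_module R "free_module R I" by (rule left_module_free[OF R])
  have "\<exists>x. \<forall>i\<in>I. x i \<in> carrier X \<and> g (x i) = f (r (unit_vector R i))"
  proof (rule bchoice, rule ballI)
    fix i assume "i \<in> I"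
    then have "r (unit_vector R i) \<in> carrier P"
      by (intro mod_hom_closed[OF r] unit_vector_closed[OF R])
    then have "f (r (unit_vector R i)) \<in> g ` carrier X" using im by blast
    then show "\<exists>x. x \<in> carrier X \<and> g x = f (r (unit_vector R i))" by (metis imageE)
  qed
  then obtain x where x: "\<And>i. i \<in> I \<Longrightarrow> x i \<in> carrier X" "\<And>i. i \<in> I \<Longrightarrow> g (x i) = f (r (unit_vector R i))" by blast
  obtain h where h: "h \<in> mod_hom R (free_module R I) X" "\<And>i. i \<in> I \<Longrightarrow> h (unit_vector R i) = x i"
    using free_module_hom_exists[OF R X, of I x] x(1) by blast
  have fr: "compose (carrier (free_module R I)) f r \<in> mod_hom R (free_module R I) Y"
    by (rule mod_hom_compose[OF F.left_module_axioms r f])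
  have gh: "compose (carrier (free_module R I)) g h \<in> mod_hom R (free_module R I) Y"
    by (rule mod_hom_compose[OF F.left_module_axioms h(1) g])
  have agree: "g (h v) = f (r v)" if v: "v \<in> carrier (free_module R I)" for v
  proof -
    let ?J = "{i. v i \<noteq> \<zero>\<^bsub>R\<^esub>}"
    have J: "finite ?J" "?J \<subseteq> I" and vc: "\<And>i. v i \<in> carrier R" using v by (auto simp: free_module_def)
    have "compose (carrier (free_module R I)) g h v
       = finsum Y (\<lambda>i. v i \<odot>\<^bsub>Y\<^esub> compose (carrier (free_module R I)) g h (unit_vector R i)) ?J"
      by (rule free_module_hom_expand[OF R Y gh J v]) auto
    also have "\<dots> = finsum Y (\<lambda>i. v i \<odot>\<^bsub>Y\<^esub> compose (carrier (free_module R I)) f r (unit_vector R i)) ?J"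
    proof (rule Y.M.finsum_cong')
      fix i assume "i \<in> ?J"
      then have i: "i \<in> I" using J(2) by blast
      note u = unit_vector_closed[OF R i]
      show "v i \<odot>\<^bsub>Y\<^esub> compose (carrier (free_module R I)) g h (unit_vector R i)
          = v i \<odot>\<^bsub>Y\<^esub> compose (carrier (free_module R I)) f r (unit_vector R i)"
        using u h(2)[OF i] x(2)[OF i] by (simp add: compose_def)
    next
      show "(\<lambda>i. v i \<odot>\<^bsub>Y\<^esub> compose (carrier (free_module R I)) f r (unit_vector R i)) \<in> ?J \<rightarrow> carrier Y"
        using J(2) vc by (intro Pi_I Y.smult_closed mod_hom_closed[OF fr] unit_vector_closed[OF R]) auto
    qed simp
    also have "\<dots> = compose (carrier (free_module R I)) f r v"
      by (rule free_module_hom_expand[OF R Y fr J v, symmetric]) auto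
    finally show ?thesis using v by (simp add: compose_def)
  qed
  show ?thesis
  proof (rule bexI, rule ballI)
    show "compose (carrier P) h s \<in> mod_hom R P X"
      by (rule mod_hom_compose[OF P.left_module_axioms s h(1)])
    show "g (compose (carrier P) h s p) = f p" if "p \<in> carrier P" for p
      using that agree[OF mod_hom_closed[OF s that]] rs by (simp add: compose_def)
  qed
qed

section \<open>Ext does not depend on the resolution\<close>

text \<open>
  The syzygies of \<open>M\<close>.  The kernel of the augmentation \<open>e\<close> counts as degree \<open>0\<close>, so that in every
  degree \<open>n\<close> the cycles are the image of \<open>d n\<close>.
\<close>

fun cycles where
  "cycles M P d e 0 = {x \<in> carrier (P 0). e x = \<zero>\<^bsub>M\<^esub>}"
| "cycles M P d e (Suc n) = {x \<in> carrier (P (Suc n)). d n x = \<zero>\<^bsub>P n\<^esub>}"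

lemma cycles_subset: "cycles M P d e n \<subseteq> carrier (P n)" by (cases n) auto

lemma resolution_boundaries:
  assumes "projective_resolution R M P d e"
  shows "d n ` carrier (P (Suc n)) = cycles M P d e n"
  using assms by (cases n) (auto simp: projective_resolution_def)

lemma resolution_projective: "projective_resolution R M P d e \<Longrightarrow> projective_module R (P n)"
  by (auto simp: projective_resolution_def)

lemma resolution_hom: "projective_resolution R M P d e \<Longrightarrow> d n \<in> mod_hom R (P (Suc n)) (P n)"
  by (auto simp: projective_resolution_def)

lemma chain_map_step:
  assumes P: "projective_resolution R M P d e" and P': "projective_resolution R M P' d' e'"
    and \<phi>: "\<phi> \<in> mod_hom R (P n) (P' n)" "\<phi> ` cycles M P d e n \<subseteq> cycles M P' d' e' n"
  obtains \<psi> where "\<psi> \<in> mod_hom R (P (Suc n)) (P' (Suc n))"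
    "\<psi> ` cycles M P d e (Suc n) \<subseteq> cycles M P' d' e' (Suc n)"
    "\<And>x. x \<in> carrier (P (Suc n)) \<Longrightarrow> d' n (\<psi> x) = \<phi> (d n x)"
proof -
  note lm = projective_module_left_module[OF resolution_projective]
  interpret P: left_module R "P n" by (rule lm[OF P])
  interpret P': left_module R "P' n" by (rule lm[OF P'])
  note d = resolution_hom[OF P, of n] and d' = resolution_hom[OF P', of n]
  have h: "compose (carrier (P (Suc n))) \<phi> (d n) \<in> mod_hom R (P (Suc n)) (P' n)"
    by (rule mod_hom_compose[OF lm[OF P] d \<phi>(1)])
  have im: "compose (carrier (P (Suc n))) \<phi> (d n) ` carrier (P (Suc n)) \<subseteq> d' n ` carrier (P' (Suc n))"
    unfolding resolution_boundaries[OF P'] using \<phi>(2) resolution_boundaries[OF P, of n]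
    by (auto simp: compose_def)
  obtain \<psi> where \<psi>: "\<psi> \<in> mod_hom R (P (Suc n)) (P' (Suc n))"
    "\<forall>x \<in> carrier (P (Suc n)). d' n (\<psi> x) = compose (carrier (P (Suc n))) \<phi> (d n) x"
    by (rule bexE[OF projective_lift[OF resolution_projective[OF P] lm[OF P'] lm[OF P'] h d' im]])
  show ?thesis
  proof
    show "\<psi> ` cycles M P d e (Suc n) \<subseteq> cycles M P' d' e' (Suc n)"
      using \<psi> mod_hom_closed[OF \<psi>(1)] P.mod_hom_zero[OF P'.M.abelian_group_axioms \<phi>(1)] by (auto simp: compose_def)
  qed (use \<psi> in \<open>auto simp: compose_def\<close>)
qed

lemma chain_map_base:
  assumes P: "projective_resolution R M P d e" and P': "projective_resolution R M P' d' e'"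
    and M: "left_module R M"
  obtains \<phi> where "\<phi> \<in> mod_hom R (P 0) (P' 0)" "\<phi> ` cycles M P d e 0 \<subseteq> cycles M P' d' e' 0"
    "\<And>x. x \<in> carrier (P 0) \<Longrightarrow> e' (\<phi> x) = e x"
proof -
  note lm = projective_module_left_module[OF resolution_projective]
  have e: "e \<in> mod_hom R (P 0) M" "e ` carrier (P 0) = carrier M"
    and e': "e' \<in> mod_hom R (P' 0) M" "e' ` carrier (P' 0) = carrier M"
    using P P' by (auto simp: projective_resolution_def)
  have "e ` carrier (P 0) \<subseteq> e' ` carrier (P' 0)" by (simp add: e(2) e'(2))
  from projective_lift[OF resolution_projective[OF P] lm[OF P'] M e(1) e'(1) this]
  obtain \<phi> where "\<phi> \<in> mod_hom R (P 0) (P' 0)" "\<And>x. x \<in> carrier (P 0) \<Longrightarrow> e' (\<phi> x) = e x" by blast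
  then show ?thesis using that[of \<phi>] mod_hom_closed[of \<phi> R "P 0" "P' 0"] by (auto simp: image_subset_iff)
qed

text \<open>
  One degree of a pair of inverse homotopy equivalences.  The homotopy formula is required only on
  cycles, where its second term vanishes; so each degree refers to no other one, and plain induction
  replaces the construction of whole chain maps.
\<close>

lemma resolutions_homotopic:
  assumes P: "projective_resolution R M P d e" and P': "projective_resolution R M P' d' e'"
    and M: "left_module R M"
  shows "\<exists>\<phi> \<psi> s. \<phi> \<in> mod_hom R (P n) (P' n) \<and> \<psi> \<in> mod_hom R (P' n) (P n) \<and>
     s \<in> mod_hom R (P n) (P (Suc n)) \<and>
     \<phi> ` cycles M P d e n \<subseteq> cycles M P' d' e' n \<and> \<psi> ` cycles M P' d' e' n \<subseteq> cycles M P d e n \<and>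
     (\<forall>x \<in> cycles M P d e n. d n (s x) = x \<ominus>\<^bsub>P n\<^esub> \<psi> (\<phi> x))"
proof (induction n)
  note lm = projective_module_left_module[OF resolution_projective]
  interpret M: left_module R M by fact
  {
    case 0
    interpret P: left_module R "P 0" by (rule lm[OF P])
    interpret P1: left_module R "P 1" by (rule lm[OF P])
    have e: "e \<in> mod_hom R (P 0) M" using P by (auto simp: projective_resolution_def)
    obtain \<phi> where \<phi>: "\<phi> \<in> mod_hom R (P 0) (P' 0)" "\<phi> ` cycles M P d e 0 \<subseteq> cycles M P' d' e' 0"
      "\<And>x. x \<in> carrier (P 0) \<Longrightarrow> e' (\<phi> x) = e x"
      using chain_map_base[OF P P' M] by blast
    obtain \<psi> where \<psi>: "\<psi> \<in> mod_hom R (P' 0) (P 0)" "\<psi> ` cycles M P' d' e' 0 \<subseteq> cycles M P d e 0"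
      "\<And>x. x \<in> carrier (P' 0) \<Longrightarrow> e (\<psi> x) = e' x"
      using chain_map_base[OF P' P M] by blast
    define F where "F = (\<lambda>x. x \<ominus>\<^bsub>P 0\<^esub> \<psi> (\<phi> x))"
    have c: "\<psi> (\<phi> x) \<in> carrier (P 0)" if "x \<in> carrier (P 0)" for x
      using that mod_hom_closed[OF \<phi>(1)] mod_hom_closed[OF \<psi>(1)] by blast
    have "restrict F (carrier (P 0)) =
        (\<lambda>x\<in>carrier (P 0). (\<lambda>x\<in>carrier (P 0). x) x \<ominus>\<^bsub>P 0\<^esub> compose (carrier (P 0)) \<psi> \<phi> x)"
      by (auto simp: F_def compose_def intro!: restrict_ext)
    then have f: "restrict F (carrier (P 0)) \<in> mod_hom R (P 0) (P 0)"
      using mod_hom_pointwise_diff[OF lm[OF P] lm[OF P] mod_hom_id[OF lm[OF P]] mod_hom_compose[OF lm[OF P] \<phi>(1) \<psi>(1)]]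
      by simp
    have "e (F x) = \<zero>\<^bsub>M\<^esub>" "F x \<in> carrier (P 0)" if x: "x \<in> carrier (P 0)" for x
      using x c[OF x] \<phi>(3)[OF x] \<psi>(3)[OF mod_hom_closed[OF \<phi>(1) x]] mod_hom_closed[OF e x]
      by (simp_all add: F_def P.mod_hom_diff[OF M.M.abelian_group_axioms e] M.M.minus_eq M.M.r_neg)
    then have im: "restrict F (carrier (P 0)) ` carrier (P 0) \<subseteq> d 0 ` carrier (P (Suc 0))"
      unfolding resolution_boundaries[OF P, of 0] by auto
    obtain s where s: "s \<in> mod_hom R (P 0) (P (Suc 0))"
      "\<forall>x \<in> carrier (P 0). d 0 (s x) = restrict F (carrier (P 0)) x"
      by (rule bexE[OF projective_lift[OF resolution_projective[OF P] lm[OF P] lm[OF P] f resolution_hom[OF P, of 0] im]])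
    have hs: "d 0 (s x) = x \<ominus>\<^bsub>P 0\<^esub> \<psi> (\<phi> x)" if "x \<in> cycles M P d e 0" for x
      using s(2) that by (simp add: F_def)
    show ?case
      by (intro exI[of _ \<phi>] exI[of _ \<psi>] exI[of _ s] conjI ballI \<phi>(1,2) \<psi>(1,2) s(1) hs)
  next
    case (Suc n)
    interpret P: left_module R "P n" by (rule lm[OF P])
    interpret P1: left_module R "P (Suc n)" by (rule lm[OF P])
    interpret P2: left_module R "P (Suc (Suc n))" by (rule lm[OF P])
    interpret P': left_module R "P' n" by (rule lm[OF P'])
    note d = resolution_hom[OF P]
    obtain \<phi> \<psi> s where IH: "\<phi> \<in> mod_hom R (P n) (P' n)" "\<psi> \<in> mod_hom R (P' n) (P n)"
      "s \<in> mod_hom R (P n) (P (Suc n))" "\<phi> ` cycles M P d e n \<subseteq> cycles M P' d' e' n"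
      "\<psi> ` cycles M P' d' e' n \<subseteq> cycles M P d e n"
      "\<forall>x \<in> cycles M P d e n. d n (s x) = x \<ominus>\<^bsub>P n\<^esub> \<psi> (\<phi> x)"
      using Suc.IH by (elim exE conjE) (rule that)
    obtain \<phi>' where \<phi>': "\<phi>' \<in> mod_hom R (P (Suc n)) (P' (Suc n))"
      "\<phi>' ` cycles M P d e (Suc n) \<subseteq> cycles M P' d' e' (Suc n)"
      "\<And>x. x \<in> carrier (P (Suc n)) \<Longrightarrow> d' n (\<phi>' x) = \<phi> (d n x)"
      using chain_map_step[OF P P' IH(1,4)] by blast
    obtain \<psi>' where \<psi>': "\<psi>' \<in> mod_hom R (P' (Suc n)) (P (Suc n))"
      "\<psi>' ` cycles M P' d' e' (Suc n) \<subseteq> cycles M P d e (Suc n)"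
      "\<And>x. x \<in> carrier (P' (Suc n)) \<Longrightarrow> d n (\<psi>' x) = \<psi> (d' n x)"
      using chain_map_step[OF P' P IH(2,5)] by blast
    define F where "F = (\<lambda>x. (x \<ominus>\<^bsub>P (Suc n)\<^esub> \<psi>' (\<phi>' x)) \<ominus>\<^bsub>P (Suc n)\<^esub> s (d n x))"
    have c: "\<psi>' (\<phi>' x) \<in> carrier (P (Suc n))" "s (d n x) \<in> carrier (P (Suc n))"
      if "x \<in> carrier (P (Suc n))" for x
      using that mod_hom_closed[OF \<phi>'(1)] mod_hom_closed[OF \<psi>'(1)] mod_hom_closed[OF d] mod_hom_closed[OF IH(3)] by blast+
    have "restrict F (carrier (P (Suc n))) = (\<lambda>x\<in>carrier (P (Suc n)). (\<lambda>x\<in>carrier (P (Suc n)).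
        (\<lambda>x\<in>carrier (P (Suc n)). x) x \<ominus>\<^bsub>P (Suc n)\<^esub> compose (carrier (P (Suc n))) \<psi>' \<phi>' x) x
          \<ominus>\<^bsub>P (Suc n)\<^esub> compose (carrier (P (Suc n))) s (d n) x)"
      by (auto simp: F_def compose_def intro!: restrict_ext)
    then have f: "restrict F (carrier (P (Suc n))) \<in> mod_hom R (P (Suc n)) (P (Suc n))"
      using mod_hom_pointwise_diff[OF lm[OF P] lm[OF P] mod_hom_pointwise_diff[OF lm[OF P] lm[OF P]
          mod_hom_id[OF lm[OF P]] mod_hom_compose[OF lm[OF P] \<phi>'(1) \<psi>'(1)]]
          mod_hom_compose[OF lm[OF P] d IH(3)]]
      by simp
    have dF: "d n (F x) = \<zero>\<^bsub>P n\<^esub>" if x: "x \<in> carrier (P (Suc n))" for x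
    proof -
      have dx: "d n x \<in> cycles M P d e n" using x resolution_boundaries[OF P, of n] by auto
      have "d n (F x) = (d n x \<ominus>\<^bsub>P n\<^esub> \<psi> (\<phi> (d n x))) \<ominus>\<^bsub>P n\<^esub> (d n x \<ominus>\<^bsub>P n\<^esub> \<psi> (\<phi> (d n x)))"
        using x c[OF x] \<psi>'(3)[OF mod_hom_closed[OF \<phi>'(1) x]] \<phi>'(3)[OF x] bspec[OF IH(6) dx]
        by (simp add: F_def P1.mod_hom_diff[OF P.M.abelian_group_axioms d])
      also have "\<dots> = \<zero>\<^bsub>P n\<^esub>"
        using x mod_hom_closed[OF d x] mod_hom_closed[OF IH(1)] mod_hom_closed[OF IH(2)]
        by (simp add: P.M.minus_eq P.M.r_neg)
      finally show ?thesis .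
    qed
    have im: "restrict F (carrier (P (Suc n))) ` carrier (P (Suc n)) \<subseteq> d (Suc n) ` carrier (P (Suc (Suc n)))"
      unfolding resolution_boundaries[OF P, of "Suc n"]
    proof
      fix y assume "y \<in> restrict F (carrier (P (Suc n))) ` carrier (P (Suc n))"
      then obtain x where x: "x \<in> carrier (P (Suc n))" "y = F x" by auto
      then show "y \<in> cycles M P d e (Suc n)" using dF[OF x(1)] c[OF x(1)] by (simp add: F_def)
    qed
    obtain s' where s': "s' \<in> mod_hom R (P (Suc n)) (P (Suc (Suc n)))"
      "\<forall>x \<in> carrier (P (Suc n)). d (Suc n) (s' x) = restrict F (carrier (P (Suc n))) x"
      by (rule bexE[OF projective_lift[OF resolution_projective[OF P] lm[OF P] lm[OF P] f resolution_hom[OF P, of "Suc n"] im]])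
    have hs: "d (Suc n) (s' x) = x \<ominus>\<^bsub>P (Suc n)\<^esub> \<psi>' (\<phi>' x)" if x: "x \<in> cycles M P d e (Suc n)" for x
    proof -
      have "x \<in> carrier (P (Suc n))" "d n x = \<zero>\<^bsub>P n\<^esub>" using x by auto
      then show ?thesis
        using s'(2) c[of x] P.mod_hom_zero[OF P1.M.abelian_group_axioms IH(3)]
        by (simp add: F_def P1.M.minus_eq)
    qed
    show ?case
      by (intro exI[of _ \<phi>'] exI[of _ \<psi>'] exI[of _ s'] conjI ballI \<phi>'(1,2) \<psi>'(1,2) s'(1) hs)
  }
qed

lemma trivial_factor_group:
  assumes "group G" "H = carrier G" shows "trivial_group (G Mod H)"
proof -
  interpret group G by fact
  have n: "carrier G \<lhd> G"
    by (simp add: normal_inv_iff subgroup_self)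
  have "carrier (G Mod carrier G) = {carrier G}"
    using coset_join2[OF _ subgroup_self] by (auto simp: FactGroup_def RCOSETS_def)
  then show ?thesis
    unfolding trivial_group_def assms(2) using normal.factorgroup_is_group[OF n]
    by (simp add: FactGroup_def)
qed

lemma hom_cohomology_trivial:
  assumes P: "\<And>n. left_module R (P n)" and d: "\<And>n. d n \<in> mod_hom R (P (Suc n)) (P n)"
    and N: "left_module R N"
    and eq: "coboundaries R P d N i = cocycles R P d N i"
  shows "trivial_group (hom_cohomology R P d N i)"
  unfolding hom_cohomology_def
proof (rule trivial_factor_group)
  interpret N: left_module R N by fact
  interpret P: left_module R "P i" by fact
  interpret P1: left_module R "P (Suc i)" by fact
  note d = d[of i]
  let ?G = "(hom_group R (P i) N)\<lparr>carrier := cocycles R P d N i\<rparr>"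
  have z: "(\<lambda>x\<in>carrier (P i). \<zero>\<^bsub>N\<^esub>) \<in> mod_hom R (P i) N"
    by (rule mod_hom_restrictI[OF P]) (auto simp: N.smult_zero_right)
  have m: "(\<lambda>x\<in>carrier (P i). \<ominus>\<^bsub>N\<^esub> f x) \<in> mod_hom R (P i) N" if f: "f \<in> mod_hom R (P i) N" for f
  proof (rule mod_hom_restrictI[OF P])
    fix a x assume "a \<in> carrier R" "x \<in> carrier (P i)"
    then show "\<ominus>\<^bsub>N\<^esub> f (a \<odot>\<^bsub>P i\<^esub> x) = a \<odot>\<^bsub>N\<^esub> (\<ominus>\<^bsub>N\<^esub> f x)"
      using N.smult_diff[of a "\<zero>\<^bsub>N\<^esub>" "f x"] mod_hom_closed[OF f]
      by (simp add: mod_hom_smult[OF f] N.M.minus_eq N.smult_zero_right N.smult_closed)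
  qed (auto simp: mod_hom_closed[OF f] mod_hom_add[OF f] N.M.minus_add)
  note a = mod_hom_pointwise_add[OF P N]
  show "group ?G"
  proof (rule groupI)
    fix f assume f: "f \<in> carrier ?G"
    then have fh: "f \<in> mod_hom R (P i) N" by (simp add: cocycles_def)
    have "(\<lambda>x\<in>carrier (P i). \<ominus>\<^bsub>N\<^esub> f x) \<in> carrier ?G"
      using f m[OF fh] mod_hom_closed[OF d] by (simp add: cocycles_def)
    moreover have "(\<lambda>x\<in>carrier (P i). \<ominus>\<^bsub>N\<^esub> f x) \<otimes>\<^bsub>?G\<^esub> f = \<one>\<^bsub>?G\<^esub>"
      using mod_hom_closed[OF fh] by (auto simp: hom_group_def N.M.l_neg)
    ultimately show "\<exists>g\<in>carrier ?G. g \<otimes>\<^bsub>?G\<^esub> f = \<one>\<^bsub>?G\<^esub>" by blast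
  next
    fix f assume f: "f \<in> carrier ?G"
    then have fh: "f \<in> mod_hom R (P i) N" by (simp add: cocycles_def)
    then have "f \<in> extensional (carrier (P i))" by (auto simp: mod_hom_def PiE_def)
    then show "\<one>\<^bsub>?G\<^esub> \<otimes>\<^bsub>?G\<^esub> f = f"
      using mod_hom_closed[OF fh] by (auto simp: hom_group_def extensional_def fun_eq_iff)
  qed (use z a mod_hom_closed[OF d] in \<open>auto simp: cocycles_def hom_group_def mod_hom_closed N.M.a_assoc intro!: restrict_ext\<close>)
  show "coboundaries R P d N i = carrier ?G" using eq by simp
qed

text \<open>
  A cocycle \<open>f\<close> of degree \<open>n + 1\<close> for an arbitrary resolution is a homomorphism on its cycles of
  degree \<open>n\<close>.  Pulled back along \<open>\<psi>\<close> it is defined on the cycles of the given resolution, where it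
  extends to some \<open>g\<close> by hypothesis; then \<open>g \<phi> + f s\<close> extends \<open>f\<close>, by the homotopy formula.
\<close>

lemma Ext_trivial:
  fixes R :: "('a, 'b) ring_scheme" and P' :: "nat \<Rightarrow> ('a, nat \<Rightarrow> 'a) module"
  assumes P': "projective_resolution R M P' d' e'" and M: "left_module R M" and N: "left_module R N"
    and ext: "\<And>n f. f \<in> mod_hom R (P' n\<lparr>carrier := cycles M P' d' e' n\<rparr>) N \<Longrightarrow>
      \<exists>g \<in> mod_hom R (P' n) N. \<forall>x \<in> cycles M P' d' e' n. g x = f x"
    and "i \<ge> 1"
  shows "trivial_group (Ext R M N i)"
proof -
  note lm = projective_module_left_module[OF resolution_projective]
  obtain n where i: "i = Suc n" using \<open>i \<ge> 1\<close> by (cases i) auto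
  define Pd :: "(nat \<Rightarrow> ('a, nat \<Rightarrow> 'a) module) \<times> (nat \<Rightarrow> (nat \<Rightarrow> 'a) \<Rightarrow> nat \<Rightarrow> 'a)"
    where "Pd = (SOME (P, d). \<exists>e. projective_resolution R M P d e)"
  obtain P d where Pd: "Pd = (P, d)" by (cases Pd)
  have "case Pd of (P, d) \<Rightarrow> \<exists>e. projective_resolution R M P d e"
    unfolding Pd_def by (rule someI[of _ "(P', d')"]) (use P' in auto)
  then obtain e where P: "projective_resolution R M P d e" using Pd by auto
  interpret N: left_module R N by fact
  interpret Pn: left_module R "P n" by (rule lm[OF P])
  interpret Pn1: left_module R "P (Suc n)" by (rule lm[OF P])
  interpret Pn2: left_module R "P (Suc (Suc n))" by (rule lm[OF P])
  interpret P'n: left_module R "P' n" by (rule lm[OF P'])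
  note d = resolution_hom[OF P]
  note bd = resolution_boundaries[OF P]
  have dd: "d n (d (Suc n) x) = \<zero>\<^bsub>P n\<^esub>" if "x \<in> carrier (P (Suc (Suc n)))" for x
    using that bd[of "Suc n"] by auto
  have "coboundaries R P d N i = cocycles R P d N i"
  proof (rule equalityI; rule subsetI)
    fix f assume "f \<in> coboundaries R P d N i"
    then obtain g where g: "g \<in> mod_hom R (P n) N" "f = compose (carrier (P (Suc n))) g (d n)"
      by (auto simp: i)
    show "f \<in> cocycles R P d N i"
      unfolding i cocycles_def g(2) using mod_hom_compose[OF lm[OF P] d[of n] g(1)] mod_hom_closed[OF d] dd Pn.mod_hom_zero[OF N.M.abelian_group_axioms g(1)]
      by (auto simp: compose_def)
  next
    fix f assume "f \<in> cocycles R P d N i"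
    then have f: "f \<in> mod_hom R (P (Suc n)) N" and fd: "\<And>x. x \<in> carrier (P (Suc (Suc n))) \<Longrightarrow> f (d (Suc n) x) = \<zero>\<^bsub>N\<^esub>"
      by (auto simp: i cocycles_def)
    have fker: "f x = f y" if x: "x \<in> carrier (P (Suc n))" and y: "y \<in> carrier (P (Suc n))" and e: "d n x = d n y" for x y
    proof -
      have "d n (x \<ominus>\<^bsub>P (Suc n)\<^esub> y) = \<zero>\<^bsub>P n\<^esub>"
        using x y e mod_hom_closed[OF d] by (simp add: Pn1.mod_hom_diff[OF Pn.M.abelian_group_axioms d] Pn.M.minus_eq Pn.M.r_neg)
      then have "x \<ominus>\<^bsub>P (Suc n)\<^esub> y \<in> cycles M P d e (Suc n)" using x y by simp
      then have "f (x \<ominus>\<^bsub>P (Suc n)\<^esub> y) = \<zero>\<^bsub>N\<^esub>" using bd[of "Suc n"] fd by (metis imageE)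
      then have "\<zero>\<^bsub>N\<^esub> = f x \<oplus>\<^bsub>N\<^esub> \<ominus>\<^bsub>N\<^esub> f y" using x y
        by (simp add: Pn1.mod_hom_diff[OF N.M.abelian_group_axioms f] N.M.minus_eq)
      then show ?thesis using x y mod_hom_closed[OF f] N.M.add.inv_solve_right[of "\<zero>\<^bsub>N\<^esub>" "f x" "f y"]
        by simp
    qed
    \<comment> \<open>By \<open>fker\<close>, composing \<open>f\<close> with a choice \<open>p\<close> of preimages under \<open>d n\<close> gives a homomorphism on the cycles.\<close>
    obtain \<phi> \<psi> s where H: "\<phi> \<in> mod_hom R (P n) (P' n)" "\<psi> \<in> mod_hom R (P' n) (P n)"
      "s \<in> mod_hom R (P n) (P (Suc n))" "\<phi> ` cycles M P d e n \<subseteq> cycles M P' d' e' n"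
      "\<psi> ` cycles M P' d' e' n \<subseteq> cycles M P d e n"
      "\<forall>x \<in> cycles M P d e n. d n (s x) = x \<ominus>\<^bsub>P n\<^esub> \<psi> (\<phi> x)"
      using resolutions_homotopic[OF P P' M, of n] by (elim exE conjE) (rule that)
    have lift: "\<exists>p. \<forall>x \<in> cycles M P d e n. p x \<in> carrier (P (Suc n)) \<and> d n (p x) = x"
      by (rule bchoice) (auto simp: bd[symmetric])
    then obtain p where p: "\<And>x. x \<in> cycles M P d e n \<Longrightarrow> p x \<in> carrier (P (Suc n))"
      "\<And>x. x \<in> cycles M P d e n \<Longrightarrow> d n (p x) = x" by blast
    let ?Z = "P' n\<lparr>carrier := cycles M P' d' e' n\<rparr>"
    have Zc: "cycles M P' d' e' n \<subseteq> carrier (P' n)" by (rule cycles_subset)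
    have cyc_closed: "x \<oplus>\<^bsub>P' n\<^esub> y \<in> cycles M P' d' e' n" "a \<odot>\<^bsub>P' n\<^esub> x \<in> cycles M P' d' e' n"
      if xy: "x \<in> cycles M P' d' e' n" "y \<in> cycles M P' d' e' n" "a \<in> carrier R" for x y a
    proof -
      interpret P'1: left_module R "P' (Suc n)" by (rule lm[OF P'])
      obtain x' y' where "x = d' n x'" "x' \<in> carrier (P' (Suc n))" "y = d' n y'" "y' \<in> carrier (P' (Suc n))"
        using xy(1,2) unfolding resolution_boundaries[OF P', symmetric] by blast
      then show "x \<oplus>\<^bsub>P' n\<^esub> y \<in> cycles M P' d' e' n" "a \<odot>\<^bsub>P' n\<^esub> x \<in> cycles M P' d' e' n"
        unfolding resolution_boundaries[OF P', symmetric] using xy(3)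
          mod_hom_add[OF resolution_hom[OF P', of n], of x' y'] mod_hom_smult[OF resolution_hom[OF P', of n], of a x']
          P'1.smult_closed[of a x'] P'1.M.a_closed[of x' y']
        by (metis imageI)+
    qed
    have \<psi>c: "\<psi> x \<in> cycles M P d e n" if "x \<in> cycles M P' d' e' n" for x using that H(5) by auto
    have "\<zero>\<^bsub>P' n\<^esub> \<in> cycles M P' d' e' n"
      unfolding resolution_boundaries[OF P', symmetric]
      using left_module.mod_hom_zero[OF lm[OF P'] P'n.M.abelian_group_axioms resolution_hom[OF P', of n]]
        abelian_group.axioms(1)[OF left_module.axioms(2)[OF lm[OF P', of "Suc n"]], THEN abelian_monoid.zero_closed]
      by (metis imageI)
    then have Zmod: "left_module R ?Z"
      using left_module_submodule[OF lm[OF P'] Zc] cyc_closed by blast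
    have "restrict (\<lambda>x. f (p (\<psi> x))) (carrier ?Z) \<in> mod_hom R ?Z N"
    proof (rule mod_hom_restrictI[OF Zmod])
      fix x y assume "x \<in> carrier ?Z" "y \<in> carrier ?Z"
      then have x: "x \<in> cycles M P' d' e' n" and y: "y \<in> cycles M P' d' e' n" by simp_all
      have "f (p (\<psi> (x \<oplus>\<^bsub>P' n\<^esub> y))) = f (p (\<psi> x) \<oplus>\<^bsub>P (Suc n)\<^esub> p (\<psi> y))"
      proof (rule fker)
        note xy = \<psi>c[OF cyc_closed(1)[OF x y N.R.one_closed]]
        show "p (\<psi> (x \<oplus>\<^bsub>P' n\<^esub> y)) \<in> carrier (P (Suc n))" by (rule p(1)[OF xy])
        show "d n (p (\<psi> (x \<oplus>\<^bsub>P' n\<^esub> y))) = d n (p (\<psi> x) \<oplus>\<^bsub>P (Suc n)\<^esub> p (\<psi> y))"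
          using p(2)[OF xy] p[OF \<psi>c[OF x]] p[OF \<psi>c[OF y]] subsetD[OF Zc x] subsetD[OF Zc y]
          by (simp add: mod_hom_add[OF d] mod_hom_add[OF H(2)])
      qed (use p(1)[OF \<psi>c[OF x]] p(1)[OF \<psi>c[OF y]] in simp)
      then show "f (p (\<psi> (x \<oplus>\<^bsub>?Z\<^esub> y))) = f (p (\<psi> x)) \<oplus>\<^bsub>N\<^esub> f (p (\<psi> y))"
        using x y \<psi>c p by (simp add: mod_hom_add[OF f])
    next
      fix a x assume a: "a \<in> carrier R" and "x \<in> carrier ?Z"
      then have x: "x \<in> cycles M P' d' e' n" by simp
      have "f (p (\<psi> (a \<odot>\<^bsub>P' n\<^esub> x))) = f (a \<odot>\<^bsub>P (Suc n)\<^esub> p (\<psi> x))"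
      proof (rule fker)
        note ax = \<psi>c[OF cyc_closed(2)[OF x x a]]
        show "p (\<psi> (a \<odot>\<^bsub>P' n\<^esub> x)) \<in> carrier (P (Suc n))" by (rule p(1)[OF ax])
        show "d n (p (\<psi> (a \<odot>\<^bsub>P' n\<^esub> x))) = d n (a \<odot>\<^bsub>P (Suc n)\<^esub> p (\<psi> x))"
          using p(2)[OF ax] p[OF \<psi>c[OF x]] subsetD[OF Zc x] a
          by (simp add: mod_hom_smult[OF d] mod_hom_smult[OF H(2)])
      qed (use p(1)[OF \<psi>c[OF x]] a in \<open>simp add: Pn1.smult_closed\<close>)
      then show "f (p (\<psi> (a \<odot>\<^bsub>?Z\<^esub> x))) = a \<odot>\<^bsub>N\<^esub> f (p (\<psi> x))"
        using x a \<psi>c p by (simp add: mod_hom_smult[OF f])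
    qed (use \<psi>c p mod_hom_closed[OF f] in simp)
    from ext[OF this] obtain g where g: "g \<in> mod_hom R (P' n) N"
      "\<And>x. x \<in> cycles M P' d' e' n \<Longrightarrow> g x = f (p (\<psi> x))" by auto
    let ?h = "\<lambda>x. g (\<phi> x) \<oplus>\<^bsub>N\<^esub> f (s x)"
    have "restrict ?h (carrier (P n)) =
        (\<lambda>x\<in>carrier (P n). compose (carrier (P n)) g \<phi> x \<oplus>\<^bsub>N\<^esub> compose (carrier (P n)) f s x)"
      by (auto simp: compose_def intro!: restrict_ext)
    then have h: "restrict ?h (carrier (P n)) \<in> mod_hom R (P n) N"
      using mod_hom_pointwise_add[OF lm[OF P] N mod_hom_compose[OF lm[OF P] H(1) g(1)] mod_hom_compose[OF lm[OF P] H(3) f]]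
      by simp
    have "?h (d n y) = f y" if y: "y \<in> carrier (P (Suc n))" for y
    proof -
      let ?x = "d n y"
      have x: "?x \<in> cycles M P d e n" using y bd[of n] by auto
      then have xc: "?x \<in> carrier (P n)" by (rule subsetD[OF cycles_subset])
      have \<phi>x: "\<phi> ?x \<in> cycles M P' d' e' n" using x H(4) by auto
      have px: "\<psi> (\<phi> ?x) \<in> cycles M P d e n" by (rule \<psi>c[OF \<phi>x])
      then have pc: "\<psi> (\<phi> ?x) \<in> carrier (P n)" by (rule subsetD[OF cycles_subset])
      have sc: "s ?x \<in> carrier (P (Suc n))" using xc mod_hom_closed[OF H(3)] by blast
      have "?h ?x = f (p (\<psi> (\<phi> ?x)) \<oplus>\<^bsub>P (Suc n)\<^esub> s ?x)"
        using g(2)[OF \<phi>x] p[OF px] sc by (simp add: mod_hom_add[OF f])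
      also have "\<dots> = f y"
      proof (rule fker)
        have "d n (p (\<psi> (\<phi> ?x)) \<oplus>\<^bsub>P (Suc n)\<^esub> s ?x) = \<psi> (\<phi> ?x) \<oplus>\<^bsub>P n\<^esub> (?x \<ominus>\<^bsub>P n\<^esub> \<psi> (\<phi> ?x))"
          using p[OF px] sc bspec[OF H(6) x] by (simp add: mod_hom_add[OF d])
        also have "\<dots> = ?x" using xc pc by (simp add: Pn.M.minus_eq Pn.M.a_ac Pn.M.r_neg1 Pn.M.r_neg)
        finally show "d n (p (\<psi> (\<phi> ?x)) \<oplus>\<^bsub>P (Suc n)\<^esub> s ?x) = d n y" .
      qed (use y p[OF px] sc in auto)
      finally show ?thesis .
    qed
    then have "f = compose (carrier (P (Suc n))) (restrict ?h (carrier (P n))) (d n)"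
      using mod_hom_closed[OF d] by (intro mod_hom_eqI[OF f mod_hom_compose[OF lm[OF P] d h]]) (simp add: compose_def)
    then show "f \<in> coboundaries R P d N i" using h by (auto simp: i)
  qed
  then have "trivial_group (hom_cohomology R P d N i)"
    by (intro hom_cohomology_trivial lm[OF P] N d)
  moreover have "Ext R M N i = hom_cohomology R P d N i"
    unfolding Ext_def Pd_def[symmetric] Pd by simp
  ultimately show ?thesis by simp
qed

section \<open>Resolutions over a corner of a ring\<close>

lemma finsum_pointwise:
  assumes G: "abelian_monoid G" and R: "abelian_monoid R"
    and z: "\<zero>\<^bsub>G\<^esub> = (\<lambda>i. \<zero>\<^bsub>R\<^esub>)" and a: "\<And>v w. v \<oplus>\<^bsub>G\<^esub> w = (\<lambda>i. v i \<oplus>\<^bsub>R\<^esub> w i)"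
    and F: "F \<in> J \<rightarrow> carrier G" and c: "\<And>v i. v \<in> carrier G \<Longrightarrow> v i \<in> carrier R"
  shows "finsum G F J i = finsum R (\<lambda>j. F j i) J"
proof -
  interpret G: abelian_monoid G by fact
  interpret R: abelian_monoid R by fact
  show ?thesis
  proof (cases "finite J")
    case True
    from this F show ?thesis
    proof (induction J rule: finite_induct)
      case (insert j J)
      then have "F j \<in> carrier G" "F \<in> J \<rightarrow> carrier G" by auto
      moreover from this have "F j i \<in> carrier R" "(\<lambda>j. F j i) \<in> J \<rightarrow> carrier R" using c by (auto simp: Pi_iff)
      ultimately show ?case using insert by (simp add: a)
    qed (simp add: z)
  qed (simp add: z)
qed

lemma (in abelian_monoid) finsum_swap:
  assumes "finite I" "finite J" "\<And>i j. i \<in> I \<Longrightarrow> j \<in> J \<Longrightarrow> f i j \<in> carrier G"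
  shows "finsum G (\<lambda>i. finsum G (f i) J) I = finsum G (\<lambda>j. finsum G (\<lambda>i. f i j) I) J"
  using assms(1,3)
proof (induction I rule: finite_induct)
  case empty
  show ?case by simp
next
  case (insert i I)
  have "finsum G (\<lambda>i. finsum G (f i) J) (insert i I) = finsum G (f i) J \<oplus> finsum G (\<lambda>i. finsum G (f i) J) I"
    using insert by (intro finsum_insert) (auto intro!: finsum_closed)
  also have "\<dots> = finsum G (f i) J \<oplus> finsum G (\<lambda>j. finsum G (\<lambda>i. f i j) I) J"
    using insert by simp
  also have "\<dots> = finsum G (\<lambda>j. f i j \<oplus> finsum G (\<lambda>i. f i j) I) J"
    using insert by (intro finsum_addf[symmetric]) (auto intro!: finsum_closed)
  also have "\<dots> = finsum G (\<lambda>j. finsum G (\<lambda>i. f i j) (insert i I)) J"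
    using insert by (intro finsum_cong') (auto intro!: finsum_closed)
  finally show ?case .
qed

lemma (in abelian_monoid) finsum_in_subset:
  assumes "Z \<subseteq> carrier G" "\<zero> \<in> Z" "\<And>x y. x \<in> Z \<Longrightarrow> y \<in> Z \<Longrightarrow> x \<oplus> y \<in> Z" "F \<in> J \<rightarrow> Z"
  shows "finsum G F J \<in> Z"
proof (cases "finite J")
  case True
  from this assms(4) show ?thesis
  proof (induction J rule: finite_induct)
    case (insert j J)
    then have "F j \<in> Z" "F \<in> J \<rightarrow> Z" by auto
    then show ?case using insert assms(1,3) by (subst finsum_insert) (auto simp: Pi_iff)
  qed (simp add: assms(2))
qed (simp add: assms(2))

definition corner :: "('a, 'b) ring_scheme \<Rightarrow> 'a \<Rightarrow> 'a set" where
  "corner R e = {b \<in> carrier R. e \<otimes>\<^bsub>R\<^esub> b = b \<and> b \<otimes>\<^bsub>R\<^esub> e = b}"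

definition corner_submodule :: "('a, 'b) ring_scheme \<Rightarrow> 'a \<Rightarrow> nat \<Rightarrow> (nat \<Rightarrow> 'a) set \<Rightarrow> bool" where
  "corner_submodule R e n Z \<longleftrightarrow>
     (\<forall>w \<in> Z. (\<forall>i. w i \<in> corner R e) \<and> (\<forall>i\<ge>n. w i = \<zero>\<^bsub>R\<^esub>)) \<and>
     (\<lambda>i. \<zero>\<^bsub>R\<^esub>) \<in> Z \<and> (\<forall>v \<in> Z. \<forall>w \<in> Z. (\<lambda>i. v i \<oplus>\<^bsub>R\<^esub> w i) \<in> Z) \<and>
     (\<forall>b \<in> corner R e. \<forall>w \<in> Z. (\<lambda>i. b \<otimes>\<^bsub>R\<^esub> w i) \<in> Z)"

text \<open>
  A ring with an idempotent \<open>e\<close> for which the corner \<open>e R e\<close> governs homomorphisms from \<open>R e\<close> to \<open>R\<close>.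
  The families \<open>\<alpha>\<close> and \<open>L\<close> are a dual basis of \<open>R e\<close> as a right module over the corner, which is thus
  finitely generated projective; \<open>corner_noetherian\<close> says that the corner is left Noetherian, and
  \<open>corner_injective\<close> that \<open>e R\<close> is injective as a left module over it, tested on submodules of free
  modules of finite rank.
\<close>

locale corner_data = ring R for R :: "('a, 'b) ring_scheme" (structure) +
  fixes e :: 'a and X :: "'x set" and \<alpha> :: "'x \<Rightarrow> 'a" and L :: "'x \<Rightarrow> 'a \<Rightarrow> 'a"
  assumes one_neq_zero: "\<one> \<noteq> \<zero>"
    and e_closed: "e \<in> carrier R" and e_idem: "e \<otimes> e = e"
    and X: "finite X" and \<alpha>_closed: "x \<in> X \<Longrightarrow> \<alpha> x \<in> carrier R"
    and L_corner: "x \<in> X \<Longrightarrow> a \<in> carrier R \<Longrightarrow> a \<otimes> e = a \<Longrightarrow> L x a \<in> corner R e"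
    and L_add: "x \<in> X \<Longrightarrow> a \<in> carrier R \<Longrightarrow> a \<otimes> e = a \<Longrightarrow> b \<in> carrier R \<Longrightarrow> b \<otimes> e = b \<Longrightarrow>
       L x (a \<oplus> b) = L x a \<oplus> L x b"
    and L_mult: "x \<in> X \<Longrightarrow> a \<in> carrier R \<Longrightarrow> a \<otimes> e = a \<Longrightarrow> b \<in> corner R e \<Longrightarrow>
       L x (a \<otimes> b) = L x a \<otimes> b"
    and L_expand: "a \<in> carrier R \<Longrightarrow> a \<otimes> e = a \<Longrightarrow> (\<Oplus>x\<in>X. \<alpha> x \<otimes> L x a) = a"
    and corner_noetherian: "corner_submodule R e n Z \<Longrightarrow>
       \<exists>ws. set ws \<subseteq> Z \<and> (\<forall>w\<in>Z. \<exists>b. (\<forall>j. b j \<in> corner R e) \<and>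
          (\<forall>i. w i = (\<Oplus>j\<in>{..<length ws}. b j \<otimes> (ws ! j) i)))"
    and corner_injective: "corner_submodule R e n Z \<Longrightarrow> \<forall>w\<in>Z. f w \<in> carrier R \<and> e \<otimes> f w = f w \<Longrightarrow>
       \<forall>v\<in>Z. \<forall>w\<in>Z. f (\<lambda>i. v i \<oplus> w i) = f v \<oplus> f w \<Longrightarrow>
       \<forall>b\<in>corner R e. \<forall>w\<in>Z. f (\<lambda>i. b \<otimes> w i) = b \<otimes> f w \<Longrightarrow>
       \<exists>c. (\<forall>i. c i \<in> carrier R) \<and> (\<forall>w\<in>Z. f w = (\<Oplus>i\<in>{..<n}. w i \<otimes> c i))"
begin

lemma corner_closed: "b \<in> corner R e \<Longrightarrow> b \<in> carrier R"
  and corner_right: "b \<in> corner R e \<Longrightarrow> b \<otimes> e = b"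
  by (auto simp: corner_def)

lemma L_zero: "x \<in> X \<Longrightarrow> L x \<zero> = \<zero>"
  using L_add[of x \<zero> \<zero>] corner_closed[OF L_corner[of x \<zero>]] e_closed
    add.l_cancel_one'[of "L x \<zero>" "L x \<zero>"] by simp

lemma L_finsum:
  assumes x: "x \<in> X" and "finite J" "\<And>j. j \<in> J \<Longrightarrow> F j \<in> carrier R" "\<And>j. j \<in> J \<Longrightarrow> F j \<otimes> e = F j"
  shows "L x (\<Oplus>j\<in>J. F j) = (\<Oplus>j\<in>J. L x (F j))"
  using assms(2-)
proof (induction J rule: finite_induct)
  case (insert j J)
  have c: "F \<in> J \<rightarrow> carrier R" "F j \<in> carrier R" using insert by auto
  have "(\<Oplus>j\<in>J. F j) \<otimes> e = (\<Oplus>j\<in>J. F j \<otimes> e)" by (rule finsum_ldistr[OF insert(1) e_closed c(1)])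
  also have "\<dots> = (\<Oplus>j\<in>J. F j)" using insert c by (intro finsum_cong') auto
  finally have e: "(\<Oplus>j\<in>J. F j) \<otimes> e = (\<Oplus>j\<in>J. F j)" .
  have "(\<lambda>j. L x (F j)) \<in> J \<rightarrow> carrier R" "L x (F j) \<in> carrier R"
    using insert.prems by (auto intro!: corner_closed[OF L_corner[OF x]])
  then show ?case using insert c e by (simp add: L_add[OF x])
qed (simp add: L_zero x)

text \<open>
  The n-th power of \<open>R e\<close>.  Its elements are sequences, not families on a set of \<open>n\<close> indices, so that the
  terms of a resolution have a common type.
\<close>

definition Q :: "nat \<Rightarrow> ('a, nat \<Rightarrow> 'a) module" where
  "Q n = (free_module R {..<n})\<lparr>carrier := {v. (\<forall>i. v i \<in> carrier R \<and> v i \<otimes> e = v i) \<and> (\<forall>i\<ge>n. v i = \<zero>)}\<rparr>"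

lemma Q_carrier: "carrier (Q n) = {v. (\<forall>i. v i \<in> carrier R \<and> v i \<otimes> e = v i) \<and> (\<forall>i\<ge>n. v i = \<zero>)}"
  and Q_zero: "\<zero>\<^bsub>Q n\<^esub> = (\<lambda>i. \<zero>)"
  and Q_add: "v \<oplus>\<^bsub>Q n\<^esub> w = (\<lambda>i. v i \<oplus> w i)"
  and Q_smult: "a \<odot>\<^bsub>Q n\<^esub> w = (\<lambda>i. a \<otimes> w i)"
  by (simp_all add: Q_def free_module_def)

lemma Q_in_free: "carrier (Q n) \<subseteq> carrier (free_module R {..<n})"
proof
  fix v assume v: "v \<in> carrier (Q n)"
  have "finite {i. v i \<noteq> \<zero>}"
    by (rule finite_subset[of _ "{..<n}"]) (use v in \<open>auto simp: Q_carrier not_le[symmetric]\<close>)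
  then show "v \<in> carrier (free_module R {..<n})" using v by (auto simp: Q_carrier free_module_def)
qed

lemma Q_left_module: "left_module R (Q n)"
  unfolding Q_def
proof (rule left_module_submodule[OF left_module_free[OF ring_axioms]])
  show "{v. (\<forall>i. v i \<in> carrier R \<and> v i \<otimes> e = v i) \<and> (\<forall>i\<ge>n. v i = \<zero>)} \<subseteq> carrier (free_module R {..<n})"
    using Q_in_free by (simp add: Q_carrier)
qed (auto simp: free_module_def l_distr m_assoc e_closed)

text \<open>
  The basis has to consist of elements of the type of \<open>Q n\<close> itself; the unit vectors are used, which
  are distinct because \<open>1\<close> and \<open>0\<close> are.
\<close>

lemma Q_projective: "projective_module R (Q n)"
proof -
  have inj: "inj (unit_vector R :: nat \<Rightarrow> nat \<Rightarrow> 'a)"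
    using one_neq_zero by (auto simp: inj_def unit_vector_def fun_eq_iff split: if_splits)
  define I where "I = (unit_vector R :: nat \<Rightarrow> nat \<Rightarrow> 'a) ` {..<n}"
  define s where "s v = (\<lambda>w. if w \<in> I then v (the_inv (unit_vector R) w) else \<zero>)" for v :: "nat \<Rightarrow> 'a"
  define r where "r f = (\<lambda>i. if i < n then f (unit_vector R i) \<otimes> e else \<zero>)" for f :: "(nat \<Rightarrow> 'a) \<Rightarrow> 'a"
  have finI: "finite I" by (simp add: I_def)
  have supp: "finite {w. s v w \<noteq> \<zero>}" for v
    by (rule finite_subset[OF _ finI]) (auto simp: s_def)
  have sc: "s v \<in> carrier (free_module R I)" if "v \<in> carrier (Q n)" for v
    using that supp[of v] by (auto simp: free_module_def s_def Q_carrier)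
  have s: "restrict s (carrier (Q n)) \<in> mod_hom R (Q n) (free_module R I)"
    by (rule mod_hom_restrictI[OF Q_left_module])
      (simp_all add: sc, simp_all add: free_module_def Q_add Q_smult s_def fun_eq_iff)
  have r: "restrict r (carrier (free_module R I)) \<in> mod_hom R (free_module R I) (Q n)"
    by (rule mod_hom_restrictI[OF left_module_free[OF ring_axioms]])
      (auto simp: free_module_def Q_carrier Q_add Q_smult r_def fun_eq_iff e_closed l_distr m_assoc e_idem)
  have rs: "r (s v) = v" if "v \<in> carrier (Q n)" for v
    using that by (auto simp: r_def s_def I_def Q_carrier fun_eq_iff the_inv_f_f[OF inj])
  show ?thesis unfolding projective_module_def
  proof (intro conjI exI ballI)
    show "restrict s (carrier (Q n)) \<in> mod_hom R (Q n) (free_module R I)" by (rule s)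
    show "restrict r (carrier (free_module R I)) \<in> mod_hom R (free_module R I) (Q n)" by (rule r)
  qed (simp_all add: Q_left_module sc rs)
qed

text \<open>
  The homomorphism that sends the j-th copy of \<open>e\<close> to \<open>e y_j\<close>.
\<close>

definition comb :: "('a, 'n, 'c) module_scheme \<Rightarrow> nat \<Rightarrow> (nat \<Rightarrow> 'n) \<Rightarrow> (nat \<Rightarrow> 'a) \<Rightarrow> 'n" where
  "comb N m y = (\<lambda>v\<in>carrier (Q m). \<Oplus>\<^bsub>N\<^esub>j\<in>{..<m}. v j \<odot>\<^bsub>N\<^esub> y j)"

lemma comb_hom:
  assumes N: "left_module R N" and y: "\<And>j. j < m \<Longrightarrow> y j \<in> carrier N"
  shows "comb N m y \<in> mod_hom R (Q m) N"
  unfolding comb_def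
proof (rule mod_hom_restrictI[OF Q_left_module])
  interpret N: left_module R N by fact
  have c: "v j \<odot>\<^bsub>N\<^esub> y j \<in> carrier N" if "v \<in> carrier (Q m)" "j < m" for v j
    using that y by (auto simp: Q_carrier intro!: N.smult_closed)
  show "(\<Oplus>\<^bsub>N\<^esub>j\<in>{..<m}. v j \<odot>\<^bsub>N\<^esub> y j) \<in> carrier N" if "v \<in> carrier (Q m)" for v
    using that c by (intro N.M.finsum_closed) auto
  show "(\<Oplus>\<^bsub>N\<^esub>j\<in>{..<m}. (v \<oplus>\<^bsub>Q m\<^esub> w) j \<odot>\<^bsub>N\<^esub> y j)
     = (\<Oplus>\<^bsub>N\<^esub>j\<in>{..<m}. v j \<odot>\<^bsub>N\<^esub> y j) \<oplus>\<^bsub>N\<^esub> (\<Oplus>\<^bsub>N\<^esub>j\<in>{..<m}. w j \<odot>\<^bsub>N\<^esub> y j)"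
    if v: "v \<in> carrier (Q m)" and w: "w \<in> carrier (Q m)" for v w
  proof -
    have "(\<Oplus>\<^bsub>N\<^esub>j\<in>{..<m}. (v \<oplus>\<^bsub>Q m\<^esub> w) j \<odot>\<^bsub>N\<^esub> y j)
       = (\<Oplus>\<^bsub>N\<^esub>j\<in>{..<m}. v j \<odot>\<^bsub>N\<^esub> y j \<oplus>\<^bsub>N\<^esub> w j \<odot>\<^bsub>N\<^esub> y j)"
    proof (rule N.M.finsum_cong')
      fix j assume "j \<in> {..<m}"
      then show "(v \<oplus>\<^bsub>Q m\<^esub> w) j \<odot>\<^bsub>N\<^esub> y j = v j \<odot>\<^bsub>N\<^esub> y j \<oplus>\<^bsub>N\<^esub> w j \<odot>\<^bsub>N\<^esub> y j"
        using v w y by (simp add: Q_add Q_carrier N.smult_l_distr)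
    qed (use c[OF v] c[OF w] in auto)
    also have "\<dots> = (\<Oplus>\<^bsub>N\<^esub>j\<in>{..<m}. v j \<odot>\<^bsub>N\<^esub> y j) \<oplus>\<^bsub>N\<^esub> (\<Oplus>\<^bsub>N\<^esub>j\<in>{..<m}. w j \<odot>\<^bsub>N\<^esub> y j)"
      using c[OF v] c[OF w] by (intro N.M.finsum_addf) auto
    finally show ?thesis .
  qed
  show "(\<Oplus>\<^bsub>N\<^esub>j\<in>{..<m}. (a \<odot>\<^bsub>Q m\<^esub> v) j \<odot>\<^bsub>N\<^esub> y j) = a \<odot>\<^bsub>N\<^esub> (\<Oplus>\<^bsub>N\<^esub>j\<in>{..<m}. v j \<odot>\<^bsub>N\<^esub> y j)"
    if a: "a \<in> carrier R" and v: "v \<in> carrier (Q m)" for a v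
  proof -
    have "(\<Oplus>\<^bsub>N\<^esub>j\<in>{..<m}. (a \<odot>\<^bsub>Q m\<^esub> v) j \<odot>\<^bsub>N\<^esub> y j) = (\<Oplus>\<^bsub>N\<^esub>j\<in>{..<m}. a \<odot>\<^bsub>N\<^esub> (v j \<odot>\<^bsub>N\<^esub> y j))"
    proof (rule N.M.finsum_cong')
      fix j assume "j \<in> {..<m}"
      then show "(a \<odot>\<^bsub>Q m\<^esub> v) j \<odot>\<^bsub>N\<^esub> y j = a \<odot>\<^bsub>N\<^esub> (v j \<odot>\<^bsub>N\<^esub> y j)"
        using a v y by (simp add: Q_smult Q_carrier N.smult_assoc)
    qed (use N.smult_closed[OF a c[OF v]] in auto)
    also have "\<dots> = a \<odot>\<^bsub>N\<^esub> (\<Oplus>\<^bsub>N\<^esub>j\<in>{..<m}. v j \<odot>\<^bsub>N\<^esub> y j)"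
      using c[OF v] a by (intro N.smult_finsum[symmetric]) auto
    finally show ?thesis .
  qed
qed

lemma comb_Q:
  assumes w: "\<And>j. j < m \<Longrightarrow> w j \<in> carrier (Q n)" and v: "v \<in> carrier (Q m)"
  shows "comb (Q n) m w v i = (\<Oplus>j\<in>{..<m}. v j \<otimes> w j i)"
proof -
  interpret Qn: left_module R "Q n" by (rule Q_left_module)
  have "comb (Q n) m w v i = (\<Oplus>\<^bsub>Q n\<^esub>j\<in>{..<m}. v j \<odot>\<^bsub>Q n\<^esub> w j) i"
    using v by (simp add: comb_def)
  also have "\<dots> = (\<Oplus>j\<in>{..<m}. (v j \<odot>\<^bsub>Q n\<^esub> w j) i)"
    using v w by (intro finsum_pointwise Qn.M.abelian_monoid_axioms abelian_monoid_axioms)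
      (auto simp: Q_zero Q_add Q_carrier Q_smult m_assoc e_closed)
  finally show ?thesis by (simp add: Q_smult)
qed

text \<open>
  The submodules \<open>Z\<close> of \<open>Q n\<close> that are generated by \<open>e Z\<close>.  Closure under the maps \<open>L x\<close> expresses
  this without mentioning generators: they send \<open>Z\<close> into \<open>e Z\<close>, and an element is recovered from its
  images by multiplication with the \<open>\<alpha> x\<close>.
\<close>

definition corner_generated :: "nat \<Rightarrow> (nat \<Rightarrow> 'a) set \<Rightarrow> bool" where
  "corner_generated n Z \<longleftrightarrow> Z \<subseteq> carrier (Q n) \<and> (\<lambda>i. \<zero>) \<in> Z \<and>
     (\<forall>v\<in>Z. \<forall>w\<in>Z. (\<lambda>i. v i \<oplus> w i) \<in> Z) \<and> (\<forall>a\<in>carrier R. \<forall>v\<in>Z. (\<lambda>i. a \<otimes> v i) \<in> Z) \<and>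
     (\<forall>x\<in>X. \<forall>v\<in>Z. (\<lambda>i. L x (v i)) \<in> Z)"

definition corner_part :: "(nat \<Rightarrow> 'a) set \<Rightarrow> (nat \<Rightarrow> 'a) set" where
  "corner_part Z = {w \<in> Z. \<forall>i. w i \<in> corner R e}"

lemma corner_part_submodule:
  assumes "corner_generated n Z" shows "corner_submodule R e n (corner_part Z)"
  using assms
  by (auto simp: corner_generated_def corner_submodule_def corner_part_def Q_carrier corner_def
      e_closed r_distr l_distr m_assoc subset_iff)
    (simp_all add: m_assoc[symmetric] e_closed)

lemma L_corner_part:
  assumes "corner_generated n Z" "x \<in> X" "v \<in> Z"
  shows "(\<lambda>i. L x (v i)) \<in> corner_part Z"
proof -
  have "v \<in> carrier (Q n)" using assms(1,3) by (auto simp: corner_generated_def)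
  then have "L x (v i) \<in> corner R e" for i using assms(2) by (auto simp: Q_carrier intro: L_corner)
  then show ?thesis using assms by (auto simp: corner_generated_def corner_part_def)
qed

text \<open>
  Generators of \<open>e Z\<close> over the corner generate \<open>Z\<close>, by the expansion of \<open>v\<close> as the sum of the
  \<open>\<alpha> x \<otimes> L x v\<close>.
\<close>

lemma corner_generated_finite:
  assumes Z: "corner_generated n Z"
  shows "\<exists>ws. set ws \<subseteq> corner_part Z \<and> Z = comb (Q n) (length ws) ((!) ws) ` carrier (Q (length ws))"
proof -
  interpret Qn: left_module R "Q n" by (rule Q_left_module)
  have ZQ: "Z \<subseteq> carrier (Q n)" using Z by (simp add: corner_generated_def)
  obtain ws where ws: "set ws \<subseteq> corner_part Z"
    and gen: "\<forall>w\<in>corner_part Z. \<exists>b. (\<forall>j. b j \<in> corner R e) \<and>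
          (\<forall>i. w i = (\<Oplus>j\<in>{..<length ws}. b j \<otimes> (ws ! j) i))"
    using corner_noetherian[OF corner_part_submodule[OF Z]] by auto
  let ?m = "length ws"
  have wsZ: "ws ! j \<in> Z" if "j < ?m" for j
    using ws nth_mem[OF that] by (auto simp: corner_part_def)
  then have wsQ: "ws ! j \<in> carrier (Q n)" if "j < ?m" for j using ZQ that by auto
  then have wsc: "(ws ! j) i \<in> carrier R" if "j < ?m" for j i using that by (auto simp: Q_carrier)
  have "Z = comb (Q n) ?m ((!) ws) ` carrier (Q ?m)"
  proof (rule equalityI; rule subsetI)
    fix v assume "v \<in> comb (Q n) ?m ((!) ws) ` carrier (Q ?m)"
    then obtain u where u: "u \<in> carrier (Q ?m)" "v = comb (Q n) ?m ((!) ws) u" by auto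
    have "v = (\<Oplus>\<^bsub>Q n\<^esub>j\<in>{..<?m}. u j \<odot>\<^bsub>Q n\<^esub> ws ! j)" using u by (simp add: comb_def)
    also have "\<dots> \<in> Z"
    proof (rule Qn.M.finsum_in_subset[OF ZQ])
      show "(\<lambda>j. u j \<odot>\<^bsub>Q n\<^esub> ws ! j) \<in> {..<?m} \<rightarrow> Z"
        using u(1) wsZ Z by (auto simp: Q_smult Q_carrier corner_generated_def)
    qed (use Z in \<open>auto simp: corner_generated_def Q_zero Q_add\<close>)
    finally show "v \<in> Z" .
  next
    fix v assume v: "v \<in> Z"
    then have vi: "v i \<in> carrier R" "v i \<otimes> e = v i" for i using ZQ by (auto simp: Q_carrier)
    have "\<forall>x\<in>X. \<exists>b. (\<forall>j. b j \<in> corner R e) \<and> (\<forall>i. L x (v i) = (\<Oplus>j\<in>{..<?m}. b j \<otimes> (ws ! j) i))"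
      using gen L_corner_part[OF Z _ v] by (intro ballI) (drule bspec, assumption, simp)
    then obtain b where b: "\<And>x j. x \<in> X \<Longrightarrow> b x j \<in> corner R e"
      "\<And>x i. x \<in> X \<Longrightarrow> L x (v i) = (\<Oplus>j\<in>{..<?m}. b x j \<otimes> (ws ! j) i)"
      by (subst (asm) bchoice_iff) blast
    have bc: "b x j \<in> carrier R" "b x j \<otimes> e = b x j" if "x \<in> X" for x j
      using corner_closed[OF b(1)[OF that]] corner_right[OF b(1)[OF that]] .
    define u where "u j = (if j < ?m then \<Oplus>x\<in>X. \<alpha> x \<otimes> b x j else \<zero>)" for j
    have uc: "(\<Oplus>x\<in>X. \<alpha> x \<otimes> b x j) \<in> carrier R" for j
      using \<alpha>_closed bc by (intro finsum_closed) auto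
    have "(\<Oplus>x\<in>X. \<alpha> x \<otimes> b x j) \<otimes> e = (\<Oplus>x\<in>X. \<alpha> x \<otimes> b x j)" for j
    proof -
      have "(\<Oplus>x\<in>X. \<alpha> x \<otimes> b x j) \<otimes> e = (\<Oplus>x\<in>X. \<alpha> x \<otimes> b x j \<otimes> e)"
        using \<alpha>_closed bc X e_closed by (intro finsum_ldistr) auto
      also have "\<dots> = (\<Oplus>x\<in>X. \<alpha> x \<otimes> b x j)"
        using \<alpha>_closed bc e_closed by (intro finsum_cong') (auto simp: m_assoc)
      finally show ?thesis .
    qed
    then have u: "u \<in> carrier (Q ?m)" using uc e_closed by (auto simp: Q_carrier u_def)
    have "comb (Q n) ?m ((!) ws) u i = v i" for i
    proof -
      have "comb (Q n) ?m ((!) ws) u i = (\<Oplus>j\<in>{..<?m}. u j \<otimes> (ws ! j) i)"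
        by (rule comb_Q[OF wsQ u])
      also have "\<dots> = (\<Oplus>j\<in>{..<?m}. \<Oplus>x\<in>X. \<alpha> x \<otimes> (b x j \<otimes> (ws ! j) i))"
      proof (rule finsum_cong'[OF refl])
        fix j assume j: "j \<in> {..<?m}"
        then have "u j \<otimes> (ws ! j) i = (\<Oplus>x\<in>X. \<alpha> x \<otimes> b x j \<otimes> (ws ! j) i)"
          using \<alpha>_closed bc wsc X by (simp add: u_def) (intro finsum_ldistr, auto)
        also have "\<dots> = (\<Oplus>x\<in>X. \<alpha> x \<otimes> (b x j \<otimes> (ws ! j) i))"
          using \<alpha>_closed bc wsc j by (intro finsum_cong') (auto simp: m_assoc)
        finally show "u j \<otimes> (ws ! j) i = (\<Oplus>x\<in>X. \<alpha> x \<otimes> (b x j \<otimes> (ws ! j) i))" .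
      qed (use \<alpha>_closed bc wsc in \<open>auto intro!: finsum_closed\<close>)
      also have "\<dots> = (\<Oplus>x\<in>X. \<Oplus>j\<in>{..<?m}. \<alpha> x \<otimes> (b x j \<otimes> (ws ! j) i))"
        using \<alpha>_closed bc wsc X by (intro finsum_swap) auto
      also have "\<dots> = (\<Oplus>x\<in>X. \<alpha> x \<otimes> L x (v i))"
      proof (rule finsum_cong'[OF refl])
        fix x assume x: "x \<in> X"
        show "(\<Oplus>j\<in>{..<?m}. \<alpha> x \<otimes> (b x j \<otimes> (ws ! j) i)) = \<alpha> x \<otimes> L x (v i)"
          unfolding b(2)[OF x] using \<alpha>_closed bc wsc x by (intro finsum_rdistr[symmetric]) auto
      qed (use \<alpha>_closed corner_closed[OF L_corner[OF _ vi]] in auto)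
      also have "\<dots> = v i" by (rule L_expand[OF vi])
      finally show ?thesis .
    qed
    then have "comb (Q n) ?m ((!) ws) u = v" by blast
    then show "v \<in> comb (Q n) ?m ((!) ws) ` carrier (Q ?m)" using u by blast
  qed
  then show ?thesis using ws by blast
qed

text \<open>
  The maps \<open>L x\<close> are right linear over the corner, so, applied to coordinates, they commute with a
  homomorphism whose matrix has entries in the corner.
\<close>

lemma corner_generated_kernel:
  assumes w: "\<And>j. j < m \<Longrightarrow> w j \<in> carrier (Q n)" "\<And>i j. j < m \<Longrightarrow> w j i \<in> corner R e"
  shows "corner_generated m {u \<in> carrier (Q m). comb (Q n) m w u = \<zero>\<^bsub>Q n\<^esub>}"
proof -
  interpret Qm: left_module R "Q m" by (rule Q_left_module)
  interpret Qn: left_module R "Q n" by (rule Q_left_module)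
  have h: "comb (Q n) m w \<in> mod_hom R (Q m) (Q n)" by (rule comb_hom[OF Q_left_module w(1)])
  let ?Z = "{u \<in> carrier (Q m). comb (Q n) m w u = \<zero>\<^bsub>Q n\<^esub>}"
  have L: "(\<lambda>i. L x (u i)) \<in> ?Z" if x: "x \<in> X" and u: "u \<in> ?Z" for x u
  proof -
    have uc: "u j \<in> carrier R" "u j \<otimes> e = u j" for j using u by (auto simp: Q_carrier)
    have lc: "L x (u j) \<in> corner R e" for j using L_corner[OF x uc] .
    have lu: "(\<lambda>i. L x (u i)) \<in> carrier (Q m)"
      using u L_zero[OF x] corner_closed[OF lc] corner_right[OF lc] by (auto simp: Q_carrier)
    have "comb (Q n) m w (\<lambda>i. L x (u i)) i = \<zero>" for i
    proof -
      have uw: "u j \<otimes> w j i \<in> carrier R" "u j \<otimes> w j i \<otimes> e = u j \<otimes> w j i" if "j \<in> {..<m}" for j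
        using that uc(1) corner_closed[OF w(2)] corner_right[OF w(2)] e_closed by (auto simp: m_assoc)
      have "comb (Q n) m w (\<lambda>i. L x (u i)) i = (\<Oplus>j\<in>{..<m}. L x (u j) \<otimes> w j i)"
        by (rule comb_Q[OF w(1) lu])
      also have "\<dots> = (\<Oplus>j\<in>{..<m}. L x (u j \<otimes> w j i))"
        using w(2) corner_closed[OF w(2)] corner_closed[OF lc]
        by (intro finsum_cong') (auto simp: L_mult[OF x uc])
      also have "\<dots> = L x (\<Oplus>j\<in>{..<m}. u j \<otimes> w j i)"
        by (rule L_finsum[OF x _ uw, symmetric]) auto
      also have "(\<Oplus>j\<in>{..<m}. u j \<otimes> w j i) = comb (Q n) m w u i"
        by (rule comb_Q[OF w(1), symmetric]) (use u in auto)
      also have "\<dots> = \<zero>" using u by (simp add: Q_zero)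
      finally show ?thesis by (simp add: L_zero[OF x])
    qed
    then show ?thesis using lu by (auto simp: Q_zero)
  qed
  have z: "(\<lambda>i. \<zero>) \<in> ?Z"
    using Qm.mod_hom_zero[OF Qn.M.abelian_group_axioms h] Qm.M.zero_closed by (simp add: Q_zero)
  have a: "(\<lambda>i. u i \<oplus> v i) \<in> ?Z" if "u \<in> ?Z" "v \<in> ?Z" for u v
    using that mod_hom_add[OF h, of u v] Qm.M.a_closed[of u v] Qn.M.zero_closed by (simp add: Q_add Q_zero)
  have s: "(\<lambda>i. a \<otimes> u i) \<in> ?Z" if "u \<in> ?Z" "a \<in> carrier R" for u a
    using that mod_hom_smult[OF h, of a u] Qm.smult_closed[of a u] Qn.smult_zero_right[of a] by (simp add: Q_smult)
  show ?thesis unfolding corner_generated_def using z a s L by blast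
qed

text \<open>
  On \<open>e Z\<close> the homomorphism takes values in \<open>e R\<close>, so there it is right multiplication by a column, by
  injectivity of \<open>e R\<close>.  As \<open>e Z\<close> generates \<open>Z\<close>, the same column describes it on \<open>Z\<close>.
\<close>

lemma corner_generated_extend:
  assumes Z: "corner_generated n Z" and f: "f \<in> mod_hom R (Q n\<lparr>carrier := Z\<rparr>) (regular_module R)"
  shows "\<exists>g \<in> mod_hom R (Q n) (regular_module R). \<forall>v\<in>Z. g v = f v"
proof -
  have ZQ: "Z \<subseteq> carrier (Q n)" using Z by (simp add: corner_generated_def)
  have ZM: "left_module R (Q n\<lparr>carrier := Z\<rparr>)"
    by (rule left_module_submodule[OF Q_left_module ZQ])
      (use Z in \<open>auto simp: corner_generated_def Q_zero Q_add Q_smult\<close>)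
  interpret Z: left_module R "Q n\<lparr>carrier := Z\<rparr>" by (rule ZM)
  have reg: "left_module R (regular_module R)" by (rule left_module_regular[OF ring_axioms])
  interpret reg: left_module R "regular_module R" by (rule reg)
  have fc: "f v \<in> carrier R" if "v \<in> Z" for v
    using mod_hom_closed[OF f, of v] that by (simp add: regular_module_def)
  have fa: "f (\<lambda>i. v i \<oplus> w i) = f v \<oplus> f w" if "v \<in> Z" "w \<in> Z" for v w
    using mod_hom_add[OF f, of v w] that by (simp add: regular_module_def Q_add)
  have fs: "f (\<lambda>i. a \<otimes> v i) = a \<otimes> f v" if "a \<in> carrier R" "v \<in> Z" for a v
    using mod_hom_smult[OF f, of a v] that by (simp add: regular_module_def Q_smult)
  have ep: "e \<otimes> f w = f w" if "w \<in> corner_part Z" for w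
  proof -
    have "w \<in> Z" "(\<lambda>i. e \<otimes> w i) = w" using that by (auto simp: corner_part_def corner_def)
    then show ?thesis using fs[OF e_closed, of w] by simp
  qed
  have "\<exists>c. (\<forall>i. c i \<in> carrier R) \<and> (\<forall>w\<in>corner_part Z. f w = (\<Oplus>i\<in>{..<n}. w i \<otimes> c i))"
  proof (rule corner_injective[OF corner_part_submodule[OF Z]])
    show "\<forall>w\<in>corner_part Z. f w \<in> carrier R \<and> e \<otimes> f w = f w"
      using ep fc by (auto simp: corner_part_def)
    show "\<forall>v\<in>corner_part Z. \<forall>w\<in>corner_part Z. f (\<lambda>i. v i \<oplus> w i) = f v \<oplus> f w"
      using fa by (auto simp: corner_part_def)
    show "\<forall>b\<in>corner R e. \<forall>w\<in>corner_part Z. f (\<lambda>i. b \<otimes> w i) = b \<otimes> f w"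
      using fs corner_closed by (auto simp: corner_part_def)
  qed
  then obtain c where c: "\<And>i. c i \<in> carrier R"
    and fw: "\<And>w. w \<in> corner_part Z \<Longrightarrow> f w = (\<Oplus>i\<in>{..<n}. w i \<otimes> c i)" by blast
  have g: "comb (regular_module R) n c \<in> mod_hom R (Q n) (regular_module R)"
    by (rule comb_hom[OF reg]) (simp add: regular_module_def c)
  have reg_finsum: "finsum (regular_module R) F J = finsum R F J" for F and J :: "'z set"
    by (simp add: finsum_def regular_module_def finprod_def)
  show ?thesis
  proof (rule bexI[OF _ g], rule ballI)
    fix v assume v: "v \<in> Z"
    then have vQ: "v \<in> carrier (Q n)" using ZQ by blast
    then have vi: "v i \<in> carrier R" "v i \<otimes> e = v i" for i by (auto simp: Q_carrier)
    have Lv: "(\<lambda>i. L x (v i)) \<in> corner_part Z" if "x \<in> X" for x by (rule L_corner_part[OF Z that v])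
    then have LvZ: "(\<lambda>i. L x (v i)) \<in> Z" if "x \<in> X" for x using that by (auto simp: corner_part_def)
    have Lc: "L x (v i) \<in> carrier R" if "x \<in> X" for x i by (rule corner_closed[OF L_corner[OF that vi]])
    have aL: "(\<lambda>i. \<alpha> x \<otimes> L x (v i)) \<in> Z" if "x \<in> X" for x
      using Z LvZ[OF that] \<alpha>_closed[OF that] by (auto simp: corner_generated_def)
    let ?F = "\<lambda>x i. \<alpha> x \<otimes> L x (v i)"
    have "finsum (Q n\<lparr>carrier := Z\<rparr>) ?F X i = v i" for i
    proof -
      have "finsum (Q n\<lparr>carrier := Z\<rparr>) ?F X i = (\<Oplus>x\<in>X. ?F x i)"
        using aL ZQ by (intro finsum_pointwise Z.M.abelian_monoid_axioms abelian_monoid_axioms)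
          (auto simp: Q_zero Q_add Q_carrier)
      then show ?thesis by (simp add: L_expand[OF vi])
    qed
    then have vsum: "finsum (Q n\<lparr>carrier := Z\<rparr>) ?F X = v" by blast
    have "f v = finsum (regular_module R) (\<lambda>x. f (?F x)) X"
      using Z.mod_hom_finsum[OF reg.M.abelian_group_axioms f, of ?F X] aL by (simp add: vsum)
    also have "\<dots> = (\<Oplus>x\<in>X. \<alpha> x \<otimes> (\<Oplus>i\<in>{..<n}. L x (v i) \<otimes> c i))"
      unfolding reg_finsum
    proof (rule finsum_cong'[OF refl])
      fix x assume x: "x \<in> X"
      show "f (?F x) = \<alpha> x \<otimes> (\<Oplus>i\<in>{..<n}. L x (v i) \<otimes> c i)"
        using fs[OF \<alpha>_closed[OF x] LvZ[OF x]] fw[OF Lv[OF x]] by simp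
    qed (use \<alpha>_closed Lc c in \<open>auto intro!: finsum_closed\<close>)
    also have "\<dots> = (\<Oplus>x\<in>X. \<Oplus>i\<in>{..<n}. \<alpha> x \<otimes> (L x (v i) \<otimes> c i))"
      using \<alpha>_closed Lc c by (intro finsum_cong' finsum_rdistr) (auto intro!: finsum_closed)
    also have "\<dots> = (\<Oplus>i\<in>{..<n}. \<Oplus>x\<in>X. \<alpha> x \<otimes> (L x (v i) \<otimes> c i))"
      using \<alpha>_closed Lc c X by (intro finsum_swap) auto
    also have "\<dots> = (\<Oplus>i\<in>{..<n}. v i \<otimes> c i)"
    proof (rule finsum_cong'[OF refl])
      fix i
      have "(\<Oplus>x\<in>X. \<alpha> x \<otimes> (L x (v i) \<otimes> c i)) = (\<Oplus>x\<in>X. \<alpha> x \<otimes> L x (v i) \<otimes> c i)"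
        using \<alpha>_closed Lc c by (intro finsum_cong') (auto simp: m_assoc)
      also have "\<dots> = (\<Oplus>x\<in>X. \<alpha> x \<otimes> L x (v i)) \<otimes> c i"
        using \<alpha>_closed Lc c X by (intro finsum_ldistr[symmetric]) auto
      finally show "(\<Oplus>x\<in>X. \<alpha> x \<otimes> (L x (v i) \<otimes> c i)) = v i \<otimes> c i" by (simp add: L_expand[OF vi])
    qed (use vi c in auto)
    also have "\<dots> = comb (regular_module R) n c v"
      using vQ by (simp add: comb_def reg_finsum) (simp add: regular_module_def)
    finally show "comb (regular_module R) n c v = f v" by simp
  qed
qed

definition corner_gens :: "nat \<Rightarrow> (nat \<Rightarrow> 'a) set \<Rightarrow> (nat \<Rightarrow> 'a) list" where
  "corner_gens n Z = (SOME ws. set ws \<subseteq> corner_part Z \<and>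
     Z = comb (Q n) (length ws) ((!) ws) ` carrier (Q (length ws)))"

lemma corner_gens:
  assumes "corner_generated n Z"
  shows "set (corner_gens n Z) \<subseteq> corner_part Z"
    "comb (Q n) (length (corner_gens n Z)) ((!) (corner_gens n Z)) ` carrier (Q (length (corner_gens n Z))) = Z"
  using someI_ex[OF corner_generated_finite[OF assms]] unfolding corner_gens_def[symmetric] by auto

text \<open>
  A resolution by the modules \<open>Q n\<close>, encoded by ranks and generators: the first component is the rank of
  the i-th term and the second is a list of generators of its cycles, starting from \<open>Z\<close> in \<open>Q 1\<close>.
\<close>

primrec syzygy :: "(nat \<Rightarrow> 'a) set \<Rightarrow> nat \<Rightarrow> nat \<times> (nat \<Rightarrow> 'a) list" where
  "syzygy Z 0 = (1, corner_gens 1 Z)"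
| "syzygy Z (Suc i) = (let (n, ws) = syzygy Z i; m = length ws in
     (m, corner_gens m {u \<in> carrier (Q m). comb (Q n) m ((!) ws) u = \<zero>\<^bsub>Q n\<^esub>}))"

text \<open>
  A module generated by an element \<open>m0\<close> that is fixed by \<open>e\<close> is a quotient of \<open>R e\<close>.  If the kernel is generated
  by its part at \<open>e\<close>, then so are all further syzygies in a resolution by powers of \<open>R e\<close> whose
  matrices have entries in the corner, and homomorphisms from them to \<open>R\<close> extend.
\<close>

lemma Ext_regular_trivial:
  assumes M: "left_module R M" and m: "m0 \<in> carrier M" "e \<odot>\<^bsub>M\<^esub> m0 = m0"
    and gen: "\<And>y. y \<in> carrier M \<Longrightarrow> \<exists>a\<in>carrier R. y = a \<odot>\<^bsub>M\<^esub> m0"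
    and ann: "\<And>x a. x \<in> X \<Longrightarrow> a \<in> carrier R \<Longrightarrow> a \<otimes> e = a \<Longrightarrow> a \<odot>\<^bsub>M\<^esub> m0 = \<zero>\<^bsub>M\<^esub> \<Longrightarrow> L x a \<odot>\<^bsub>M\<^esub> m0 = \<zero>\<^bsub>M\<^esub>"
    and "i \<ge> 1"
  shows "trivial_group (Ext R M (regular_module R) i)"
proof -
  interpret M: left_module R M by fact
  define \<epsilon> where "\<epsilon> = comb M 1 (\<lambda>_. m0)"
  have \<epsilon>: "\<epsilon> \<in> mod_hom R (Q 1) M" unfolding \<epsilon>_def by (rule comb_hom[OF M m(1)])
  have \<epsilon>v: "\<epsilon> v = v 0 \<odot>\<^bsub>M\<^esub> m0" if "v \<in> carrier (Q 1)" for v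
    using that m(1) by (auto simp: \<epsilon>_def comb_def Q_carrier M.smult_closed lessThan_Suc)
  define Z where "Z = {v \<in> carrier (Q 1). \<epsilon> v = \<zero>\<^bsub>M\<^esub>}"
  define P where "P i = Q (fst (syzygy Z i))" for i
  define d where "d i = comb (Q (fst (syzygy Z i))) (length (snd (syzygy Z i))) ((!) (snd (syzygy Z i)))" for i
  have fstS: "fst (syzygy Z (Suc i)) = length (snd (syzygy Z i))" for i
    by (simp add: Let_def split: prod.split)
  have P0: "P 0 = Q 1" by (simp add: P_def)
  have PSuc: "P (Suc i) = Q (length (snd (syzygy Z i)))" for i unfolding P_def fstS by simp
  have Z0: "corner_generated 1 Z"
  proof -
    interpret Q1: left_module R "Q 1" by (rule Q_left_module)
    have z: "(\<lambda>i. \<zero>) \<in> Z"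
      using Q1.mod_hom_zero[OF M.M.abelian_group_axioms \<epsilon>] Q1.M.zero_closed by (simp add: Z_def Q_zero)
    have a: "(\<lambda>i. u i \<oplus> v i) \<in> Z" if "u \<in> Z" "v \<in> Z" for u v
      using that mod_hom_add[OF \<epsilon>, of u v] Q1.M.a_closed[of u v] by (simp add: Z_def Q_add)
    have s: "(\<lambda>i. a \<otimes> u i) \<in> Z" if "u \<in> Z" "a \<in> carrier R" for u a
      using that mod_hom_smult[OF \<epsilon>, of a u] Q1.smult_closed[of a u] M.smult_zero_right[of a]
      by (simp add: Z_def Q_smult)
    have L: "(\<lambda>i. L x (u i)) \<in> Z" if x: "x \<in> X" and u: "u \<in> Z" for x u
    proof -
      have uQ: "u \<in> carrier (Q 1)" using u by (simp add: Z_def)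
      then have uc: "u j \<in> carrier R" "u j \<otimes> e = u j" for j by (auto simp: Q_carrier)
      have lu: "(\<lambda>i. L x (u i)) \<in> carrier (Q 1)"
        using uQ L_zero[OF x] corner_closed[OF L_corner[OF x uc]] corner_right[OF L_corner[OF x uc]]
        by (auto simp: Q_carrier)
      have "u 0 \<odot>\<^bsub>M\<^esub> m0 = \<zero>\<^bsub>M\<^esub>" using u \<epsilon>v[OF uQ] by (simp add: Z_def)
      then show ?thesis using ann[OF x uc] lu by (simp add: Z_def \<epsilon>v)
    qed
    show ?thesis unfolding corner_generated_def using z a s L by (auto simp: Z_def)
  qed
  define K where "K i = cycles M P d \<epsilon> i" for i
  have inv: "corner_generated (fst (syzygy Z i)) (K i) \<and> snd (syzygy Z i) = corner_gens (fst (syzygy Z i)) (K i)" for i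
  proof (induction i)
    case 0
    have "K 0 = Z" by (simp add: K_def P0 Z_def)
    then show ?case using Z0 by simp
  next
    case (Suc i)
    let ?n = "fst (syzygy Z i)" and ?ws = "snd (syzygy Z i)"
    have KS: "K (Suc i) = {u \<in> carrier (Q (length ?ws)). comb (Q ?n) (length ?ws) ((!) ?ws) u = \<zero>\<^bsub>Q ?n\<^esub>}"
      by (simp only: K_def cycles.simps PSuc) (simp add: d_def P_def)
    have ws: "set ?ws \<subseteq> corner_part (K i)" using corner_gens(1) Suc.IH by metis
    have KQ: "K i \<subseteq> carrier (Q ?n)" using Suc.IH by (simp add: corner_generated_def)
    have "corner_generated (length ?ws) (K (Suc i))" unfolding KS
    proof (rule corner_generated_kernel)
      fix j assume "j < length ?ws"
      then have "?ws ! j \<in> corner_part (K i)" using ws nth_mem by blast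
      then show "?ws ! j \<in> carrier (Q ?n)" "(?ws ! j) k \<in> corner R e" for k
        using KQ by (auto simp: corner_part_def)
    qed
    then show ?case unfolding fstS by (simp add: KS Let_def split: prod.split)
  qed
  have res: "projective_resolution R M P d \<epsilon>"
    unfolding projective_resolution_def
  proof (intro conjI allI)
    show "projective_module R (P n)" for n by (simp add: P_def Q_projective)
    show "\<epsilon> \<in> mod_hom R (P 0) M" unfolding P0 by (rule \<epsilon>)
    have ws: "snd (syzygy Z n) ! j \<in> carrier (Q (fst (syzygy Z n)))" if "j < length (snd (syzygy Z n))" for n j
    proof -
      have "set (snd (syzygy Z n)) \<subseteq> K n" "K n \<subseteq> carrier (Q (fst (syzygy Z n)))"
        using inv[of n] corner_gens(1)[of "fst (syzygy Z n)" "K n"]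
        by (auto simp: corner_generated_def corner_part_def)
      then show ?thesis using nth_mem[OF that] by blast
    qed
    show "d n \<in> mod_hom R (P (Suc n)) (P n)" for n
      unfolding PSuc by (simp add: d_def P_def comb_hom[OF Q_left_module ws])
    show "\<epsilon> ` carrier (P 0) = carrier M"
    proof (rule equalityI; rule subsetI)
      fix y assume "y \<in> carrier M"
      then obtain a where a: "a \<in> carrier R" "y = a \<odot>\<^bsub>M\<^esub> m0" using gen by blast
      let ?v = "\<lambda>i::nat. if i = 0 then a \<otimes> e else \<zero>"
      have v: "?v \<in> carrier (Q 1)" using a e_closed by (auto simp: Q_carrier m_assoc e_idem)
      have "\<epsilon> ?v = y" using \<epsilon>v[OF v] a m e_closed by (simp add: M.smult_assoc)
      then show "y \<in> \<epsilon> ` carrier (P 0)" unfolding P0 using v by (metis imageI)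
    qed (use mod_hom_closed[OF \<epsilon>] in \<open>auto simp: P0\<close>)
    have im: "d n ` carrier (P (Suc n)) = K n" for n
      unfolding PSuc d_def using inv[of n] corner_gens(2)[of "fst (syzygy Z n)" "K n"] by simp
    show "d 0 ` carrier (P 1) = {x \<in> carrier (P 0). \<epsilon> x = \<zero>\<^bsub>M\<^esub>}"
      using im[of 0] by (simp add: K_def)
    show "d (Suc n) ` carrier (P (Suc (Suc n))) = {x \<in> carrier (P (Suc n)). d n x = \<zero>\<^bsub>P n\<^esub>}" for n
      using im[of "Suc n"] by (simp add: K_def)
  qed
  show ?thesis
  proof (rule Ext_trivial[OF res M left_module_regular[OF ring_axioms] _ \<open>i \<ge> 1\<close>])
    fix n f assume "f \<in> mod_hom R (P n\<lparr>carrier := cycles M P d \<epsilon> n\<rparr>) (regular_module R)"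
    then show "\<exists>g\<in>mod_hom R (P n) (regular_module R). \<forall>x\<in>cycles M P d \<epsilon> n. g x = f x"
      using corner_generated_extend[of "fst (syzygy Z n)" "K n" f] inv[of n] by (simp add: K_def P_def)
  qed
qed

end

section \<open>Linear algebra in spaces of functions\<close>

lemma functional_extend:
  fixes scale :: "'k::field \<Rightarrow> 'v::ab_group_add \<Rightarrow> 'v" and f :: "'v \<Rightarrow> 'k"
  assumes V: "vector_space scale" and S: "module.subspace scale S"
    and add: "\<And>x y. x \<in> S \<Longrightarrow> y \<in> S \<Longrightarrow> f (x + y) = f x + f y"
    and smult: "\<And>r x. x \<in> S \<Longrightarrow> f (scale r x) = r * f x"
  shows "\<exists>g. Vector_Spaces.linear scale (*) g \<and> (\<forall>x\<in>S. g x = f x)"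
proof -
  interpret V: vector_space scale by fact
  interpret K: vector_space "(*) :: 'k \<Rightarrow> 'k \<Rightarrow> 'k" by standard (simp_all add: algebra_simps)
  interpret VK: vector_space_pair scale "(*) :: 'k \<Rightarrow> 'k \<Rightarrow> 'k" ..
  obtain B where B: "B \<subseteq> S" "V.independent B" "S \<subseteq> V.span B"
    using V.maximal_independent_subset[of S] by blast
  obtain g where g: "Vector_Spaces.linear scale (*) g" "\<forall>x\<in>B. g x = f x"
    using VK.linear_independent_extend[OF B(2), of f] by blast
  interpret g: Vector_Spaces.linear scale "(*)" g by (rule g(1))
  have f0: "f 0 = 0" using smult[of 0 0] V.subspace_0[OF S] by simp
  have "x \<in> S \<and> g x = f x" if "x \<in> V.span B" for x
    using that
  proof (induction rule: V.span_induct_alt)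
    case base
    show ?case using V.subspace_0[OF S] f0 g.zero by simp
  next
    case (step c b y)
    then have b: "b \<in> S" using B(1) by blast
    then have cb: "scale c b \<in> S" by (rule V.subspace_scale[OF S])
    have "f (scale c b + y) = c * f b + f y" using add[OF cb] smult[OF b] step by simp
    moreover have "g (scale c b + y) = c * f b + f y" using g(2) step by (simp add: g.add g.scale)
    ultimately show ?case using V.subspace_add[OF S cb] step by simp
  qed
  then show ?thesis using B(3) g(1) by blast
qed

lemma subspace_finite_generators:
  fixes scale :: "'k::field \<Rightarrow> 'v::ab_group_add \<Rightarrow> 'v"
  assumes V: "vector_space scale" and T: "finite T" "S \<subseteq> module.span scale T"
  shows "\<exists>ws. set ws \<subseteq> S \<and> (\<forall>x\<in>S. \<exists>u. x = (\<Sum>j<length ws. scale (u j) (ws ! j)))"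
proof -
  interpret V: vector_space scale by fact
  obtain B where B: "B \<subseteq> S" "V.independent B" "S \<subseteq> V.span B"
    using V.maximal_independent_subset[of S] by blast
  have "finite B" using V.independent_span_bound[OF T(1) B(2)] B(1) T(2) by blast
  then obtain ws where ws: "set ws = B" "distinct ws" using finite_distinct_list by blast
  have "\<exists>u. x = (\<Sum>j<length ws. scale (u j) (ws ! j))" if "x \<in> S" for x
  proof -
    have "x \<in> V.span B" using that B(3) by blast
    then obtain u where "x = (\<Sum>v\<in>B. scale (u v) v)" using V.span_finite[OF \<open>finite B\<close>] by auto
    also have "\<dots> = (\<Sum>j<length ws. scale (u (ws ! j)) (ws ! j))"
      by (rule sum.reindex_bij_betw[symmetric, OF bij_betw_nth[OF ws(2) refl ws(1)[symmetric]]])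
    finally show ?thesis by (intro exI[of _ "\<lambda>j. u (ws ! j)"])
  qed
  then show ?thesis using ws B(1) by blast
qed

lemma sum_fun_apply: "(\<Sum>j\<in>J. F j) x = (\<Sum>j\<in>J. F j x)"
  by (induction J rule: infinite_finite_induct) auto

text \<open>
  Families of vectors form a vector space over the field, in which the linear algebra of the submodules of
  a free module over a group algebra takes place.
\<close>

definition family_scale :: "'k::field \<Rightarrow> (nat \<Rightarrow> 'm \<Rightarrow> 'k) \<Rightarrow> nat \<Rightarrow> 'm \<Rightarrow> 'k" where
  "family_scale r w = (\<lambda>i h. r * w i h)"

lemma family_vector_space: "vector_space family_scale"
  by standard (auto simp: family_scale_def fun_eq_iff algebra_simps)

definition family_unit :: "nat \<Rightarrow> 'm \<Rightarrow> nat \<Rightarrow> 'm \<Rightarrow> 'k::field" where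
  "family_unit i g = (\<lambda>j h. if j = i \<and> h = g then 1 else 0)"

lemma family_expand:
  fixes w :: "nat \<Rightarrow> 'm \<Rightarrow> 'k::field"
  assumes "finite G" "\<And>i h. h \<notin> G \<Longrightarrow> w i h = 0" "\<And>i h. i \<ge> n \<Longrightarrow> w i h = 0"
  shows "w = (\<Sum>(i, g)\<in>{..<n} \<times> G. family_scale (w i g) (family_unit i g))"
proof (intro ext)
  fix j h
  have "(\<Sum>(i, g)\<in>{..<n} \<times> G. family_scale (w i g) (family_unit i g)) j h
     = (\<Sum>p\<in>{..<n} \<times> G. if p = (j, h) then w j h else 0)"
    by (auto simp: sum_fun_apply family_scale_def family_unit_def case_prod_unfold intro!: sum.cong)
  also have "\<dots> = w j h" using assms by (auto simp: not_less)
  finally show "w j h = (\<Sum>(i, g)\<in>{..<n} \<times> G. family_scale (w i g) (family_unit i g)) j h" by simp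
qed

section \<open>Category algebras\<close>

lemma finsum_fun_apply:
  fixes G :: "('i \<Rightarrow> 'k::field, 'b) ring_scheme"
  assumes G: "abelian_monoid G"
    and z: "\<zero>\<^bsub>G\<^esub> = (\<lambda>i. 0)" and a: "\<And>v w. v \<oplus>\<^bsub>G\<^esub> w = (\<lambda>i. v i + w i)"
    and F: "F \<in> J \<rightarrow> carrier G"
  shows "finsum G F J i = (\<Sum>j\<in>J. F j i)"
proof -
  interpret G: abelian_monoid G by fact
  show ?thesis
  proof (cases "finite J")
    case True
    from this F show ?thesis
      by (induction J rule: finite_induct) (auto simp: z a Pi_iff)
  qed (simp add: z)
qed

definition basis_vector :: "'m \<Rightarrow> 'm \<Rightarrow> 'k::field" where
  "basis_vector f = (\<lambda>h. if h = f then 1 else 0)"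

lemma sum_rotate: "(\<Sum>x\<in>A. \<Sum>y\<in>B. \<Sum>t\<in>D. F x y t) = (\<Sum>y\<in>B. \<Sum>t\<in>D. \<Sum>x\<in>A. F x y t)"
  by (rule trans[OF sum.swap]) (intro sum.cong refl sum.swap)

locale fin_category = category C for C :: "('o, 'm) cat" (structure) +
  assumes fin: "finite (Arr C)"
begin

abbreviation alg :: "('k::field, 'm \<Rightarrow> 'k) module" where "alg \<equiv> category_algebra C"

lemma Hom_iff: "f \<in> Hom C x y \<longleftrightarrow> f \<in> Arr C \<and> Dom C f = x \<and> Cod C f = y"
  by (auto simp: Hom_def)

lemma Ident_arr: "x \<in> Obj C \<Longrightarrow> Ident C x \<in> Arr C \<and> Dom C (Ident C x) = x \<and> Cod C (Ident C x) = x"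
  using ident_hom by (simp add: Hom_iff)

lemma Comp_arr: "f \<in> Arr C \<Longrightarrow> g \<in> Arr C \<Longrightarrow> Dom C f = Cod C g \<Longrightarrow>
   f \<cdot> g \<in> Arr C \<and> Dom C (f \<cdot> g) = Dom C g \<and> Cod C (f \<cdot> g) = Cod C f"
  using comp_hom[of g "Dom C g" "Cod C g" f "Cod C f"] by (simp add: Hom_iff)

lemma Comp_assoc: "f \<in> Arr C \<Longrightarrow> g \<in> Arr C \<Longrightarrow> h \<in> Arr C \<Longrightarrow> Dom C f = Cod C g \<Longrightarrow> Dom C g = Cod C h \<Longrightarrow>
   f \<cdot> (g \<cdot> h) = f \<cdot> g \<cdot> h"
  using comp_assoc[of h "Dom C h" "Cod C h" g "Cod C g" f "Cod C f"] by (simp add: Hom_iff)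

lemma Comp_Ident: "f \<in> Arr C \<Longrightarrow> f \<cdot> Ident C (Dom C f) = f \<and> Ident C (Cod C f) \<cdot> f = f"
  using comp_ident_left comp_ident_right by (simp add: Hom_iff)

lemma fin_Obj: "finite (Obj C)"
proof (rule finite_subset)
  show "Obj C \<subseteq> Dom C ` Arr C" using Ident_arr by force
qed (simp add: fin)

lemma alg_carrier: "carrier (alg :: ('k::field, 'm \<Rightarrow> 'k) module) = {a. \<forall>h. h \<notin> Arr C \<longrightarrow> a h = 0}"
  and alg_zero: "\<zero>\<^bsub>alg\<^esub> = (\<lambda>h. 0)"
  and alg_one: "\<one>\<^bsub>alg\<^esub> = (\<lambda>h. if h \<in> Ident C ` Obj C then 1 else 0)"
  and alg_add: "a \<oplus>\<^bsub>alg\<^esub> b = (\<lambda>h. a h + b h)"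
  and alg_smult: "r \<odot>\<^bsub>alg\<^esub> a = (\<lambda>h. r * a h)"
  by (simp_all add: category_algebra_def linear_span_def)

lemma alg_mult: "(a \<otimes>\<^bsub>alg\<^esub> b) h =
   (\<Sum>f\<in>Arr C. \<Sum>g\<in>Arr C. if Dom C f = Cod C g \<and> f \<cdot> g = h then a f * b g else 0)"
proof -
  have "(a \<otimes>\<^bsub>alg\<^esub> b) h =
     (\<Sum>p\<in>{p \<in> Arr C \<times> Arr C. Dom C (fst p) = Cod C (snd p) \<and> fst p \<cdot> snd p = h}. a (fst p) * b (snd p))"
    by (auto simp: category_algebra_def case_prod_unfold intro!: sum.cong)
  also have "\<dots> = (\<Sum>p\<in>Arr C \<times> Arr C. if Dom C (fst p) = Cod C (snd p) \<and> fst p \<cdot> snd p = h then a (fst p) * b (snd p) else 0)"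
    by (simp add: sum.inter_filter fin)
  also have "\<dots> = (\<Sum>f\<in>Arr C. \<Sum>g\<in>Arr C. if Dom C f = Cod C g \<and> f \<cdot> g = h then a f * b g else 0)"
    by (simp add: sum.cartesian_product case_prod_unfold)
  finally show ?thesis .
qed

text \<open>
  Associativity of the product and of the action on the trivial module both come down to this formula.
\<close>

lemma alg_mult_pairing: "(\<Sum>h\<in>Arr C. (a \<otimes>\<^bsub>alg\<^esub> b) h * F h) =
   (\<Sum>f\<in>Arr C. \<Sum>g\<in>Arr C. if Dom C f = Cod C g then a f * b g * F (f \<cdot> g) else 0)"
proof -
  have "(\<Sum>h\<in>Arr C. (a \<otimes>\<^bsub>alg\<^esub> b) h * F h) =
     (\<Sum>h\<in>Arr C. \<Sum>f\<in>Arr C. \<Sum>g\<in>Arr C. if f \<cdot> g = h then (if Dom C f = Cod C g then a f * b g * F h else 0) else 0)"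
    unfolding alg_mult sum_distrib_right by (intro sum.cong) auto
  also have "\<dots> = (\<Sum>f\<in>Arr C. \<Sum>g\<in>Arr C. \<Sum>h\<in>Arr C. if f \<cdot> g = h then (if Dom C f = Cod C g then a f * b g * F h else 0) else 0)"
    by (rule sum_rotate)
  also have "\<dots> = (\<Sum>f\<in>Arr C. \<Sum>g\<in>Arr C. if Dom C f = Cod C g then a f * b g * F (f \<cdot> g) else 0)"
    using Comp_arr by (intro sum.cong refl) (auto simp: fin)
  finally show ?thesis .
qed

lemma alg_mult_closed: "a \<otimes>\<^bsub>alg\<^esub> b \<in> carrier (alg :: ('k::field, 'm \<Rightarrow> 'k) module)"
  using Comp_arr by (auto simp: alg_carrier alg_mult intro!: sum.neutral)

lemma basis_mult_left:
  assumes f: "f \<in> Arr C"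
  shows "(basis_vector f \<otimes>\<^bsub>alg\<^esub> a) h = (\<Sum>g\<in>Arr C. if Dom C f = Cod C g \<and> f \<cdot> g = h then a g else 0)"
proof -
  have "(basis_vector f \<otimes>\<^bsub>alg\<^esub> a) h = (\<Sum>f'\<in>Arr C. if f' = f then
     (\<Sum>g\<in>Arr C. if Dom C f = Cod C g \<and> f \<cdot> g = h then a g else 0) else 0)"
    unfolding alg_mult by (intro sum.cong refl) (auto simp: basis_vector_def intro!: sum.neutral sum.cong)
  then show ?thesis using f by (simp add: fin)
qed

lemma basis_mult_right:
  assumes g: "g \<in> Arr C"
  shows "(a \<otimes>\<^bsub>alg\<^esub> basis_vector g) h = (\<Sum>f\<in>Arr C. if Dom C f = Cod C g \<and> f \<cdot> g = h then a f else 0)"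
proof -
  have "(a \<otimes>\<^bsub>alg\<^esub> basis_vector g) h = (\<Sum>f\<in>Arr C. \<Sum>g'\<in>Arr C. if g' = g then
     (if Dom C f = Cod C g \<and> f \<cdot> g = h then a f else 0) else 0)"
    unfolding alg_mult by (intro sum.cong refl) (auto simp: basis_vector_def)
  then show ?thesis using g by (simp add: fin)
qed

lemma alg_one_left:
  assumes "a \<in> carrier alg" shows "\<one>\<^bsub>alg\<^esub> \<otimes>\<^bsub>alg\<^esub> a = a"
proof
  fix h
  have "(\<one>\<^bsub>alg\<^esub> \<otimes>\<^bsub>alg\<^esub> a) h = (\<Sum>g\<in>Arr C. \<Sum>f\<in>Arr C. if f = Ident C (Cod C g) then (if g = h then a h else 0) else 0)"
    unfolding alg_mult alg_one
    by (rule trans[OF sum.swap], intro sum.cong refl) (use Comp_Ident Ident_arr cod_obj in auto)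
  also have "\<dots> = (\<Sum>g\<in>Arr C. if g = h then a h else 0)"
    using Ident_arr cod_obj by (intro sum.cong refl) (simp add: fin)
  also have "\<dots> = a h" using assms by (simp add: fin alg_carrier)
  finally show "(\<one>\<^bsub>alg\<^esub> \<otimes>\<^bsub>alg\<^esub> a) h = a h" .
qed

lemma alg_one_right:
  assumes "a \<in> carrier alg" shows "a \<otimes>\<^bsub>alg\<^esub> \<one>\<^bsub>alg\<^esub> = a"
proof
  fix h
  have "(a \<otimes>\<^bsub>alg\<^esub> \<one>\<^bsub>alg\<^esub>) h = (\<Sum>f\<in>Arr C. \<Sum>g\<in>Arr C. if g = Ident C (Dom C f) then (if f = h then a h else 0) else 0)"
    unfolding alg_mult alg_one
    by (intro sum.cong refl) (use Comp_Ident Ident_arr dom_obj in auto)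
  also have "\<dots> = (\<Sum>f\<in>Arr C. if f = h then a h else 0)"
    using Ident_arr dom_obj by (intro sum.cong refl) (simp add: fin)
  also have "\<dots> = a h" using assms by (simp add: fin alg_carrier)
  finally show "(a \<otimes>\<^bsub>alg\<^esub> \<one>\<^bsub>alg\<^esub>) h = a h" .
qed

lemma alg_mult_assoc: "(a \<otimes>\<^bsub>alg\<^esub> b) \<otimes>\<^bsub>alg\<^esub> c = a \<otimes>\<^bsub>alg\<^esub> (b \<otimes>\<^bsub>alg\<^esub> c)"
proof
  fix h
  have "((a \<otimes>\<^bsub>alg\<^esub> b) \<otimes>\<^bsub>alg\<^esub> c) h = (\<Sum>l\<in>Arr C. \<Sum>p\<in>Arr C.
      (a \<otimes>\<^bsub>alg\<^esub> b) p * (if Dom C p = Cod C l \<and> p \<cdot> l = h then c l else 0))"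
    unfolding alg_mult[of "a \<otimes>\<^bsub>alg\<^esub> b"] by (rule trans[OF sum.swap], intro sum.cong refl) auto
  also have "\<dots> = (\<Sum>l\<in>Arr C. \<Sum>f\<in>Arr C. \<Sum>g\<in>Arr C.
      if Dom C f = Cod C g \<and> Dom C g = Cod C l \<and> f \<cdot> (g \<cdot> l) = h then a f * b g * c l else 0)"
    unfolding alg_mult_pairing using Comp_arr Comp_assoc by (intro sum.cong refl) auto
  also have "\<dots> = (\<Sum>f\<in>Arr C. \<Sum>g\<in>Arr C. \<Sum>l\<in>Arr C.
      if Dom C f = Cod C g \<and> Dom C g = Cod C l \<and> f \<cdot> (g \<cdot> l) = h then a f * b g * c l else 0)"
    by (rule sum_rotate)
  also have "\<dots> = (\<Sum>f\<in>Arr C. \<Sum>p\<in>Arr C.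
      (b \<otimes>\<^bsub>alg\<^esub> c) p * (if Dom C f = Cod C p \<and> f \<cdot> p = h then a f else 0))"
    unfolding alg_mult_pairing using Comp_arr by (intro sum.cong refl) auto
  also have "\<dots> = (a \<otimes>\<^bsub>alg\<^esub> (b \<otimes>\<^bsub>alg\<^esub> c)) h"
    unfolding alg_mult[of a] by (intro sum.cong refl) auto
  finally show "((a \<otimes>\<^bsub>alg\<^esub> b) \<otimes>\<^bsub>alg\<^esub> c) h = (a \<otimes>\<^bsub>alg\<^esub> (b \<otimes>\<^bsub>alg\<^esub> c)) h" .
qed

lemma alg_distr_left: "(\<lambda>h. a h + b h) \<otimes>\<^bsub>alg\<^esub> c = (\<lambda>h. (a \<otimes>\<^bsub>alg\<^esub> c) h + (b \<otimes>\<^bsub>alg\<^esub> c) h)"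
  unfolding alg_mult fun_eq_iff by (auto simp: sum.distrib[symmetric] algebra_simps intro!: sum.cong)

lemma alg_distr_right: "c \<otimes>\<^bsub>alg\<^esub> (\<lambda>h. a h + b h) = (\<lambda>h. (c \<otimes>\<^bsub>alg\<^esub> a) h + (c \<otimes>\<^bsub>alg\<^esub> b) h)"
  unfolding alg_mult fun_eq_iff by (auto simp: sum.distrib[symmetric] algebra_simps intro!: sum.cong)

lemma alg_scale_left: "(\<lambda>h. r * a h) \<otimes>\<^bsub>alg\<^esub> c = (\<lambda>h. r * (a \<otimes>\<^bsub>alg\<^esub> c) h)"
  unfolding alg_mult fun_eq_iff by (auto simp: sum_distrib_left algebra_simps intro!: sum.cong)

lemma alg_scale_right: "a \<otimes>\<^bsub>alg\<^esub> (\<lambda>h. r * c h) = (\<lambda>h. r * (a \<otimes>\<^bsub>alg\<^esub> c) h)"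
  unfolding alg_mult fun_eq_iff by (auto simp: sum_distrib_left algebra_simps intro!: sum.cong)

lemma alg_ring: "ring (alg :: ('k::field, 'm \<Rightarrow> 'k) module)"
proof (rule ringI)
  show "abelian_group (alg :: ('k, 'm \<Rightarrow> 'k) module)"
  proof (rule abelian_groupI)
    fix a :: "'m \<Rightarrow> 'k" assume "a \<in> carrier alg"
    then show "\<exists>b\<in>carrier alg. b \<oplus>\<^bsub>alg\<^esub> a = \<zero>\<^bsub>alg\<^esub>"
      by (intro bexI[of _ "\<lambda>h. - a h"]) (auto simp: alg_carrier alg_add alg_zero)
  qed (auto simp: alg_carrier alg_add alg_zero algebra_simps)
  show "Group.monoid (alg :: ('k, 'm \<Rightarrow> 'k) module)"
    by (rule monoidI) (use Ident_arr in \<open>auto simp: alg_mult_closed alg_mult_assoc alg_one_left alg_one_right\<close>,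
      use Ident_arr in \<open>auto simp: alg_carrier alg_one\<close>)
qed (auto simp: alg_add alg_distr_left alg_distr_right)

lemma alg_finsum: "F \<in> J \<rightarrow> carrier alg \<Longrightarrow> finsum alg F J h = (\<Sum>j\<in>J. F j h)"
proof -
  interpret A: ring "alg :: ('b::field, 'm \<Rightarrow> 'b) module" by (rule alg_ring)
  show "F \<in> J \<rightarrow> carrier alg \<Longrightarrow> finsum alg F J h = (\<Sum>j\<in>J. F j h)"
    by (rule finsum_fun_apply[OF A.abelian_monoid_axioms]) (auto simp: alg_zero alg_add)
qed

lemma basis_closed: "f \<in> Arr C \<Longrightarrow> basis_vector f \<in> carrier alg"
  by (auto simp: alg_carrier basis_vector_def)

lemma ident_mult_left:
  assumes "x \<in> Obj C"
  shows "basis_vector (Ident C x) \<otimes>\<^bsub>alg\<^esub> a = (\<lambda>h. if h \<in> Arr C \<and> Cod C h = x then a h else 0)"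
proof
  fix h
  have *: "Dom C (Ident C x) = Cod C g \<and> Ident C x \<cdot> g = h \<longleftrightarrow> g = h \<and> Cod C h = x" if "g \<in> Arr C" for g
    using Ident_arr[OF assms] Comp_Ident[OF that] by metis
  have "(basis_vector (Ident C x) \<otimes>\<^bsub>alg\<^esub> a) h = (\<Sum>g\<in>Arr C. if g = h then (if Cod C h = x then a h else 0) else 0)"
    unfolding basis_mult_left[OF conjunct1[OF Ident_arr[OF assms]]]
    by (intro sum.cong refl) (simp add: *)
  then show "(basis_vector (Ident C x) \<otimes>\<^bsub>alg\<^esub> a) h = (if h \<in> Arr C \<and> Cod C h = x then a h else 0)"
    by (auto simp: fin)
qed

lemma ident_mult_right:
  assumes "x \<in> Obj C"
  shows "a \<otimes>\<^bsub>alg\<^esub> basis_vector (Ident C x) = (\<lambda>h. if h \<in> Arr C \<and> Dom C h = x then a h else 0)"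
proof
  fix h
  have *: "Dom C g = Cod C (Ident C x) \<and> g \<cdot> Ident C x = h \<longleftrightarrow> g = h \<and> Dom C h = x" if "g \<in> Arr C" for g
    using Ident_arr[OF assms] Comp_Ident[OF that] by metis
  have "(a \<otimes>\<^bsub>alg\<^esub> basis_vector (Ident C x)) h = (\<Sum>g\<in>Arr C. if g = h then (if Dom C h = x then a h else 0) else 0)"
    unfolding basis_mult_right[OF conjunct1[OF Ident_arr[OF assms]]]
    by (intro sum.cong refl) (simp add: *)
  then show "(a \<otimes>\<^bsub>alg\<^esub> basis_vector (Ident C x)) h = (if h \<in> Arr C \<and> Dom C h = x then a h else 0)"
    by (auto simp: fin)
qed

end

definition op_cat :: "('o, 'm) cat \<Rightarrow> ('o, 'm) cat" where
  "op_cat C = \<lparr>Obj = Obj C, Arr = Arr C, Dom = Cod C, Cod = Dom C, Ident = Ident C, Comp = (\<lambda>f g. Comp C g f)\<rparr>"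

lemma op_cat_simps [simp]:
  "Obj (op_cat C) = Obj C" "Arr (op_cat C) = Arr C" "Dom (op_cat C) = Cod C" "Cod (op_cat C) = Dom C"
  "Ident (op_cat C) = Ident C" "Comp (op_cat C) f g = Comp C g f"
  by (simp_all add: op_cat_def)

lemma op_cat_Hom [simp]: "Hom (op_cat C) x y = Hom C y x"
  by (auto simp: Hom_def)

lemma fin_category_op: "fin_category C \<Longrightarrow> fin_category (op_cat C)"
proof -
  assume "fin_category C"
  then interpret fin_category C .
  show "fin_category (op_cat C)"
  proof
    fix f w x g y h z
    assume "f \<in> Hom (op_cat C) w x" "g \<in> Hom (op_cat C) x y" "h \<in> Hom (op_cat C) y z"
    then show "h \<cdot>\<^bsub>op_cat C\<^esub> (g \<cdot>\<^bsub>op_cat C\<^esub> f) = h \<cdot>\<^bsub>op_cat C\<^esub> g \<cdot>\<^bsub>op_cat C\<^esub> f"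
      using comp_assoc[of h z y g x f w] by simp
  qed (auto simp: dom_obj cod_obj fin ident_hom comp_hom comp_ident_left comp_ident_right)
qed

lemma op_category_algebra: "op_ring (category_algebra C) = (category_algebra (op_cat C) :: ('k::field, 'm \<Rightarrow> 'k) module)"
proof -
  have "(\<lambda>a b h. \<Sum>(f, g) | f \<in> Arr C \<and> g \<in> Arr C \<and> Dom C f = Cod C g \<and> f \<cdot>\<^bsub>C\<^esub> g = h. b f * a g)
     = (\<lambda>a b h. \<Sum>(f, g) | f \<in> Arr C \<and> g \<in> Arr C \<and> Cod C f = Dom C g \<and> g \<cdot>\<^bsub>C\<^esub> f = h. a f * (b g :: 'k))"
    by (intro ext sum.reindex_bij_witness[of _ prod.swap prod.swap]) auto
  then show ?thesis by (simp add: op_ring_def category_algebra_def)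
qed

section \<open>The corner at an object whose endomorphisms are invertible\<close>

locale group_object = fin_category C for C :: "('o, 'm) cat" (structure) +
  fixes z :: 'o
  assumes z: "z \<in> Obj C" and end_iso: "g \<in> Hom C z z \<Longrightarrow> iso_arrow C g"
begin

definition ginv :: "'m \<Rightarrow> 'm" where
  "ginv g = (SOME h. h \<in> Hom C z z \<and> h \<cdot> g = Ident C z \<and> g \<cdot> h = Ident C z)"

lemma ginv:
  assumes "g \<in> Hom C z z"
  shows "ginv g \<in> Hom C z z" "ginv g \<cdot> g = Ident C z" "g \<cdot> ginv g = Ident C z"
proof -
  have "\<exists>h. h \<in> Hom C z z \<and> h \<cdot> g = Ident C z \<and> g \<cdot> h = Ident C z"
    using end_iso[OF assms] assms by (auto simp: iso_arrow_def inverse_arrows_def Hom_iff)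
  from someI_ex[OF this] show "ginv g \<in> Hom C z z" "ginv g \<cdot> g = Ident C z" "g \<cdot> ginv g = Ident C z"
    by (auto simp: ginv_def)
qed

lemma ginv_cancel:
  assumes "g \<in> Hom C z z" "f \<in> Hom C z x"
  shows "f \<cdot> g \<cdot> ginv g = f" "f \<cdot> ginv g \<cdot> g = f"
  using assms ginv[OF assms(1)] Comp_Ident[of f] Comp_assoc[of f g "ginv g"] Comp_assoc[of f "ginv g" g]
  by (auto simp: Hom_iff)

lemma ginv_unique:
  assumes "g \<in> Hom C z z" "f \<in> Hom C z z" "f \<cdot> g = Ident C z"
  shows "g = ginv f"
  using assms ginv[OF assms(2)] Comp_Ident[of g] Comp_Ident[of "ginv f"] Comp_assoc[of "ginv f" f g]
  by (auto simp: Hom_iff)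

abbreviation e :: "'m \<Rightarrow> 'k::field" where "e \<equiv> basis_vector (Ident C z)"

lemma e_closed: "e \<in> carrier alg"
  using Ident_arr[OF z] by (simp add: basis_closed)

lemma e_left: "e \<otimes>\<^bsub>alg\<^esub> a = (\<lambda>h. if h \<in> Arr C \<and> Cod C h = z then a h else 0)"
  and e_right: "a \<otimes>\<^bsub>alg\<^esub> e = (\<lambda>h. if h \<in> Arr C \<and> Dom C h = z then a h else 0)"
  by (rule ident_mult_left[OF z], rule ident_mult_right[OF z])

lemma e_idem: "e \<otimes>\<^bsub>alg\<^esub> e = (e :: 'm \<Rightarrow> 'k::field)"
  unfolding e_left using Ident_arr[OF z] by (auto simp: basis_vector_def fun_eq_iff)

lemma corner_alg: "corner alg (e :: 'm \<Rightarrow> 'k::field) = {b. \<forall>h. h \<notin> Hom C z z \<longrightarrow> b h = 0}"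
  unfolding corner_def e_left e_right alg_carrier fun_eq_iff by (auto simp: Hom_iff)

lemma alg_one_neq_zero: "\<one>\<^bsub>alg\<^esub> \<noteq> (\<zero>\<^bsub>alg\<^esub> :: 'm \<Rightarrow> 'k::field)"
  unfolding alg_one alg_zero fun_eq_iff using z by (metis imageI zero_neq_one)

lemma corner_scaled_e: "(\<lambda>h. r * e h) \<in> corner alg e"
  unfolding corner_alg using ident_hom[OF z] by (auto simp: basis_vector_def)

lemma corner_basis: "g \<in> Hom C z z \<Longrightarrow> basis_vector g \<in> corner alg e"
  unfolding corner_alg by (auto simp: basis_vector_def)

lemma scaled_e_mult: "b \<in> corner alg e \<Longrightarrow> (\<lambda>h. r * e h) \<otimes>\<^bsub>alg\<^esub> b = (\<lambda>h. r * b h)"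
  unfolding alg_scale_left by (simp add: corner_def)

lemma corner_submodule_subspace:
  assumes "corner_submodule alg (e :: 'm \<Rightarrow> 'k::field) n Z"
  shows "module.subspace family_scale Z"
proof -
  interpret V: vector_space "family_scale :: 'k \<Rightarrow> (nat \<Rightarrow> 'm \<Rightarrow> 'k) \<Rightarrow> _" by (rule family_vector_space)
  show ?thesis
  proof (rule V.subspaceI)
    show "0 \<in> Z" using assms by (simp add: corner_submodule_def alg_zero zero_fun_def)
    show "v + w \<in> Z" if "v \<in> Z" "w \<in> Z" for v w
      using assms that by (auto simp: corner_submodule_def alg_add plus_fun_def)
    show "family_scale r w \<in> Z" if "w \<in> Z" for r w
    proof -
      have "(\<lambda>i. (\<lambda>h. r * e h) \<otimes>\<^bsub>alg\<^esub> w i) \<in> Z"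
        using assms corner_scaled_e[of r] that unfolding corner_submodule_def by blast
      moreover have "w i \<in> corner alg e" for i using assms that by (simp add: corner_submodule_def)
      ultimately show ?thesis by (simp add: scaled_e_mult family_scale_def)
    qed
  qed
qed

lemma corner_submodule_expand:
  assumes "corner_submodule alg e n Z" "w \<in> Z"
  shows "w = (\<Sum>(i, g)\<in>{..<n} \<times> Hom C z z. family_scale (w i g) (family_unit i g))"
proof (rule family_expand)
  show "finite (Hom C z z)" by (rule finite_subset[OF _ fin]) (auto simp: Hom_iff)
qed (use assms in \<open>auto simp: corner_submodule_def corner_alg alg_zero\<close>)

text \<open>
  Submodules are subspaces of a finite-dimensional space, and a basis over the field generates.
\<close>

lemma group_algebra_noetherian:
  assumes Z: "corner_submodule alg (e :: 'm \<Rightarrow> 'k::field) n Z"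
  shows "\<exists>ws. set ws \<subseteq> Z \<and> (\<forall>w\<in>Z. \<exists>b. (\<forall>j. b j \<in> corner alg e) \<and>
          (\<forall>i. w i = (\<Oplus>\<^bsub>alg\<^esub>j\<in>{..<length ws}. b j \<otimes>\<^bsub>alg\<^esub> (ws ! j) i)))"
proof -
  interpret V: vector_space "family_scale :: 'k \<Rightarrow> (nat \<Rightarrow> 'm \<Rightarrow> 'k) \<Rightarrow> _" by (rule family_vector_space)
  let ?T = "(\<lambda>(i, g). family_unit i g :: nat \<Rightarrow> 'm \<Rightarrow> 'k) ` ({..<n} \<times> Hom C z z)"
  have "finite (Hom C z z)" by (rule finite_subset[OF _ fin]) (auto simp: Hom_iff)
  then have T: "finite ?T" by simp
  have "Z \<subseteq> V.span ?T"
  proof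
    fix w assume w: "w \<in> Z"
    have "(\<Sum>(i, g)\<in>{..<n} \<times> Hom C z z. family_scale (w i g) (family_unit i g)) \<in> V.span ?T"
      unfolding case_prod_unfold
      by (intro V.span_sum V.span_scale V.span_base) (erule rev_image_eqI, rule refl)
    then show "w \<in> V.span ?T" using corner_submodule_expand[OF Z w] by simp
  qed
  from subspace_finite_generators[OF family_vector_space T this]
  obtain ws where ws: "set ws \<subseteq> Z"
    and gen: "\<forall>x\<in>Z. \<exists>u. x = (\<Sum>j<length ws. family_scale (u j) (ws ! j))" by auto
  have wsc: "(ws ! j) i \<in> corner alg e" if "j < length ws" for i j
    using Z ws nth_mem[OF that] by (auto simp: corner_submodule_def)
  have "\<exists>b. (\<forall>j. b j \<in> corner alg e) \<and> (\<forall>i. w i = (\<Oplus>\<^bsub>alg\<^esub>j\<in>{..<length ws}. b j \<otimes>\<^bsub>alg\<^esub> (ws ! j) i))"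
    if w: "w \<in> Z" for w
  proof -
    obtain u where u: "w = (\<Sum>j<length ws. family_scale (u j) (ws ! j))" using gen w by blast
    let ?b = "\<lambda>j h. u j * e h"
    have "w i = (\<Oplus>\<^bsub>alg\<^esub>j\<in>{..<length ws}. ?b j \<otimes>\<^bsub>alg\<^esub> (ws ! j) i)" for i
    proof
      fix h
      have "(\<Oplus>\<^bsub>alg\<^esub>j\<in>{..<length ws}. ?b j \<otimes>\<^bsub>alg\<^esub> (ws ! j) i) h = (\<Sum>j<length ws. (?b j \<otimes>\<^bsub>alg\<^esub> (ws ! j) i) h)"
        by (rule alg_finsum) (simp add: alg_mult_closed)
      also have "\<dots> = (\<Sum>j<length ws. u j * (ws ! j) i h)"
        using wsc by (simp add: scaled_e_mult)
      also have "\<dots> = w i h" by (subst u) (simp add: sum_fun_apply family_scale_def)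
      finally show "w i h = (\<Oplus>\<^bsub>alg\<^esub>j\<in>{..<length ws}. ?b j \<otimes>\<^bsub>alg\<^esub> (ws ! j) i) h" by simp
    qed
    then show ?thesis using corner_scaled_e by (intro exI[of _ ?b]) auto
  qed
  then show ?thesis using ws by blast
qed

lemma group_mult_coeff_ident:
  assumes "a \<in> corner alg e" "b \<in> corner alg (e :: 'm \<Rightarrow> 'k::field)"
  shows "(a \<otimes>\<^bsub>alg\<^esub> b) (Ident C z) = (\<Sum>g\<in>Hom C z z. a g * b (ginv g))"
proof -
  have H: "Hom C z z \<subseteq> Arr C" by (auto simp: Hom_iff)
  have "(a \<otimes>\<^bsub>alg\<^esub> b) (Ident C z) =
    (\<Sum>f\<in>Arr C. if f \<in> Hom C z z then (\<Sum>g\<in>Arr C. if g = ginv f then a f * b g else 0) else 0)"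
    unfolding alg_mult
  proof (intro sum.cong refl)
    fix f assume "f \<in> Arr C"
    show "(\<Sum>g\<in>Arr C. if Dom C f = Cod C g \<and> f \<cdot> g = Ident C z then a f * b g else 0)
      = (if f \<in> Hom C z z then (\<Sum>g\<in>Arr C. if g = ginv f then a f * b g else 0) else 0)"
    proof (cases "f \<in> Hom C z z")
      case True
      have *: "(Dom C f = Cod C g \<and> f \<cdot> g = Ident C z) \<longleftrightarrow> g = ginv f" if "g \<in> Arr C" "b g \<noteq> 0" for g
      proof -
        have "g \<in> Hom C z z" using that assms(2) by (auto simp: corner_alg)
        then have "Dom C f = Cod C g" using True by (simp add: Hom_iff)
        then show ?thesis using ginv_unique[OF \<open>g \<in> Hom C z z\<close> True] ginv(3)[OF True] by blast
      qed
      have "(\<Sum>g\<in>Arr C. if Dom C f = Cod C g \<and> f \<cdot> g = Ident C z then a f * b g else 0)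
        = (\<Sum>g\<in>Arr C. if g = ginv f then a f * b g else 0)"
      proof (intro sum.cong refl)
        fix g assume "g \<in> Arr C"
        with * show "(if Dom C f = Cod C g \<and> f \<cdot> g = Ident C z then a f * b g else 0)
          = (if g = ginv f then a f * b g else 0)" by (cases "b g = 0") auto
      qed
      then show ?thesis using True by simp
    next
      case False
      then show ?thesis using assms(1) by (auto simp: corner_alg intro!: sum.neutral)
    qed
  qed
  also have "\<dots> = (\<Sum>f\<in>Arr C. if f \<in> Hom C z z then a f * b (ginv f) else 0)"
    using ginv(1) H by (intro sum.cong refl) (auto simp: fin)
  also have "\<dots> = (\<Sum>f\<in>Hom C z z. a f * b (ginv f))"
    using H by (simp add: sum.If_cases fin Int_absorb1)
  finally show ?thesis .
qed

lemma basis_shift: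
  assumes g: "g \<in> Hom C z z" and b: "b \<in> corner alg (e :: 'm \<Rightarrow> 'k::field)"
  shows "(basis_vector (ginv g) \<otimes>\<^bsub>alg\<^esub> b) (Ident C z) = b g"
proof -
  have H: "Hom C z z \<subseteq> Arr C" by (auto simp: Hom_iff)
  have "(basis_vector (ginv g) \<otimes>\<^bsub>alg\<^esub> b) (Ident C z)
     = (\<Sum>h\<in>Hom C z z. basis_vector (ginv g) h * b (ginv h))"
    by (rule group_mult_coeff_ident[OF corner_basis[OF ginv(1)[OF g]] b])
  also have "\<dots> = (\<Sum>h\<in>Hom C z z. if h = ginv g then b (ginv (ginv g)) else 0)"
    by (intro sum.cong refl) (auto simp: basis_vector_def)
  also have "\<dots> = b (ginv (ginv g))" using ginv(1)[OF g] finite_subset[OF H fin] by simp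
  also have "ginv (ginv g) = g" using ginv_unique[OF g ginv(1)[OF g] ginv(2)[OF g]] by simp
  finally show ?thesis .
qed

text \<open>
  A group algebra is self-injective because it is a symmetric algebra.  The coefficient of \<open>f\<close> at the
  identity is a linear functional on \<open>Z\<close>, which extends to a functional \<open>\<Lambda>\<close> on all families of vectors.  On
  families of elements of the group algebra, every functional is the coefficient at the identity of right
  multiplication by a column \<open>c\<close>: the i-th entry has at \<open>g\<close> the value of the functional at the
  unit family for \<open>i\<close> and the inverse of \<open>g\<close>.
\<close>

lemma group_algebra_injective:
  fixes f :: "(nat \<Rightarrow> 'm \<Rightarrow> 'k::field) \<Rightarrow> 'm \<Rightarrow> 'k"
  assumes Z: "corner_submodule alg e n Z" and fc: "\<And>w. w \<in> Z \<Longrightarrow> f w \<in> corner alg e"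
    and fa: "\<And>v w. v \<in> Z \<Longrightarrow> w \<in> Z \<Longrightarrow> f (\<lambda>i. v i \<oplus>\<^bsub>alg\<^esub> w i) = f v \<oplus>\<^bsub>alg\<^esub> f w"
    and fs: "\<And>b w. b \<in> corner alg e \<Longrightarrow> w \<in> Z \<Longrightarrow> f (\<lambda>i. b \<otimes>\<^bsub>alg\<^esub> w i) = b \<otimes>\<^bsub>alg\<^esub> f w"
  shows "\<exists>c. (\<forall>i. c i \<in> corner alg e) \<and> (\<forall>w\<in>Z. f w = (\<Oplus>\<^bsub>alg\<^esub>i\<in>{..<n}. w i \<otimes>\<^bsub>alg\<^esub> c i))"
proof -
  interpret A: ring "alg :: ('k, 'm \<Rightarrow> 'k) module" by (rule alg_ring)
  let ?lam = "\<lambda>w. f w (Ident C z)"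
  have "\<exists>\<Lambda>. Vector_Spaces.linear family_scale (*) \<Lambda> \<and> (\<forall>x\<in>Z. \<Lambda> x = ?lam x)"
  proof (rule functional_extend[OF family_vector_space corner_submodule_subspace[OF Z]])
    show "f (v + w) (Ident C z) = f v (Ident C z) + f w (Ident C z)" if "v \<in> Z" "w \<in> Z" for v w
      using fa[OF that] by (simp add: alg_add plus_fun_def)
    show "f (family_scale r w) (Ident C z) = r * f w (Ident C z)" if w: "w \<in> Z" for r w
    proof -
      have "w i \<in> corner alg e" for i using Z w by (simp add: corner_submodule_def)
      then have "family_scale r w = (\<lambda>i. (\<lambda>h. r * e h) \<otimes>\<^bsub>alg\<^esub> w i)"
        by (simp add: scaled_e_mult family_scale_def)
      then show ?thesis using fs[OF corner_scaled_e w, of r] fc[OF w] by (simp add: scaled_e_mult)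
    qed
  qed
  then obtain \<Lambda> where \<Lambda>: "Vector_Spaces.linear family_scale (*) \<Lambda>" "\<And>x. x \<in> Z \<Longrightarrow> \<Lambda> x = f x (Ident C z)" by blast
  interpret \<Lambda>: Vector_Spaces.linear family_scale "(*) :: 'k \<Rightarrow> 'k \<Rightarrow> 'k" \<Lambda> by (rule \<Lambda>(1))
  define c where "c i g = (if g \<in> Hom C z z then \<Lambda> (family_unit i (ginv g)) else 0)" for i g
  have cc: "c i \<in> corner alg e" for i by (simp add: corner_alg c_def)
  have wc: "w i \<in> corner alg e" if "w \<in> Z" for w i using Z that by (simp add: corner_submodule_def)
  have invol: "ginv (ginv g) = g" if "g \<in> Hom C z z" for g
    using ginv_unique[OF that ginv(1)[OF that] ginv(2)[OF that]] by simp
  \<comment> \<open>It suffices to compare coefficients at the identity, as translation moves any other one there.\<close>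
  have at_ident: "f w (Ident C z) = (\<Sum>i<n. (w i \<otimes>\<^bsub>alg\<^esub> c i) (Ident C z))" if w: "w \<in> Z" for w
  proof -
    have "f w (Ident C z) = \<Lambda> (\<Sum>(i, g)\<in>{..<n} \<times> Hom C z z. family_scale (w i g) (family_unit i g))"
      by (subst corner_submodule_expand[OF Z w, symmetric]) (simp add: \<Lambda>(2)[OF w])
    also have "\<dots> = (\<Sum>(i, g)\<in>{..<n} \<times> Hom C z z. w i g * \<Lambda> (family_unit i g))"
      by (simp add: \<Lambda>.sum case_prod_unfold \<Lambda>.scale)
    also have "\<dots> = (\<Sum>i<n. \<Sum>g\<in>Hom C z z. w i g * c i (ginv g))"
      by (subst sum.cartesian_product[symmetric]) (auto simp: c_def ginv invol intro!: sum.cong)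
    also have "\<dots> = (\<Sum>i<n. (w i \<otimes>\<^bsub>alg\<^esub> c i) (Ident C z))"
      using wc[OF w] cc by (simp add: group_mult_coeff_ident)
    finally show ?thesis .
  qed
  have "f w = (\<Oplus>\<^bsub>alg\<^esub>i\<in>{..<n}. w i \<otimes>\<^bsub>alg\<^esub> c i)" if w: "w \<in> Z" for w
  proof
    fix g
    have wcs: "w i \<otimes>\<^bsub>alg\<^esub> c i \<in> corner alg e" for i
    proof -
      have "w i \<in> carrier alg" "c i \<in> carrier alg" "e \<otimes>\<^bsub>alg\<^esub> w i = w i" "c i \<otimes>\<^bsub>alg\<^esub> e = c i"
        using wc[OF w, of i] cc[of i] by (simp_all add: corner_def)
      then show ?thesis by (simp add: corner_def alg_mult_closed alg_mult_assoc) (metis alg_mult_assoc)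
    qed
    have rhs: "(\<Oplus>\<^bsub>alg\<^esub>i\<in>{..<n}. w i \<otimes>\<^bsub>alg\<^esub> c i) g = (\<Sum>i<n. (w i \<otimes>\<^bsub>alg\<^esub> c i) g)"
      by (rule alg_finsum) (simp add: alg_mult_closed)
    show "f w g = (\<Oplus>\<^bsub>alg\<^esub>i\<in>{..<n}. w i \<otimes>\<^bsub>alg\<^esub> c i) g"
    proof (cases "g \<in> Hom C z z")
      case True
      let ?b = "basis_vector (ginv g) :: 'm \<Rightarrow> 'k"
      have bc: "?b \<in> corner alg e" by (rule corner_basis[OF ginv(1)[OF True]])
      have bw: "(\<lambda>i. ?b \<otimes>\<^bsub>alg\<^esub> w i) \<in> Z" using Z bc w by (simp add: corner_submodule_def)
      have "f w g = (?b \<otimes>\<^bsub>alg\<^esub> f w) (Ident C z)" using basis_shift[OF True fc[OF w]] by simp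
      also have "\<dots> = f (\<lambda>i. ?b \<otimes>\<^bsub>alg\<^esub> w i) (Ident C z)" using fs[OF bc w] by simp
      also have "\<dots> = (\<Sum>i<n. (?b \<otimes>\<^bsub>alg\<^esub> w i \<otimes>\<^bsub>alg\<^esub> c i) (Ident C z))" by (rule at_ident[OF bw])
      also have "\<dots> = (\<Sum>i<n. (w i \<otimes>\<^bsub>alg\<^esub> c i) g)"
        by (simp add: alg_mult_assoc basis_shift[OF True wcs])
      finally show ?thesis using rhs by simp
    next
      case False
      then show ?thesis using fc[OF w] wcs unfolding rhs by (simp add: corner_alg)
    qed
  qed
  then show ?thesis using cc by blast
qed

end

section \<open>Stabilizers of morphisms\<close>

context group_object
begin

lemma G_finite: "finite (Hom C z x)" by (rule finite_subset[OF _ fin]) (auto simp: Hom_iff)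

lemma comp_G: "f \<in> Hom C z x \<Longrightarrow> g \<in> Hom C z z \<Longrightarrow> f \<cdot> g \<in> Hom C z x"
  by (rule comp_hom)

lemma comp_assoc_G: "f \<in> Hom C z x \<Longrightarrow> g \<in> Hom C z z \<Longrightarrow> h \<in> Hom C z z \<Longrightarrow> f \<cdot> (g \<cdot> h) = f \<cdot> g \<cdot> h"
  using comp_assoc by blast

lemma ginv_ginv: "g \<in> Hom C z z \<Longrightarrow> ginv (ginv g) = g"
  using ginv_unique[of g "ginv g"] ginv[of g] by simp

lemma ginv_bij: "bij_betw ginv (Hom C z z) (Hom C z z)"
  by (rule bij_betw_byWitness[of _ ginv]) (auto simp: ginv_ginv ginv(1))

lemma comp_eq_iff:
  assumes "f \<in> Hom C z x" "f' \<in> Hom C z x" "g \<in> Hom C z z"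
  shows "f \<cdot> g = f' \<longleftrightarrow> f = f' \<cdot> ginv g"
  using ginv_cancel[OF assms(3,1)] ginv_cancel[OF assms(3,2)] by auto

lemma left_translation_bij:
  assumes g: "g \<in> Hom C z z" shows "bij_betw (\<lambda>h. g \<cdot> h) (Hom C z z) (Hom C z z)"
proof (rule bij_betw_byWitness[of _ "\<lambda>h. ginv g \<cdot> h"])
  show "\<forall>h\<in>Hom C z z. ginv g \<cdot> (g \<cdot> h) = h" "\<forall>h\<in>Hom C z z. g \<cdot> (ginv g \<cdot> h) = h"
    using g ginv[OF g] comp_assoc_G comp_ident_left by auto
qed (use g ginv[OF g] comp_G in auto)

lemma sum_pairs_right:
  assumes "f' \<in> Hom C z x"
  shows "(\<Sum>(f, g) | f \<in> Hom C z x \<and> g \<in> Hom C z z \<and> f \<cdot> g = f'. F f g) = (\<Sum>g\<in>Hom C z z. F (f' \<cdot> ginv g) g)"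
proof (rule sum.reindex_bij_witness[of _ "\<lambda>g. (f' \<cdot> ginv g, g)" snd])
  fix p assume "p \<in> {(f, g). f \<in> Hom C z x \<and> g \<in> Hom C z z \<and> f \<cdot> g = f'}"
  then obtain f g where p: "p = (f, g)" "f \<in> Hom C z x" "g \<in> Hom C z z" "f \<cdot> g = f'" by auto
  then show "(f' \<cdot> ginv (snd p), snd p) = p" "snd p \<in> Hom C z z"
    "F (f' \<cdot> ginv (snd p)) (snd p) = (case p of (f, g) \<Rightarrow> F f g)"
    using ginv_cancel[of g f x] by auto
next
  fix g assume "g \<in> Hom C z z"
  then show "(f' \<cdot> ginv g, g) \<in> {(f, g). f \<in> Hom C z x \<and> g \<in> Hom C z z \<and> f \<cdot> g = f'}"
    using assms ginv_cancel[of g f' x] ginv(1) comp_G by auto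
qed simp

lemma mult_corner_right:
  assumes b: "b \<in> corner alg (e :: 'm \<Rightarrow> 'k::field)" and f: "f' \<in> Hom C z x"
  shows "(a \<otimes>\<^bsub>alg\<^esub> b) f' = (\<Sum>g\<in>Hom C z z. a (f' \<cdot> ginv g) * b g)"
proof -
  have "(a \<otimes>\<^bsub>alg\<^esub> b) f' = (\<Sum>(f, g) | f \<in> Arr C \<and> g \<in> Arr C \<and> Dom C f = Cod C g \<and> f \<cdot> g = f'. a f * b g)"
    by (simp add: category_algebra_def)
  also have "\<dots> = (\<Sum>(f, g) | f \<in> Hom C z x \<and> g \<in> Hom C z z \<and> f \<cdot> g = f'. a f * b g)"
  proof (rule sum.mono_neutral_cong_right)
    show "finite {(f, g). f \<in> Arr C \<and> g \<in> Arr C \<and> Dom C f = Cod C g \<and> f \<cdot> g = f'}"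
      by (rule finite_subset[of _ "Arr C \<times> Arr C"]) (auto simp: fin)
    show "{(f, g). f \<in> Hom C z x \<and> g \<in> Hom C z z \<and> f \<cdot> g = f'}
       \<subseteq> {(f, g). f \<in> Arr C \<and> g \<in> Arr C \<and> Dom C f = Cod C g \<and> f \<cdot> g = f'}"
      by (auto simp: Hom_iff)
    show "\<forall>p\<in>{(f, g). f \<in> Arr C \<and> g \<in> Arr C \<and> Dom C f = Cod C g \<and> f \<cdot> g = f'} -
        {(f, g). f \<in> Hom C z x \<and> g \<in> Hom C z z \<and> f \<cdot> g = f'}. (case p of (f, g) \<Rightarrow> a f * b g) = 0"
    proof
      fix p assume "p \<in> {(f, g). f \<in> Arr C \<and> g \<in> Arr C \<and> Dom C f = Cod C g \<and> f \<cdot> g = f'} -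
        {(f, g). f \<in> Hom C z x \<and> g \<in> Hom C z z \<and> f \<cdot> g = f'}"
      then obtain l g where p: "p = (l, g)" "l \<in> Arr C" "g \<in> Arr C" "Dom C l = Cod C g" "f' = l \<cdot> g"
        "l \<in> Hom C z x \<longrightarrow> g \<notin> Hom C z z" by auto
      have "l \<in> Hom C z x" if "g \<in> Hom C z z"
        using that p(2-5) f Comp_arr[of l g] by (auto simp: Hom_iff)
      then have "g \<notin> Hom C z z" using p(6) by blast
      then show "(case p of (f, g) \<Rightarrow> a f * b g) = 0" using b p(1) by (simp add: corner_alg)
    qed
  qed auto
  also have "\<dots> = (\<Sum>g\<in>Hom C z z. a (f' \<cdot> ginv g) * b g)" by (rule sum_pairs_right[OF f])
  finally show ?thesis .
qed

lemma Aut_carrier: "carrier (Aut C z) = Hom C z z"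
  using end_iso by (auto simp: Aut_def)

definition stab :: "'m \<Rightarrow> 'm set" where
  "stab f = {g \<in> Hom C z z. f \<cdot> g = f}"

lemma stab_comp:
  assumes "f \<in> Hom C z x" "g \<in> stab f" "h \<in> stab f"
  shows "g \<cdot> h \<in> stab f" "ginv g \<in> stab f"
proof -
  have gh: "g \<in> Hom C z z" "h \<in> Hom C z z" "f \<cdot> g = f" "f \<cdot> h = f" using assms by (auto simp: stab_def)
  show "g \<cdot> h \<in> stab f" using comp_assoc_G[OF assms(1) gh(1,2)] gh comp_G[OF gh(1,2)] by (simp add: stab_def)
  show "ginv g \<in> stab f" using ginv_cancel(1)[OF gh(1) assms(1)] gh ginv(1)[OF gh(1)] by (simp add: stab_def)
qed

text \<open>
  The vector of the morphism \<open>f\<close> is invariant under the stabilizer \<open>H\<close> of \<open>f\<close>.  In a free module the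
  invariants of \<open>H\<close> are the multiples of the sum of the elements of \<open>H\<close>, and this passes to direct
  summands.  But the coefficient at \<open>f\<close> of such a multiple is divisible by the order of \<open>H\<close>, while
  that of the vector of \<open>f\<close> is \<open>1\<close>.
\<close>

lemma stabilizer_invertible:
  assumes P: "projective_module (op_ring (group_algebra (Aut C z) :: ('k::field, 'm \<Rightarrow> 'k) module))
      (hom_right_module C z x)"
    and f: "f \<in> Hom C z x"
  shows "of_nat (card (stab f)) \<noteq> (0 :: 'k)"
proof -
  let ?R = "op_ring (group_algebra (Aut C z) :: ('k, 'm \<Rightarrow> 'k) module)"
  let ?P = "hom_right_module C z x :: ('m \<Rightarrow> 'k, 'm \<Rightarrow> 'k) module"
  let ?G = "Hom C z z"
  have Rc: "carrier ?R = {a. \<forall>g. g \<notin> ?G \<longrightarrow> a g = 0}"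
    by (simp add: op_ring_def group_algebra_def linear_span_def Aut_carrier)
  have Rz: "\<zero>\<^bsub>?R\<^esub> = (\<lambda>h. 0)" by (simp add: op_ring_def group_algebra_def)
  have Rm: "(a \<otimes>\<^bsub>?R\<^esub> b) g = (\<Sum>h\<in>?G. b (g \<cdot> ginv h) * a h)" if "g \<in> ?G" for a b g
    using sum_pairs_right[OF that, of "\<lambda>f g. b f * a g"]
    by (simp add: op_ring_def group_algebra_def Aut_carrier) (simp add: Aut_def)
  have Rm0: "(a \<otimes>\<^bsub>?R\<^esub> b) g = 0" if "g \<notin> ?G" for a b g
  proof -
    have "(a \<otimes>\<^bsub>?R\<^esub> b) g = (\<Sum>(f, h) | f \<in> ?G \<and> h \<in> ?G \<and> f \<cdot> h = g. b f * a h)"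
      by (simp add: op_ring_def group_algebra_def Aut_carrier) (simp add: Aut_def)
    also have "{(f, h). f \<in> ?G \<and> h \<in> ?G \<and> f \<cdot> h = g} = {}" using that comp_G by auto
    finally show ?thesis by simp
  qed
  have Pc: "carrier ?P = {v. \<forall>h. h \<notin> Hom C z x \<longrightarrow> v h = 0}"
    by (simp add: hom_right_module_def linear_span_def)
  have Ps: "(a \<odot>\<^bsub>?P\<^esub> v) h = (\<Sum>g\<in>?G. v (h \<cdot> ginv g) * a g)" if "h \<in> Hom C z x" for a v h
    using sum_pairs_right[OF that, of "\<lambda>f g. v f * a g"] by (simp add: hom_right_module_def Aut_carrier)
  have Ps0: "(a \<odot>\<^bsub>?P\<^esub> v) h = 0" if "h \<notin> Hom C z x" for a v h
  proof -
    have "(a \<odot>\<^bsub>?P\<^esub> v) h = (\<Sum>(f, g) | f \<in> Hom C z x \<and> g \<in> ?G \<and> f \<cdot> g = h. v f * a g)"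
      by (simp add: hom_right_module_def Aut_carrier)
    also have "{(f, g). f \<in> Hom C z x \<and> g \<in> ?G \<and> f \<cdot> g = h} = {}" using that comp_G by auto
    finally show ?thesis by simp
  qed
  obtain I :: "('m \<Rightarrow> 'k) set" and s r where s: "s \<in> mod_hom ?R ?P (free_module ?R I)"
    and r: "r \<in> mod_hom ?R (free_module ?R I) ?P" and rs: "\<And>v. v \<in> carrier ?P \<Longrightarrow> r (s v) = v"
    using P unfolding projective_module_def by blast
  let ?F = "free_module ?R I"
  have Fc: "carrier ?F = {v. (\<forall>i. v i \<in> carrier ?R) \<and> (\<forall>i. i \<notin> I \<longrightarrow> v i = (\<lambda>h. 0)) \<and> finite {i. v i \<noteq> (\<lambda>h. 0)}}"
    by (simp add: free_module_def Rz)
  have Fs: "(a \<odot>\<^bsub>?F\<^esub> v) i = a \<otimes>\<^bsub>?R\<^esub> v i" for a v i by (simp add: free_module_def)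
  let ?d = "basis_vector f :: 'm \<Rightarrow> 'k"
  let ?H = "stab f"
  have HG: "?H \<subseteq> ?G" by (auto simp: stab_def)
  have finH: "finite ?H" using finite_subset[OF HG G_finite] .
  have dP: "?d \<in> carrier ?P" using f by (auto simp: Pc basis_vector_def)
  define v where "v = s ?d"
  have vF: "v \<in> carrier ?F" unfolding v_def by (rule mod_hom_closed[OF s dP])
  have inv: "v i (g \<cdot> ginv h) = v i g" if h: "h \<in> ?H" and g: "g \<in> ?G" for h g i
  proof -
    let ?b = "basis_vector h :: 'm \<Rightarrow> 'k"
    have hG: "h \<in> ?G" "f \<cdot> h = f" using h by (auto simp: stab_def)
    have bR: "?b \<in> carrier ?R" using hG by (auto simp: Rc basis_vector_def)
    have "?b \<odot>\<^bsub>?P\<^esub> ?d = ?d"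
    proof
      fix k show "(?b \<odot>\<^bsub>?P\<^esub> ?d) k = ?d k"
      proof (cases "k \<in> Hom C z x")
        case True
        have "(?b \<odot>\<^bsub>?P\<^esub> ?d) k = (\<Sum>g\<in>?G. if g = h then ?d (k \<cdot> ginv h) else 0)"
          unfolding Ps[OF True] by (intro sum.cong refl) (auto simp: basis_vector_def)
        also have "\<dots> = ?d (k \<cdot> ginv h)" using hG G_finite by simp
        also have "\<dots> = ?d k" using comp_eq_iff[OF f True hG(1)] hG(2) by (auto simp: basis_vector_def)
        finally show ?thesis .
      next
        case False
        then show ?thesis using f Ps0 by (auto simp: basis_vector_def)
      qed
    qed
    then have "v = ?b \<odot>\<^bsub>?F\<^esub> v" unfolding v_def using mod_hom_smult[OF s bR dP] by simp
    then have "v i g = (?b \<otimes>\<^bsub>?R\<^esub> v i) g" using Fs by metis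
    also have "\<dots> = (\<Sum>k\<in>?G. if k = h then v i (g \<cdot> ginv h) else 0)"
      unfolding Rm[OF g] by (intro sum.cong refl) (auto simp: basis_vector_def)
    also have "\<dots> = v i (g \<cdot> ginv h)" using hG G_finite by simp
    finally show ?thesis by simp
  qed
  \<comment> \<open>Keeping the coefficients of \<open>v\<close> at coset representatives only yields an element \<open>u\<close> of which \<open>v\<close> is
    the multiple by the sum of the stabilizer.\<close>
  define rep where "rep g = (SOME k. k \<in> (\<lambda>h. g \<cdot> ginv h) ` ?H)" for g
  have fI: "Ident C z \<in> ?H" using f ident_hom[OF z] comp_ident_right by (auto simp: stab_def)
  have rep: "rep g \<in> (\<lambda>h. g \<cdot> ginv h) ` ?H" for g
    unfolding rep_def by (rule someI_ex) (use fI in blast)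
  have ginv_mult: "ginv (h \<cdot> k) = ginv k \<cdot> ginv h" if hk: "h \<in> ?G" "k \<in> ?G" for h k
  proof -
    have "(h \<cdot> k) \<cdot> (ginv k \<cdot> ginv h) = Ident C z"
      using comp_assoc_G[OF comp_G[OF hk] ginv(1)[OF hk(2)] ginv(1)[OF hk(1)]] ginv_cancel(1)[OF hk(2,1)] ginv(3)[OF hk(1)]
      by simp
    then show ?thesis using ginv_unique[OF comp_G[OF ginv(1)[OF hk(2)] ginv(1)[OF hk(1)]] comp_G[OF hk]] by simp
  qed
  have rep_coset: "rep (g \<cdot> ginv h) = rep g" if h: "h \<in> ?H" and g: "g \<in> ?G" for g h
  proof -
    have hG: "h \<in> ?G" using h HG by blast
    have "(\<lambda>k. g \<cdot> ginv h \<cdot> ginv k) ` ?H = (\<lambda>k. g \<cdot> ginv k) ` ?H"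
    proof (rule equalityI; rule subsetI)
      fix y assume "y \<in> (\<lambda>k. g \<cdot> ginv h \<cdot> ginv k) ` ?H"
      then obtain k where k: "k \<in> ?H" "y = g \<cdot> ginv h \<cdot> ginv k" by auto
      have kG: "k \<in> ?G" using k HG by blast
      have "y = g \<cdot> ginv (k \<cdot> h)"
        using k(2) comp_assoc_G[OF g ginv(1)[OF hG] ginv(1)[OF kG]] ginv_mult[OF kG hG] by simp
      then show "y \<in> (\<lambda>k. g \<cdot> ginv k) ` ?H" using stab_comp(1)[OF f k(1) h] by blast
    next
      fix y assume "y \<in> (\<lambda>k. g \<cdot> ginv k) ` ?H"
      then obtain k where k: "k \<in> ?H" "y = g \<cdot> ginv k" by auto
      have kG: "k \<in> ?G" using k HG by blast
      let ?k = "k \<cdot> ginv h"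
      have kH: "?k \<in> ?H" using stab_comp[OF f] k(1) h by blast
      have "ginv ?k = h \<cdot> ginv k" using ginv_mult[OF kG ginv(1)[OF hG]] ginv_ginv[OF hG] by simp
      then have "g \<cdot> ginv h \<cdot> ginv ?k = g \<cdot> ginv h \<cdot> h \<cdot> ginv k"
        using comp_assoc_G[OF comp_G[OF g ginv(1)[OF hG]] hG ginv(1)[OF kG]] by simp
      also have "\<dots> = y" using ginv_cancel(2)[OF hG g] k(2) by simp
      finally show "y \<in> (\<lambda>k. g \<cdot> ginv h \<cdot> ginv k) ` ?H" using kH by force
    qed
    then show ?thesis by (simp add: rep_def)
  qed
  define u where "u i g = (if g \<in> ?G \<and> rep g = g then v i g else 0)" for i g
  define N :: "'m \<Rightarrow> 'k" where "N g = (if g \<in> ?H then 1 else 0)" for g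
  have NR: "N \<in> carrier ?R" using HG by (auto simp: Rc N_def)
  have uF: "u \<in> carrier ?F"
  proof -
    have "{i. u i \<noteq> (\<lambda>h. 0)} \<subseteq> {i. v i \<noteq> (\<lambda>h. 0)}" by (auto simp: u_def fun_eq_iff)
    from finite_subset[OF this] have "finite {i. u i \<noteq> (\<lambda>h. 0)}" using vF by (simp add: Fc)
    then show ?thesis using vF by (auto simp: Fc Rc u_def fun_eq_iff)
  qed
  have sumN: "(\<Sum>h\<in>?G. F h * N h) = (\<Sum>h\<in>?H. F h)" for F
  proof -
    have "(\<Sum>h\<in>?G. F h * N h) = (\<Sum>h\<in>?G. if h \<in> ?H then F h else 0)"
      by (intro sum.cong refl) (simp add: N_def)
    also have "\<dots> = (\<Sum>h\<in>?H. F h)" using HG by (simp add: sum.If_cases G_finite Int_absorb1)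
    finally show ?thesis .
  qed
  have "N \<odot>\<^bsub>?F\<^esub> u = v"
  proof (intro ext)
    fix i g show "(N \<odot>\<^bsub>?F\<^esub> u) i g = v i g"
    proof (cases "g \<in> ?G")
      case g: True
      obtain h0 where h0: "h0 \<in> ?H" "rep g = g \<cdot> ginv h0" using rep[of g] by auto
      have h0G: "h0 \<in> ?G" using h0 HG by blast
      have "(N \<odot>\<^bsub>?F\<^esub> u) i g = (\<Sum>h\<in>?H. u i (g \<cdot> ginv h))"
        unfolding Fs Rm[OF g] by (rule sumN)
      also have "\<dots> = (\<Sum>h\<in>?H. if h = h0 then v i g else 0)"
      proof (intro sum.cong refl)
        fix h assume h: "h \<in> ?H"
        then have hG: "h \<in> ?G" using HG by blast
        have gh: "g \<cdot> ginv h \<in> ?G" by (rule comp_G[OF g ginv(1)[OF hG]])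
        have "rep (g \<cdot> ginv h) = g \<cdot> ginv h \<longleftrightarrow> g \<cdot> ginv h0 = g \<cdot> ginv h"
          unfolding rep_coset[OF h g] using h0 by simp
        also have "\<dots> \<longleftrightarrow> ginv h0 = ginv h"
          using bij_betw_imp_inj_on[OF left_translation_bij[OF g]] ginv(1)[OF hG] ginv(1)[OF h0G] by (auto simp: inj_on_def)
        also have "\<dots> \<longleftrightarrow> h = h0" using ginv_ginv[OF hG] ginv_ginv[OF h0G] by metis
        finally show "u i (g \<cdot> ginv h) = (if h = h0 then v i g else 0)"
          using gh inv[OF h g] by (cases "h = h0") (simp_all add: u_def)
      qed
      also have "\<dots> = v i g" using h0(1) finH by simp
      finally show ?thesis .
    next
      case False
      then show ?thesis using vF by (simp add: Fs Rm0 Fc Rc)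
    qed
  qed
  then have "?d = r (N \<odot>\<^bsub>?F\<^esub> u)" using rs[OF dP] by (simp add: v_def)
  also have "\<dots> = N \<odot>\<^bsub>?P\<^esub> r u" by (rule mod_hom_smult[OF r NR uF])
  finally have "?d f = (\<Sum>h\<in>?G. r u (f \<cdot> ginv h) * N h)" using Ps[OF f] by metis
  also have "\<dots> = (\<Sum>h\<in>?H. r u (f \<cdot> ginv h))" by (rule sumN)
  also have "\<dots> = (\<Sum>h\<in>?H. r u f)"
  proof (intro sum.cong refl)
    fix h assume h: "h \<in> ?H"
    have "ginv h \<in> ?H" by (rule stab_comp(2)[OF f h h])
    then show "r u (f \<cdot> ginv h) = r u f" by (simp add: stab_def)
  qed
  finally have "1 = of_nat (card ?H) * r u f" by (simp add: basis_vector_def)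
  then show ?thesis by auto
qed

end

section \<open>Categories with a transitive smallest object\<close>

text \<open>
  The choice of \<open>a x\<close> identifies \<open>Hom(z, x)\<close> with the cosets of its stabilizer in the automorphism
  group of \<open>z\<close>.  The parameter \<open>K\<close> serves to fix the field.
\<close>

locale transitive_category = group_object C z for C :: "('o, 'm) cat" (structure) and z :: 'o +
  fixes a :: "'o \<Rightarrow> 'm" and K :: "'k::field itself"
  assumes to_z: "f \<in> Arr C \<Longrightarrow> Cod C f = z \<Longrightarrow> Dom C f = z"
    and a: "x \<in> Obj C \<Longrightarrow> a x \<in> Hom C z x"
    and orbit: "f \<in> Hom C z x \<Longrightarrow> \<exists>g\<in>Hom C z z. f = a x \<cdot> g"
    and stab_invertible: "x \<in> Obj C \<Longrightarrow> of_nat (card (stab (a x))) \<noteq> (0 :: 'k)"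
begin

abbreviation A :: "('k, 'm \<Rightarrow> 'k) module" where "A \<equiv> alg"

definition weight :: "'o \<Rightarrow> 'k" where "weight x = of_nat (card (stab (a x)))"

lemma weight: "x \<in> Obj C \<Longrightarrow> weight x \<noteq> 0"
  by (simp add: weight_def stab_invertible)

lemma a_arr: "x \<in> Obj C \<Longrightarrow> a x \<in> Arr C \<and> Dom C (a x) = z \<and> Cod C (a x) = x"
  using a by (auto simp: Hom_iff)

lemma Hom_Obj: "f \<in> Hom C z x \<Longrightarrow> x \<in> Obj C"
  using cod_obj by (auto simp: Hom_iff)

lemma fiber_card:
  assumes x: "x \<in> Obj C" and f: "f \<in> Hom C z x"
  shows "card {g \<in> Hom C z z. a x \<cdot> g = f} = card (stab (a x))"
proof -
  obtain g where g: "g \<in> Hom C z z" "f = a x \<cdot> g" using orbit[OF f] by blast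
  have "bij_betw (\<lambda>h. h \<cdot> g) (stab (a x)) {g \<in> Hom C z z. a x \<cdot> g = f}"
  proof (rule bij_betw_byWitness[of _ "\<lambda>h. h \<cdot> ginv g"])
    show "\<forall>h\<in>stab (a x). h \<cdot> g \<cdot> ginv g = h" using g(1) ginv_cancel by (auto simp: stab_def)
    show "\<forall>h\<in>{g \<in> Hom C z z. a x \<cdot> g = f}. h \<cdot> ginv g \<cdot> g = h" using g(1) ginv_cancel by auto
    show "(\<lambda>h. h \<cdot> g) ` stab (a x) \<subseteq> {g \<in> Hom C z z. a x \<cdot> g = f}"
      using g comp_G comp_assoc_G[OF a[OF x] _ g(1)] by (auto simp: stab_def)
    show "(\<lambda>h. h \<cdot> ginv g) ` {g \<in> Hom C z z. a x \<cdot> g = f} \<subseteq> stab (a x)"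
      using g comp_G comp_assoc_G[OF a[OF x] _ ginv(1)[OF g(1)]] ginv[OF g(1)] ginv_cancel(1)[OF g(1) a[OF x]]
      by (auto simp: stab_def)
  qed
  then show ?thesis by (simp add: bij_betw_same_card)
qed

lemma orbit_sum_base:
  assumes x: "x \<in> Obj C"
  shows "(\<Sum>g\<in>Hom C z z. F (a x \<cdot> g)) = weight x * (\<Sum>f\<in>Hom C z x. F f :: 'k)"
proof -
  have "(\<Sum>g\<in>Hom C z z. F (a x \<cdot> g)) = (\<Sum>f\<in>Hom C z x. \<Sum>g\<in>{g \<in> Hom C z z. a x \<cdot> g = f}. F (a x \<cdot> g))"
    by (rule sum.group[symmetric]) (use G_finite comp_G[OF a[OF x]] in auto)
  also have "\<dots> = (\<Sum>f\<in>Hom C z x. weight x * F f)"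
    using fiber_card[OF x] by (intro sum.cong refl) (simp add: weight_def)
  finally show ?thesis by (simp add: sum_distrib_left)
qed

lemma orbit_sum:
  assumes f: "f \<in> Hom C z x"
  shows "(\<Sum>g\<in>Hom C z z. F (f \<cdot> g)) = weight x * (\<Sum>f\<in>Hom C z x. F f :: 'k)"
proof -
  obtain h where h: "h \<in> Hom C z z" "f = a x \<cdot> h" using orbit[OF f] by blast
  have "(\<Sum>g\<in>Hom C z z. F (f \<cdot> g)) = (\<Sum>g\<in>Hom C z z. F (a x \<cdot> (h \<cdot> g)))"
    using h comp_assoc_G[OF a[OF Hom_Obj[OF f]] h(1)] by simp
  also have "\<dots> = (\<Sum>g\<in>Hom C z z. F (a x \<cdot> g))"
    by (rule sum.reindex_bij_betw[OF left_translation_bij[OF h(1)], of "\<lambda>g. F (a x \<cdot> g)"])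
  finally show ?thesis by (simp add: orbit_sum_base[OF Hom_Obj[OF f]])
qed

text \<open>
  Left multiplication by \<open>a x\<close> maps \<open>k G\<close> onto \<open>k Hom(z, x)\<close>, and \<open>L x\<close> is the section of this map that
  distributes the coefficient of a morphism evenly over its preimages.  Being independent of choices, it is right linear
  over \<open>k G\<close>; this is where the stabilizers have to have invertible order.
\<close>

definition L :: "'o \<Rightarrow> ('m \<Rightarrow> 'k) \<Rightarrow> 'm \<Rightarrow> 'k" where
  "L x b = (\<lambda>g. if g \<in> Hom C z z then b (a x \<cdot> g) / weight x else 0)"

lemma L_corner: "L x b \<in> corner A e"
  by (simp add: corner_alg L_def)

lemma L_mult:
  assumes x: "x \<in> Obj C" and b: "b \<in> corner A e"
  shows "L x (c \<otimes>\<^bsub>A\<^esub> b) = L x c \<otimes>\<^bsub>A\<^esub> b"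
proof
  fix g show "L x (c \<otimes>\<^bsub>A\<^esub> b) g = (L x c \<otimes>\<^bsub>A\<^esub> b) g"
  proof (cases "g \<in> Hom C z z")
    case g: True
    have "L x (c \<otimes>\<^bsub>A\<^esub> b) g = (\<Sum>h\<in>Hom C z z. c (a x \<cdot> g \<cdot> ginv h) * b h) / weight x"
      using g by (simp add: L_def mult_corner_right[OF b comp_G[OF a[OF x] g]])
    also have "\<dots> = (\<Sum>h\<in>Hom C z z. L x c (g \<cdot> ginv h) * b h)"
      using g comp_assoc_G[OF a[OF x] g ginv(1)] comp_G[OF g ginv(1)] by (simp add: L_def sum_divide_distrib)
    also have "\<dots> = (L x c \<otimes>\<^bsub>A\<^esub> b) g" by (rule mult_corner_right[OF b g, symmetric])
    finally show ?thesis .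
  next
    case False
    interpret ring A by (rule alg_ring)
    have eA: "e \<in> carrier A" by (rule e_closed)
    have *: "L x c \<in> carrier A" "b \<in> carrier A" "e \<otimes>\<^bsub>A\<^esub> L x c = L x c" "b \<otimes>\<^bsub>A\<^esub> e = b"
      using b L_corner[of x c] by (simp_all add: corner_def)
    then have "L x c \<otimes>\<^bsub>A\<^esub> b \<in> corner A e"
      using m_assoc[OF eA *(1,2)] m_assoc[OF *(1,2) eA] by (simp add: corner_def)
    then show ?thesis using False by (simp add: L_def corner_alg)
  qed
qed

lemma L_expand:
  assumes c: "c \<in> carrier A" "c \<otimes>\<^bsub>A\<^esub> e = c"
  shows "(\<Oplus>\<^bsub>A\<^esub>x\<in>Obj C. basis_vector (a x) \<otimes>\<^bsub>A\<^esub> L x c) = c"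
proof
  fix h
  have c0: "c h = 0" if "\<not> (h \<in> Arr C \<and> Dom C h = z)"
    using that fun_cong[OF c(2), of h] unfolding e_right by (auto split: if_splits)
  have coeff: "(basis_vector (a x) \<otimes>\<^bsub>A\<^esub> L x c) h = (if x = Cod C h \<and> Dom C h = z \<and> h \<in> Arr C then c h else 0)" if x: "x \<in> Obj C" for x
  proof -
    have "(basis_vector (a x) \<otimes>\<^bsub>A\<^esub> L x c) h = (\<Sum>g\<in>Arr C. if Dom C (a x) = Cod C g \<and> a x \<cdot> g = h then L x c g else 0)"
      using a_arr[OF x] by (simp add: basis_mult_left)
    also have "\<dots> = (\<Sum>g\<in>{g \<in> Hom C z z. a x \<cdot> g = h}. c h / weight x)"
    proof (rule sum.mono_neutral_cong_right[OF fin])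
      show "{g \<in> Hom C z z. a x \<cdot> g = h} \<subseteq> Arr C" by (auto simp: Hom_iff)
      show "\<forall>g\<in>Arr C - {g \<in> Hom C z z. a x \<cdot> g = h}. (if Dom C (a x) = Cod C g \<and> a x \<cdot> g = h then L x c g else 0) = 0"
        by (simp add: L_def)
      show "(if Dom C (a x) = Cod C g \<and> a x \<cdot> g = h then L x c g else 0) = c h / weight x"
        if "g \<in> {g \<in> Hom C z z. a x \<cdot> g = h}" for g
        using that a_arr[OF x] by (auto simp: L_def Hom_iff)
    qed
    also have "\<dots> = of_nat (card {g \<in> Hom C z z. a x \<cdot> g = h}) * (c h / weight x)" by simp
    also have "\<dots> = (if x = Cod C h \<and> Dom C h = z \<and> h \<in> Arr C then c h else 0)"
    proof (cases "h \<in> Hom C z x")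
      case True
      then show ?thesis using fiber_card[OF x True] weight[OF x] by (auto simp: weight_def Hom_iff)
    next
      case False
      then have "{g \<in> Hom C z z. a x \<cdot> g = h} = {}" using comp_G[OF a[OF x]] by auto
      moreover have "\<not> (x = Cod C h \<and> Dom C h = z \<and> h \<in> Arr C)" using False by (auto simp: Hom_iff)
      ultimately show ?thesis by (simp only: card.empty if_False of_nat_0 mult_zero_left)
    qed
    finally show ?thesis .
  qed
  have "(\<Oplus>\<^bsub>A\<^esub>x\<in>Obj C. basis_vector (a x) \<otimes>\<^bsub>A\<^esub> L x c) h = (\<Sum>x\<in>Obj C. (basis_vector (a x) \<otimes>\<^bsub>A\<^esub> L x c) h)"
    by (rule alg_finsum) (simp add: alg_mult_closed)
  also have "\<dots> = (\<Sum>x\<in>Obj C. if x = Cod C h then (if Dom C h = z \<and> h \<in> Arr C then c h else 0) else 0)"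
    using coeff by (intro sum.cong refl) auto
  also have "\<dots> = c h" using c0 cod_obj by (auto simp: fin_Obj)
  finally show "(\<Oplus>\<^bsub>A\<^esub>x\<in>Obj C. basis_vector (a x) \<otimes>\<^bsub>A\<^esub> L x c) h = c h" .
qed

lemma corner_data_alg: "corner_data A e (Obj C) (\<lambda>x. basis_vector (a x)) L"
proof -
  interpret ring A by (rule alg_ring)
  show ?thesis
  proof
    show "\<one>\<^bsub>A\<^esub> \<noteq> \<zero>\<^bsub>A\<^esub>" by (rule alg_one_neq_zero)
    show "e \<in> carrier A" by (rule e_closed)
    show "e \<otimes>\<^bsub>A\<^esub> e = e" by (rule e_idem)
    show "finite (Obj C)" by (rule fin_Obj)
    show "basis_vector (a x) \<in> carrier A" if "x \<in> Obj C" for x using a_arr[OF that] by (simp add: basis_closed)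
    show "L x b \<in> corner A e" for x b by (rule L_corner)
    show "L x (b \<oplus>\<^bsub>A\<^esub> c) = L x b \<oplus>\<^bsub>A\<^esub> L x c" for x b c
      by (auto simp: L_def alg_add fun_eq_iff add_divide_distrib)
    show "L x (c \<otimes>\<^bsub>A\<^esub> b) = L x c \<otimes>\<^bsub>A\<^esub> b" if "x \<in> Obj C" "b \<in> corner A e" for x b c
      by (rule L_mult[OF that])
    show "(\<Oplus>\<^bsub>A\<^esub>x\<in>Obj C. basis_vector (a x) \<otimes>\<^bsub>A\<^esub> L x c) = c" if "c \<in> carrier A" "c \<otimes>\<^bsub>A\<^esub> e = c" for c
      by (rule L_expand[OF that])
    show "\<exists>ws. set ws \<subseteq> Z \<and> (\<forall>w\<in>Z. \<exists>b. (\<forall>j. b j \<in> corner A e) \<and>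
          (\<forall>i. w i = (\<Oplus>\<^bsub>A\<^esub>j\<in>{..<length ws}. b j \<otimes>\<^bsub>A\<^esub> (ws ! j) i)))"
      if "corner_submodule A e n Z" for n Z by (rule group_algebra_noetherian[OF that])
    show "\<exists>c. (\<forall>i. c i \<in> carrier A) \<and> (\<forall>w\<in>Z. f w = (\<Oplus>\<^bsub>A\<^esub>i\<in>{..<n}. w i \<otimes>\<^bsub>A\<^esub> c i))"
      if Z: "corner_submodule A e n Z" and fc: "\<forall>w\<in>Z. f w \<in> carrier A \<and> e \<otimes>\<^bsub>A\<^esub> f w = f w"
        and fa: "\<forall>v\<in>Z. \<forall>w\<in>Z. f (\<lambda>i. v i \<oplus>\<^bsub>A\<^esub> w i) = f v \<oplus>\<^bsub>A\<^esub> f w"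
        and fs: "\<forall>b\<in>corner A e. \<forall>w\<in>Z. f (\<lambda>i. b \<otimes>\<^bsub>A\<^esub> w i) = b \<otimes>\<^bsub>A\<^esub> f w" for n Z f
    proof -
      \<comment> \<open>As no other object maps to \<open>z\<close>, the right ideal of the idempotent is the corner.\<close>
      have "f w \<in> corner A e" if "w \<in> Z" for w
      proof -
        have "f w \<in> carrier A" "e \<otimes>\<^bsub>A\<^esub> f w = f w" using fc that by auto
        then have "f w h = 0" if "h \<notin> Hom C z z" for h
          using that to_z unfolding e_left fun_eq_iff Hom_iff alg_carrier by (metis (no_types, lifting))
        then show ?thesis by (simp add: corner_alg)
      qed
      then have "\<exists>c. (\<forall>i. c i \<in> corner A e) \<and> (\<forall>w\<in>Z. f w = (\<Oplus>\<^bsub>A\<^esub>i\<in>{..<n}. w i \<otimes>\<^bsub>A\<^esub> c i))"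
        using fa fs by (intro group_algebra_injective[OF Z]) auto
      then show ?thesis by (auto simp: corner_def)
    qed
  qed
qed

lemma op_group_object: "group_object (op_cat C) z"
proof -
  interpret op: fin_category "op_cat C" by (rule fin_category_op) (rule fin_category_axioms)
  show ?thesis
  proof
    fix g assume "g \<in> Hom (op_cat C) z z"
    then have g: "g \<in> Hom C z z" by simp
    show "iso_arrow (op_cat C) g"
      unfolding iso_arrow_def inverse_arrows_def using g ginv[OF g] by (intro exI[of _ "ginv g"]) (auto simp: Hom_iff)
  qed (simp add: z)
qed

sublocale op: group_object "op_cat C" z by (rule op_group_object)

abbreviation Aop :: "('k, 'm \<Rightarrow> 'k) module" where "Aop \<equiv> op.alg"

lemma Aop_eq: "op_ring A = Aop" by (rule op_category_algebra)

lemma Aop_mult: "b \<otimes>\<^bsub>Aop\<^esub> c = c \<otimes>\<^bsub>A\<^esub> b"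
  unfolding Aop_eq[symmetric] by (simp add: op_ring_def)

lemma Aop_simps: "carrier Aop = carrier A" "add Aop = add A" "zero Aop = zero A" "one Aop = one A"
  unfolding Aop_eq[symmetric] by (simp_all add: op_ring_def)

lemma Aop_finsum: "finsum Aop F J = finsum A F J"
  unfolding Aop_eq[symmetric] by (simp add: finsum_def op_ring_def finprod_def)

lemma Aop_corner: "corner Aop e = corner A e"
  unfolding corner_alg by (rule op.corner_alg[unfolded op_cat_simps op_cat_Hom])

text \<open>
  Passing to the opposite algebra exchanges the roles of \<open>A e\<close> and \<open>e A\<close>.  The dual basis is now that of
  \<open>e A\<close>, which is the corner itself, and is trivial; the injectivity is now that of \<open>A e\<close>,
  which is a direct summand of a free module over the corner by means of \<open>a\<close> and \<open>L\<close>.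
\<close>

lemma corner_data_op: "corner_data Aop e {()} (\<lambda>_. e) (\<lambda>_ b. b)"
proof -
  interpret A: ring A by (rule alg_ring)
  interpret Aop: ring Aop by (rule op.alg_ring)
  show ?thesis
  proof
    show "\<one>\<^bsub>Aop\<^esub> \<noteq> \<zero>\<^bsub>Aop\<^esub>" by (rule op.alg_one_neq_zero)
    show "e \<in> carrier Aop" using op.e_closed by simp
    show "e \<otimes>\<^bsub>Aop\<^esub> e = e" using op.e_idem by simp
    have ideal: "e \<otimes>\<^bsub>Aop\<^esub> b = b" if "b \<in> carrier Aop" "b \<otimes>\<^bsub>Aop\<^esub> e = b" for b
    proof -
      have "b \<in> carrier A" "e \<otimes>\<^bsub>A\<^esub> b = b" using that by (auto simp: Aop_simps Aop_mult)
      then show ?thesis unfolding Aop_mult e_right e_left fun_eq_iff alg_carrier using to_z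
        by (metis (no_types, lifting))
    qed
    show "b \<in> corner Aop e" if "b \<in> carrier Aop" "b \<otimes>\<^bsub>Aop\<^esub> e = b" for b
      using that ideal by (simp add: corner_def)
    show "(\<Oplus>\<^bsub>Aop\<^esub>x\<in>{()}. e \<otimes>\<^bsub>Aop\<^esub> b) = b" if "b \<in> carrier Aop" "b \<otimes>\<^bsub>Aop\<^esub> e = b" for b
      using that ideal[OF that] by simp
    show "\<exists>ws. set ws \<subseteq> Z \<and> (\<forall>w\<in>Z. \<exists>b. (\<forall>j. b j \<in> corner Aop e) \<and>
          (\<forall>i. w i = (\<Oplus>\<^bsub>Aop\<^esub>j\<in>{..<length ws}. b j \<otimes>\<^bsub>Aop\<^esub> (ws ! j) i)))"
      if "corner_submodule Aop e n Z" for n Z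
      using op.group_algebra_noetherian[of n Z] that by simp
    show "\<exists>c. (\<forall>i. c i \<in> carrier Aop) \<and> (\<forall>w\<in>Z. f w = (\<Oplus>\<^bsub>Aop\<^esub>i\<in>{..<n}. w i \<otimes>\<^bsub>Aop\<^esub> c i))"
      if Z: "corner_submodule Aop e n Z" and fc: "\<forall>w\<in>Z. f w \<in> carrier Aop \<and> e \<otimes>\<^bsub>Aop\<^esub> f w = f w"
        and fa: "\<forall>v\<in>Z. \<forall>w\<in>Z. f (\<lambda>i. v i \<oplus>\<^bsub>Aop\<^esub> w i) = f v \<oplus>\<^bsub>Aop\<^esub> f w"
        and fs: "\<forall>b\<in>corner Aop e. \<forall>w\<in>Z. f (\<lambda>i. b \<otimes>\<^bsub>Aop\<^esub> w i) = b \<otimes>\<^bsub>Aop\<^esub> f w" for n Z f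
    proof -
      have fw: "f w \<in> carrier A" "f w \<otimes>\<^bsub>A\<^esub> e = f w" if "w \<in> Z" for w
        using fc that by (auto simp: Aop_simps Aop_mult)
      have wc: "w i \<in> corner A e" if "w \<in> Z" for w i
        using Z that by (simp add: corner_submodule_def Aop_corner)
      have "\<exists>c. (\<forall>i. c i \<in> corner Aop e) \<and> (\<forall>w\<in>Z. L x (f w) = (\<Oplus>\<^bsub>Aop\<^esub>i\<in>{..<n}. w i \<otimes>\<^bsub>Aop\<^esub> c i))"
        if x: "x \<in> Obj C" for x
      proof (rule op.group_algebra_injective[unfolded op_cat_simps])
        show "corner_submodule Aop e n Z" by (rule Z)
        show "L x (f w) \<in> corner Aop e" for w unfolding Aop_corner by (rule L_corner)
        show "L x (f (\<lambda>i. v i \<oplus>\<^bsub>Aop\<^esub> w i)) = L x (f v) \<oplus>\<^bsub>Aop\<^esub> L x (f w)" if "v \<in> Z" "w \<in> Z" for v w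
        proof -
          have "f (\<lambda>i. v i \<oplus>\<^bsub>Aop\<^esub> w i) = f v \<oplus>\<^bsub>Aop\<^esub> f w" using fa that by blast
          then show ?thesis by (auto simp: L_def op.alg_add add_divide_distrib fun_eq_iff)
        qed
        show "L x (f (\<lambda>i. b \<otimes>\<^bsub>Aop\<^esub> w i)) = b \<otimes>\<^bsub>Aop\<^esub> L x (f w)" if b: "b \<in> corner Aop e" and w: "w \<in> Z" for b w
        proof -
          have "f (\<lambda>i. b \<otimes>\<^bsub>Aop\<^esub> w i) = b \<otimes>\<^bsub>Aop\<^esub> f w" using fs b w by blast
          then show ?thesis using b unfolding Aop_corner by (simp add: Aop_mult L_mult[OF x])
        qed
      qed
      then have "\<forall>x\<in>Obj C. \<exists>c. (\<forall>i. c i \<in> corner A e) \<and>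
          (\<forall>w\<in>Z. L x (f w) = (\<Oplus>\<^bsub>A\<^esub>i\<in>{..<n}. c i \<otimes>\<^bsub>A\<^esub> w i))"
        unfolding Aop_corner Aop_mult Aop_finsum ..
      from bchoice[OF this] obtain c where c': "\<forall>x\<in>Obj C. (\<forall>i. c x i \<in> corner A e) \<and>
          (\<forall>w\<in>Z. L x (f w) = (\<Oplus>\<^bsub>A\<^esub>i\<in>{..<n}. c x i \<otimes>\<^bsub>A\<^esub> w i))" ..
      have c: "\<And>x i. x \<in> Obj C \<Longrightarrow> c x i \<in> corner A e"
        "\<And>x w. x \<in> Obj C \<Longrightarrow> w \<in> Z \<Longrightarrow> L x (f w) = (\<Oplus>\<^bsub>A\<^esub>i\<in>{..<n}. c x i \<otimes>\<^bsub>A\<^esub> w i)"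
        using bspec[OF c'] by simp_all
      have cc: "c x i \<in> carrier A" if "x \<in> Obj C" for x i using c(1)[OF that] by (simp add: corner_def)
      have ac: "basis_vector (a x) \<in> carrier A" if "x \<in> Obj C" for x using a_arr[OF that] by (simp add: basis_closed)
      define c' where "c' i = (\<Oplus>\<^bsub>A\<^esub>x\<in>Obj C. basis_vector (a x) \<otimes>\<^bsub>A\<^esub> c x i)" for i
      have "c' i \<in> carrier A" for i unfolding c'_def using cc ac by (intro A.finsum_closed) auto
      moreover have "f w = (\<Oplus>\<^bsub>A\<^esub>i\<in>{..<n}. c' i \<otimes>\<^bsub>A\<^esub> w i)" if w: "w \<in> Z" for w
      proof -
        have wcc: "w i \<in> carrier A" for i using wc[OF w, of i] by (simp add: corner_def)
        have "f w = (\<Oplus>\<^bsub>A\<^esub>x\<in>Obj C. basis_vector (a x) \<otimes>\<^bsub>A\<^esub> L x (f w))"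
          using L_expand[OF fw[OF w]] by simp
        also have "\<dots> = (\<Oplus>\<^bsub>A\<^esub>x\<in>Obj C. \<Oplus>\<^bsub>A\<^esub>i\<in>{..<n}. basis_vector (a x) \<otimes>\<^bsub>A\<^esub> (c x i \<otimes>\<^bsub>A\<^esub> w i))"
        proof (rule A.finsum_cong'[OF refl])
          fix x assume x: "x \<in> Obj C"
          show "basis_vector (a x) \<otimes>\<^bsub>A\<^esub> L x (f w) = (\<Oplus>\<^bsub>A\<^esub>i\<in>{..<n}. basis_vector (a x) \<otimes>\<^bsub>A\<^esub> (c x i \<otimes>\<^bsub>A\<^esub> w i))"
            unfolding c(2)[OF x w] using ac[OF x] cc[OF x] wcc by (intro A.finsum_rdistr) auto
        qed (use ac cc wcc in \<open>auto intro!: A.finsum_closed\<close>)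
        also have "\<dots> = (\<Oplus>\<^bsub>A\<^esub>i\<in>{..<n}. \<Oplus>\<^bsub>A\<^esub>x\<in>Obj C. basis_vector (a x) \<otimes>\<^bsub>A\<^esub> (c x i \<otimes>\<^bsub>A\<^esub> w i))"
          using ac cc wcc by (intro A.finsum_swap) (auto simp: fin_Obj)
        also have "\<dots> = (\<Oplus>\<^bsub>A\<^esub>i\<in>{..<n}. c' i \<otimes>\<^bsub>A\<^esub> w i)"
        proof (rule A.finsum_cong'[OF refl])
          fix i
          have "(\<Oplus>\<^bsub>A\<^esub>x\<in>Obj C. basis_vector (a x) \<otimes>\<^bsub>A\<^esub> (c x i \<otimes>\<^bsub>A\<^esub> w i))
             = (\<Oplus>\<^bsub>A\<^esub>x\<in>Obj C. basis_vector (a x) \<otimes>\<^bsub>A\<^esub> c x i \<otimes>\<^bsub>A\<^esub> w i)"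
            using ac cc wcc by (intro A.finsum_cong') (auto simp: A.m_assoc)
          also have "\<dots> = c' i \<otimes>\<^bsub>A\<^esub> w i"
            unfolding c'_def using ac cc wcc by (intro A.finsum_ldistr[symmetric]) (auto simp: fin_Obj)
          finally show "(\<Oplus>\<^bsub>A\<^esub>x\<in>Obj C. basis_vector (a x) \<otimes>\<^bsub>A\<^esub> (c x i \<otimes>\<^bsub>A\<^esub> w i)) = c' i \<otimes>\<^bsub>A\<^esub> w i" .
        qed (use calculation(1) wcc \<open>\<And>i. c' i \<in> carrier A\<close> in auto)
        finally show ?thesis .
      qed
      ultimately show ?thesis by (intro exI[of _ c']) (simp add: Aop_finsum Aop_mult Aop_simps)
    qed
  qed (simp_all add: op.e_closed[unfolded op_cat_simps])
qed

end

section \<open>The trivial module\<close>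

context fin_category
begin

abbreviation triv :: "('m \<Rightarrow> 'k::field, 'o \<Rightarrow> 'k) module" where "triv \<equiv> trivial_module C"

lemma triv_carrier: "carrier (triv :: ('m \<Rightarrow> 'k::field, 'o \<Rightarrow> 'k) module) = {v. \<forall>x. x \<notin> Obj C \<longrightarrow> v x = 0}"
  and triv_zero: "\<zero>\<^bsub>triv\<^esub> = (\<lambda>x. 0)"
  and triv_add: "v \<oplus>\<^bsub>triv\<^esub> w = (\<lambda>x. v x + w x)"
  by (simp_all add: trivial_module_def linear_span_def)

lemma triv_smult: "(b \<odot>\<^bsub>triv\<^esub> v) y = (\<Sum>f\<in>Arr C. b f * (if Cod C f = y then v (Dom C f) else 0))"
proof -
  have "(b \<odot>\<^bsub>triv\<^esub> v) y = (\<Sum>f\<in>{f \<in> Arr C. Cod C f = y}. b f * v (Dom C f))"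
    by (simp add: trivial_module_def)
  also have "\<dots> = (\<Sum>f\<in>Arr C. if Cod C f = y then b f * v (Dom C f) else 0)"
    by (rule sum.inter_filter[OF fin])
  also have "\<dots> = (\<Sum>f\<in>Arr C. b f * (if Cod C f = y then v (Dom C f) else 0))"
    by (intro sum.cong refl) simp
  finally show ?thesis .
qed

lemma triv_smult_closed: "b \<odot>\<^bsub>triv\<^esub> v \<in> carrier (triv :: ('m \<Rightarrow> 'k::field, 'o \<Rightarrow> 'k) module)"
  using cod_obj by (auto simp: triv_carrier triv_smult intro!: sum.neutral)

lemma basis_triv:
  assumes "f \<in> Arr C"
  shows "basis_vector f \<odot>\<^bsub>triv\<^esub> v = (\<lambda>y. if y = Cod C f then v (Dom C f) else (0 :: 'k::field))"
proof
  fix y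
  have "(basis_vector f \<odot>\<^bsub>triv\<^esub> v) y = (\<Sum>g\<in>Arr C. if g = f then (if y = Cod C f then v (Dom C f) else (0 :: 'k)) else 0)"
    unfolding triv_smult by (intro sum.cong refl) (auto simp: basis_vector_def)
  then show "(basis_vector f \<odot>\<^bsub>triv\<^esub> v) y = (if y = Cod C f then v (Dom C f) else (0 :: 'k))"
    using assms by (simp add: fin)
qed

lemma triv_scale: "(\<lambda>h. r * b h) \<odot>\<^bsub>triv\<^esub> v = (\<lambda>y. r * (b \<odot>\<^bsub>triv\<^esub> v) y)"
  unfolding triv_smult fun_eq_iff by (simp add: sum_distrib_left mult.assoc)

lemma triv_left_module: "left_module (alg :: ('k::field, 'm \<Rightarrow> 'k) module) triv"
proof (intro left_module.intro left_module_axioms.intro alg_ring)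
  show "abelian_group (triv :: ('m \<Rightarrow> 'k, 'o \<Rightarrow> 'k) module)"
  proof (rule abelian_groupI)
    fix v :: "'o \<Rightarrow> 'k" assume "v \<in> carrier triv"
    then show "\<exists>w\<in>carrier triv. w \<oplus>\<^bsub>triv\<^esub> v = \<zero>\<^bsub>triv\<^esub>"
      by (intro bexI[of _ "\<lambda>x. - v x"]) (auto simp: triv_carrier triv_add triv_zero)
  qed (auto simp: triv_carrier triv_add triv_zero algebra_simps)
  fix b c :: "'m \<Rightarrow> 'k" and v w :: "'o \<Rightarrow> 'k"
  show "b \<odot>\<^bsub>triv\<^esub> v \<in> carrier triv" by (rule triv_smult_closed)
  show "(b \<oplus>\<^bsub>alg\<^esub> c) \<odot>\<^bsub>triv\<^esub> v = b \<odot>\<^bsub>triv\<^esub> v \<oplus>\<^bsub>triv\<^esub> c \<odot>\<^bsub>triv\<^esub> v"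
    by (auto simp: fun_eq_iff triv_add triv_smult alg_add sum.distrib[symmetric] algebra_simps)
  show "b \<odot>\<^bsub>triv\<^esub> (v \<oplus>\<^bsub>triv\<^esub> w) = b \<odot>\<^bsub>triv\<^esub> v \<oplus>\<^bsub>triv\<^esub> b \<odot>\<^bsub>triv\<^esub> w"
    by (auto simp: fun_eq_iff triv_add triv_smult sum.distrib[symmetric] algebra_simps intro!: sum.cong)
  show "(b \<otimes>\<^bsub>alg\<^esub> c) \<odot>\<^bsub>triv\<^esub> v = b \<odot>\<^bsub>triv\<^esub> (c \<odot>\<^bsub>triv\<^esub> v)"
  proof
    fix y
    have "((b \<otimes>\<^bsub>alg\<^esub> c) \<odot>\<^bsub>triv\<^esub> v) y = (\<Sum>f\<in>Arr C. \<Sum>g\<in>Arr C.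
       if Dom C f = Cod C g then b f * c g * (if Cod C (f \<cdot> g) = y then v (Dom C (f \<cdot> g)) else 0) else 0)"
      unfolding triv_smult by (rule alg_mult_pairing)
    also have "\<dots> = (\<Sum>f\<in>Arr C. \<Sum>g\<in>Arr C.
       b f * (if Cod C f = y then c g * (if Cod C g = Dom C f then v (Dom C g) else 0) else 0))"
      using Comp_arr by (intro sum.cong refl) auto
    also have "\<dots> = (b \<odot>\<^bsub>triv\<^esub> (c \<odot>\<^bsub>triv\<^esub> v)) y"
      unfolding triv_smult by (intro sum.cong refl) (auto simp: sum_distrib_left)
    finally show "((b \<otimes>\<^bsub>alg\<^esub> c) \<odot>\<^bsub>triv\<^esub> v) y = (b \<odot>\<^bsub>triv\<^esub> (c \<odot>\<^bsub>triv\<^esub> v)) y" .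
  qed
  assume v: "v \<in> carrier triv"
  show "\<one>\<^bsub>alg\<^esub> \<odot>\<^bsub>triv\<^esub> v = v"
  proof
    fix y
    have "(\<one>\<^bsub>alg\<^esub> \<odot>\<^bsub>triv\<^esub> v) y = (\<Sum>f\<in>Arr C. if f = Ident C y then v y else 0)"
      unfolding triv_smult alg_one
    proof (intro sum.cong refl)
      fix f assume f: "f \<in> Arr C"
      show "(if f \<in> Ident C ` Obj C then 1 else 0) * (if Cod C f = y then v (Dom C f) else 0) = (if f = Ident C y then v y else 0)"
      proof (cases "y \<in> Obj C")
        case True
        then show ?thesis using Ident_arr by (auto simp: image_iff)
      next
        case False
        then show ?thesis using v f cod_obj by (auto simp: triv_carrier)
      qed
    qed
    also have "\<dots> = v y" using v Ident_arr by (auto simp: fin triv_carrier)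
    finally show "(\<one>\<^bsub>alg\<^esub> \<odot>\<^bsub>triv\<^esub> v) y = v y" .
  qed
qed

lemma triv_finite_dimensional:
  "finite_dimensional_module (alg :: ('k::field, 'm \<Rightarrow> 'k) module) triv"
  unfolding finite_dimensional_module_def
proof (intro conjI triv_left_module exI ballI)
  interpret T: left_module "alg :: ('k, 'm \<Rightarrow> 'k) module" triv by (rule triv_left_module)
  let ?S = "(basis_vector :: 'o \<Rightarrow> 'o \<Rightarrow> 'k) ` Obj C"
  have inj: "inj (basis_vector :: 'o \<Rightarrow> 'o \<Rightarrow> 'k)"
    by (auto simp: inj_def basis_vector_def fun_eq_iff split: if_splits)
  show "finite ?S" using fin_Obj by simp
  show S: "?S \<subseteq> carrier triv" by (auto simp: triv_carrier basis_vector_def)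
  fix v :: "'o \<Rightarrow> 'k" assume v: "v \<in> carrier triv"
  let ?c = "\<lambda>s. v (the_inv (basis_vector :: 'o \<Rightarrow> 'o \<Rightarrow> 'k) s)"
  show "v = (\<Oplus>\<^bsub>triv\<^esub>s\<in>?S. (?c s \<odot>\<^bsub>alg\<^esub> \<one>\<^bsub>alg\<^esub>) \<odot>\<^bsub>triv\<^esub> s)"
  proof
    fix y
    have "(\<Oplus>\<^bsub>triv\<^esub>s\<in>?S. (?c s \<odot>\<^bsub>alg\<^esub> \<one>\<^bsub>alg\<^esub>) \<odot>\<^bsub>triv\<^esub> s) y
       = (\<Sum>s\<in>?S. ((?c s \<odot>\<^bsub>alg\<^esub> \<one>\<^bsub>alg\<^esub>) \<odot>\<^bsub>triv\<^esub> s) y)"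
      by (rule finsum_fun_apply[OF T.M.abelian_monoid_axioms]) (auto simp: triv_zero triv_add triv_smult_closed)
    also have "\<dots> = (\<Sum>s\<in>?S. ?c s * s y)"
    proof (intro sum.cong refl)
      fix s assume "s \<in> ?S"
      then have "s \<in> carrier triv" using S by blast
      then show "((?c s \<odot>\<^bsub>alg\<^esub> \<one>\<^bsub>alg\<^esub>) \<odot>\<^bsub>triv\<^esub> s) y = ?c s * s y"
        by (simp add: alg_smult triv_scale T.smult_one)
    qed
    also have "\<dots> = (\<Sum>x\<in>Obj C. if x = y then v y else 0)"
    proof -
      have "(\<Sum>s\<in>?S. ?c s * s y) = (\<Sum>x\<in>Obj C. v x * basis_vector x y)"
        by (simp add: sum.reindex[OF inj_on_subset[OF inj subset_UNIV]] the_inv_f_f[OF inj])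
      also have "\<dots> = (\<Sum>x\<in>Obj C. if x = y then v y else 0)"
        by (intro sum.cong refl) (auto simp: basis_vector_def)
      finally show ?thesis .
    qed
    also have "\<dots> = v y" using v by (simp add: fin_Obj triv_carrier)
    finally show "v y = (\<Oplus>\<^bsub>triv\<^esub>s\<in>?S. (?c s \<odot>\<^bsub>alg\<^esub> \<one>\<^bsub>alg\<^esub>) \<odot>\<^bsub>triv\<^esub> s) y" by simp
  qed
qed

end

section \<open>Dual modules\<close>

lemma op_ring_simps [simp]:
  "carrier (op_ring R) = carrier R" "add (op_ring R) = add R" "zero (op_ring R) = zero R"
  "one (op_ring R) = one R" "mult (op_ring R) b c = c \<otimes>\<^bsub>R\<^esub> b"
  by (simp_all add: op_ring_def)

lemma ring_op: "ring R \<Longrightarrow> ring (op_ring R)"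
proof -
  assume "ring R"
  then interpret ring R .
  have "abelian_group (op_ring R)"
    by (rule abelian_groupI) (auto simp: a_ac intro: l_neg)
  then show ?thesis
    by (rule ringI) (auto simp: l_distr r_distr m_assoc intro!: Group.monoidI)
qed

lemma regular_module_simps [simp]:
  "carrier (regular_module R) = carrier R" "add (regular_module R) = add R" "zero (regular_module R) = zero R"
  "smult (regular_module R) = mult R"
  by (simp_all add: regular_module_def)

lemma dual_simps:
  "carrier (dual R M) = mod_hom R M (regular_module R)"
  "f \<oplus>\<^bsub>dual R M\<^esub> g = (\<lambda>x\<in>carrier M. f x \<oplus>\<^bsub>R\<^esub> g x)"
  "\<zero>\<^bsub>dual R M\<^esub> = (\<lambda>x\<in>carrier M. \<zero>\<^bsub>R\<^esub>)"
  "b \<odot>\<^bsub>dual R M\<^esub> f = (\<lambda>x\<in>carrier M. f x \<otimes>\<^bsub>R\<^esub> b)"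
  by (simp_all add: dual_def)

lemma mod_hom_restrict: "f \<in> mod_hom R M N \<Longrightarrow> restrict f (carrier M) = f"
  by (auto simp: mod_hom_def PiE_def extensional_restrict)

lemma left_module_dual:
  assumes M: "left_module R M" shows "left_module (op_ring R) (dual R M)"
proof -
  interpret M: left_module R M by fact
  have reg: "left_module R (regular_module R)" by (rule left_module_regular[OF M.ring_axioms])
  interpret op: ring "op_ring R" by (rule ring_op[OF M.ring_axioms])
  have cl: "f x \<in> carrier R" if "f \<in> mod_hom R M (regular_module R)" "x \<in> carrier M" for f x
    using mod_hom_closed[OF that] by simp
  have add: "f \<oplus>\<^bsub>dual R M\<^esub> g \<in> mod_hom R M (regular_module R)"
    if "f \<in> mod_hom R M (regular_module R)" "g \<in> mod_hom R M (regular_module R)" for f g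
    using mod_hom_pointwise_add[OF M reg that] by (simp add: dual_simps)
  have zero: "\<zero>\<^bsub>dual R M\<^esub> \<in> mod_hom R M (regular_module R)"
    unfolding dual_simps by (rule mod_hom_restrictI[OF M]) auto
  have smult: "b \<odot>\<^bsub>dual R M\<^esub> f \<in> mod_hom R M (regular_module R)"
    if "b \<in> carrier R" and f: "f \<in> mod_hom R M (regular_module R)" for b f
    unfolding dual_simps
    by (rule mod_hom_restrictI[OF M])
      (use that(1) cl[OF f] in \<open>simp_all add: mod_hom_add[OF f] mod_hom_smult[OF f] M.l_distr M.m_assoc\<close>)
  have grp: "abelian_group (dual R M)"
  proof (rule abelian_groupI)
    fix f assume "f \<in> carrier (dual R M)"
    then have f: "f \<in> mod_hom R M (regular_module R)" by (simp add: dual_simps(1))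
    define g where "g = (\<lambda>x\<in>carrier M. \<ominus>\<^bsub>R\<^esub> f x)"
    have g: "g \<in> mod_hom R M (regular_module R)" unfolding g_def
      by (rule mod_hom_restrictI[OF M])
        (use cl[OF f] in \<open>simp_all add: mod_hom_add[OF f] mod_hom_smult[OF f] M.R.minus_add M.R.r_minus\<close>)
    have "g \<oplus>\<^bsub>dual R M\<^esub> f = \<zero>\<^bsub>dual R M\<^esub>"
      using cl[OF f] by (auto simp: g_def dual_simps M.R.l_neg intro!: restrict_ext)
    with g show "\<exists>g\<in>carrier (dual R M). g \<oplus>\<^bsub>dual R M\<^esub> f = \<zero>\<^bsub>dual R M\<^esub>"
      by (intro bexI[of _ g]) (simp_all add: dual_simps(1))
    show "\<zero>\<^bsub>dual R M\<^esub> \<oplus>\<^bsub>dual R M\<^esub> f = f"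
      by (rule mod_hom_eqI[OF add[OF zero f] f]) (simp add: dual_simps cl[OF f])
  next
    fix f g h assume "f \<in> carrier (dual R M)" "g \<in> carrier (dual R M)" "h \<in> carrier (dual R M)"
    then have "f \<in> mod_hom R M (regular_module R)" "g \<in> mod_hom R M (regular_module R)"
      "h \<in> mod_hom R M (regular_module R)" by (simp_all add: dual_simps(1))
    note c = this[THEN cl]
    show "f \<oplus>\<^bsub>dual R M\<^esub> g \<oplus>\<^bsub>dual R M\<^esub> h = f \<oplus>\<^bsub>dual R M\<^esub> (g \<oplus>\<^bsub>dual R M\<^esub> h)"
      unfolding dual_simps(2) by (intro restrict_ext) (simp add: c M.R.a_assoc)
    show "f \<oplus>\<^bsub>dual R M\<^esub> g = g \<oplus>\<^bsub>dual R M\<^esub> f"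
      unfolding dual_simps(2) by (intro restrict_ext) (simp add: c M.R.a_comm)
  qed (simp_all add: dual_simps(1) add zero)
  show ?thesis
  proof (intro left_module.intro left_module_axioms.intro op.ring_axioms grp)
    fix b c f g assume b: "b \<in> carrier (op_ring R)" and f: "f \<in> carrier (dual R M)"
    then have fm: "f \<in> mod_hom R M (regular_module R)" and bR: "b \<in> carrier R" by (simp_all add: dual_simps(1))
    show "b \<odot>\<^bsub>dual R M\<^esub> f \<in> carrier (dual R M)" using smult[OF bR fm] by (simp add: dual_simps(1))
    show "b \<odot>\<^bsub>dual R M\<^esub> (f \<oplus>\<^bsub>dual R M\<^esub> g) = b \<odot>\<^bsub>dual R M\<^esub> f \<oplus>\<^bsub>dual R M\<^esub> b \<odot>\<^bsub>dual R M\<^esub> g"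
      if "g \<in> carrier (dual R M)"
    proof -
      have g: "g \<in> mod_hom R M (regular_module R)" using that by (simp add: dual_simps(1))
      show ?thesis unfolding dual_simps
        by (intro restrict_ext) (simp add: cl[OF fm] cl[OF g] bR M.R.l_distr)
    qed
    assume c: "c \<in> carrier (op_ring R)"
    then have cR: "c \<in> carrier R" by simp
    show "(b \<oplus>\<^bsub>op_ring R\<^esub> c) \<odot>\<^bsub>dual R M\<^esub> f = b \<odot>\<^bsub>dual R M\<^esub> f \<oplus>\<^bsub>dual R M\<^esub> c \<odot>\<^bsub>dual R M\<^esub> f"
      unfolding dual_simps by (intro restrict_ext) (simp add: cl[OF fm] bR cR M.R.r_distr)
    show "(b \<otimes>\<^bsub>op_ring R\<^esub> c) \<odot>\<^bsub>dual R M\<^esub> f = b \<odot>\<^bsub>dual R M\<^esub> (c \<odot>\<^bsub>dual R M\<^esub> f)"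
      unfolding dual_simps by (intro restrict_ext) (simp add: cl[OF fm] bR cR M.R.m_assoc)
  next
    fix f assume "f \<in> carrier (dual R M)"
    then have f: "f \<in> mod_hom R M (regular_module R)" by (simp add: dual_simps(1))
    have "(\<lambda>x\<in>carrier M. f x \<otimes>\<^bsub>R\<^esub> \<one>\<^bsub>R\<^esub>) = restrict f (carrier M)"
      by (intro restrict_ext) (simp add: cl[OF f])
    then show "\<one>\<^bsub>op_ring R\<^esub> \<odot>\<^bsub>dual R M\<^esub> f = f"
      by (simp add: dual_simps(4) mod_hom_restrict[OF f])
  qed
qed

section \<open>The trivial module in the presence of a transitive smallest object\<close>

context transitive_category
begin

abbreviation T :: "('m \<Rightarrow> 'k, 'o \<Rightarrow> 'k) module" where "T \<equiv> triv"

definition \<delta> :: "'o \<Rightarrow> 'k" where "\<delta> = basis_vector z"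

lemma delta_closed: "\<delta> \<in> carrier T"
  using z by (auto simp: \<delta>_def triv_carrier basis_vector_def)

lemma smult_delta: "(b \<odot>\<^bsub>T\<^esub> \<delta>) y = (\<Sum>f\<in>Hom C z y. b f)"
proof -
  have "(b \<odot>\<^bsub>T\<^esub> \<delta>) y = (\<Sum>f\<in>Arr C. if f \<in> Hom C z y then b f else 0)"
    unfolding triv_smult by (intro sum.cong refl) (auto simp: \<delta>_def basis_vector_def Hom_iff)
  also have "\<dots> = (\<Sum>f\<in>Hom C z y. b f)"
  proof -
    have "Hom C z y \<subseteq> Arr C" by (auto simp: Hom_iff)
    then show ?thesis by (simp add: sum.If_cases fin Int_absorb1)
  qed
  finally show ?thesis .
qed

text \<open>
  An element of \<open>A e\<close> that carries \<open>\<delta>\<close> to \<open>v\<close>, which shows that \<open>\<delta>\<close> generates the trivial module.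
\<close>

definition section_at :: "('o \<Rightarrow> 'k) \<Rightarrow> 'm \<Rightarrow> 'k" where
  "section_at v = (\<lambda>f. if f \<in> a ` Obj C then v (Cod C f) else 0)"

lemma section_at:
  assumes "v \<in> carrier T"
  shows "section_at v \<in> carrier A" "section_at v \<otimes>\<^bsub>A\<^esub> e = section_at v" "section_at v \<odot>\<^bsub>T\<^esub> \<delta> = v"
proof -
  show "section_at v \<in> carrier A" using a_arr by (auto simp: alg_carrier section_at_def)
  show "section_at v \<otimes>\<^bsub>A\<^esub> e = section_at v"
    unfolding e_right using a_arr by (auto simp: section_at_def fun_eq_iff)
  show "section_at v \<odot>\<^bsub>T\<^esub> \<delta> = v"
  proof
    fix y
    show "(section_at v \<odot>\<^bsub>T\<^esub> \<delta>) y = v y"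
    proof (cases "y \<in> Obj C")
      case True
      have "(section_at v \<odot>\<^bsub>T\<^esub> \<delta>) y = (\<Sum>f\<in>Hom C z y. if f = a y then v y else 0)"
        unfolding smult_delta
      proof (intro sum.cong refl)
        fix f assume "f \<in> Hom C z y"
        then have c: "Cod C f = y" by (simp add: Hom_iff)
        have "f \<in> a ` Obj C \<longleftrightarrow> f = a y"
        proof
          assume "f \<in> a ` Obj C"
          then obtain x where "x \<in> Obj C" "f = a x" by blast
          then show "f = a y" using a_arr[of x] c by simp
        qed (use True in simp)
        then show "section_at v f = (if f = a y then v y else 0)"
          using c by (cases "f = a y") (auto simp: section_at_def)
      qed
      also have "\<dots> = v y" using a[OF True] G_finite by simp
      finally show ?thesis .
    next
      case False
      then have "Hom C z y = {}" using Hom_Obj by blast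
      then show ?thesis using False assms by (simp add: smult_delta triv_carrier)
    qed
  qed
qed

lemma e_delta: "e \<odot>\<^bsub>T\<^esub> \<delta> = \<delta>"
  using basis_triv[OF conjunct1[OF Ident_arr[OF z]], of \<delta>] Ident_arr[OF z] by (auto simp: \<delta>_def basis_vector_def fun_eq_iff)

lemma Ext_trivial_module:
  assumes "i \<ge> 1" shows "trivial_group (Ext A T (regular_module A) i)"
proof -
  interpret D: corner_data A e "Obj C" "\<lambda>x. basis_vector (a x)" L by (rule corner_data_alg)
  show ?thesis
  proof (rule D.Ext_regular_trivial[OF triv_left_module delta_closed e_delta _ _ assms])
    show "\<exists>b\<in>carrier A. v = b \<odot>\<^bsub>T\<^esub> \<delta>" if "v \<in> carrier T" for v
      using section_at[OF that] by metis
    show "L x b \<odot>\<^bsub>T\<^esub> \<delta> = \<zero>\<^bsub>T\<^esub>" if x: "x \<in> Obj C" and b: "b \<odot>\<^bsub>T\<^esub> \<delta> = \<zero>\<^bsub>T\<^esub>" for x b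
    proof
      fix y
      show "(L x b \<odot>\<^bsub>T\<^esub> \<delta>) y = \<zero>\<^bsub>T\<^esub> y"
      proof (cases "y = z")
        case True
        have "(L x b \<odot>\<^bsub>T\<^esub> \<delta>) y = (\<Sum>g\<in>Hom C z z. b (a x \<cdot> g)) / weight x"
          by (simp add: smult_delta True L_def sum_divide_distrib)
        also have "\<dots> = (b \<odot>\<^bsub>T\<^esub> \<delta>) x"
          using orbit_sum_base[OF x, of b] weight[OF x] by (simp add: smult_delta)
        finally show ?thesis using b by (simp add: triv_zero)
      next
        case False
        then show ?thesis by (auto simp: smult_delta triv_zero L_def Hom_iff intro!: sum.neutral)
      qed
    qed
  qed
qed

text \<open>
  The embedding of the trivial module into \<open>A e\<close> that sends \<open>\<delta>\<close> to the sum of the automorphisms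
  of \<open>z\<close>.  The weights enter because composition with \<open>a x\<close> maps this sum to the sum of the morphisms
  from \<open>z\<close> to \<open>x\<close>, each counted as often as the order of the stabilizer.
\<close>

definition embedding :: "('o \<Rightarrow> 'k) \<Rightarrow> 'm \<Rightarrow> 'k" where
  "embedding = (\<lambda>v\<in>carrier T. \<lambda>f. if f \<in> Arr C \<and> Dom C f = z then weight (Cod C f) * v (Cod C f) else 0)"

definition norm_element :: "'m \<Rightarrow> 'k" where
  "norm_element = (\<lambda>g. if g \<in> Hom C z z then 1 else 0)"

lemma norm_corner: "norm_element \<in> corner A e"
  by (simp add: corner_alg norm_element_def)

text \<open>
  This formula makes the embedding a homomorphism, and reduces its further properties to those
  of the sum of the automorphisms.
\<close>

lemma mult_norm: "b \<otimes>\<^bsub>A\<^esub> norm_element = embedding (b \<odot>\<^bsub>T\<^esub> \<delta>)"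
proof
  fix f
  have c: "b \<odot>\<^bsub>T\<^esub> \<delta> \<in> carrier T" by (rule triv_smult_closed)
  show "(b \<otimes>\<^bsub>A\<^esub> norm_element) f = embedding (b \<odot>\<^bsub>T\<^esub> \<delta>) f"
  proof (cases "f \<in> Arr C \<and> Dom C f = z")
    case True
    then have f: "f \<in> Hom C z (Cod C f)" by (simp add: Hom_iff)
    have "(b \<otimes>\<^bsub>A\<^esub> norm_element) f = (\<Sum>g\<in>Hom C z z. b (f \<cdot> ginv g) * norm_element g)"
      by (rule mult_corner_right[OF norm_corner f])
    also have "\<dots> = (\<Sum>g\<in>Hom C z z. b (f \<cdot> ginv g))"
      by (intro sum.cong refl) (simp add: norm_element_def)
    also have "\<dots> = (\<Sum>g\<in>Hom C z z. b (f \<cdot> g))"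
      by (rule sum.reindex_bij_betw[OF ginv_bij, of "\<lambda>g. b (f \<cdot> g)"])
    also have "\<dots> = weight (Cod C f) * (b \<odot>\<^bsub>T\<^esub> \<delta>) (Cod C f)"
      unfolding smult_delta by (rule orbit_sum[OF f])
    finally show ?thesis using True c by (simp add: embedding_def)
  next
    case False
    have "norm_element \<otimes>\<^bsub>A\<^esub> e = norm_element" using norm_corner by (simp add: corner_def)
    then have "(b \<otimes>\<^bsub>A\<^esub> norm_element) f = ((b \<otimes>\<^bsub>A\<^esub> norm_element) \<otimes>\<^bsub>A\<^esub> e) f" by (simp add: alg_mult_assoc)
    also have "\<dots> = 0" using False unfolding e_right by auto
    finally show ?thesis using False c by (auto simp: embedding_def)
  qed
qed

lemma embedding_hom: "embedding \<in> mod_hom A T (regular_module A)"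
proof -
  have "restrict embedding (carrier T) \<in> mod_hom A T (regular_module A)"
  proof (rule mod_hom_restrictI[OF triv_left_module])
    interpret T: left_module A T by (rule triv_left_module)
    fix v assume v: "v \<in> carrier T"
    show "embedding v \<in> carrier (regular_module A)" using v by (auto simp: embedding_def alg_carrier)
    show "embedding (v \<oplus>\<^bsub>T\<^esub> w) = embedding v \<oplus>\<^bsub>regular_module A\<^esub> embedding w" if "w \<in> carrier T" for w
      using v that T.M.a_closed[OF v that]
      by (auto simp: embedding_def alg_add triv_add fun_eq_iff algebra_simps)
    show "embedding (b \<odot>\<^bsub>T\<^esub> v) = b \<odot>\<^bsub>regular_module A\<^esub> embedding v" if b: "b \<in> carrier A" for b
    proof -
      note s = section_at[OF v]
      have "b \<odot>\<^bsub>T\<^esub> v = (b \<otimes>\<^bsub>A\<^esub> section_at v) \<odot>\<^bsub>T\<^esub> \<delta>"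
        using T.smult_assoc[OF b s(1) delta_closed] s(3) by simp
      then have "embedding (b \<odot>\<^bsub>T\<^esub> v) = b \<otimes>\<^bsub>A\<^esub> section_at v \<otimes>\<^bsub>A\<^esub> norm_element"
        by (simp only: mult_norm)
      also have "\<dots> = b \<otimes>\<^bsub>A\<^esub> embedding v" unfolding alg_mult_assoc by (simp add: mult_norm s(3))
      finally show ?thesis by simp
    qed
  qed
  then show ?thesis by (simp add: embedding_def)
qed

lemma embedding_right:
  assumes "v \<in> carrier T" "g \<in> Hom C z z"
  shows "embedding v \<otimes>\<^bsub>A\<^esub> basis_vector g = embedding v"
proof -
  have "norm_element \<otimes>\<^bsub>A\<^esub> basis_vector g = norm_element"
  proof
    fix h
    have bc: "(basis_vector g :: 'm \<Rightarrow> 'k) \<in> corner A e" by (rule corner_basis[OF assms(2)])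
    show "(norm_element \<otimes>\<^bsub>A\<^esub> basis_vector g) h = norm_element h"
    proof (cases "h \<in> Hom C z z")
      case h: True
      have "(norm_element \<otimes>\<^bsub>A\<^esub> basis_vector g) h = (\<Sum>k\<in>Hom C z z. norm_element (h \<cdot> ginv k) * basis_vector g k)"
        by (rule mult_corner_right[OF bc h])
      also have "\<dots> = (\<Sum>k\<in>Hom C z z. if k = g then 1 else 0)"
        using comp_G[OF h ginv(1)] by (intro sum.cong refl) (auto simp: norm_element_def basis_vector_def)
      finally show ?thesis using h assms(2) G_finite by (simp add: norm_element_def)
    next
      case False
      have "\<forall>f\<in>Arr C. (if Dom C f = Cod C g \<and> f \<cdot> g = h then norm_element f else (0 :: 'k)) = 0"
        using False comp_G[OF _ assms(2)] by (auto simp: norm_element_def)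
      then have "(norm_element \<otimes>\<^bsub>A\<^esub> basis_vector g) h = 0"
        using assms(2) by (subst basis_mult_right) (auto simp: Hom_iff intro: sum.neutral)
      then show ?thesis using False by (simp add: norm_element_def)
    qed
  qed
  moreover have "embedding v = section_at v \<otimes>\<^bsub>A\<^esub> norm_element"
    using section_at(3)[OF assms(1)] by (simp add: mult_norm)
  ultimately show ?thesis by (simp add: alg_mult_assoc)
qed

text \<open>
  A homomorphism \<open>f\<close> is determined by \<open>f \<delta>\<close>, which lies in \<open>e A = k G\<close> and is fixed by \<open>G\<close>; so it is a
  scalar multiple of the sum of the elements of \<open>G\<close>.
\<close>

lemma dual_spanned:
  assumes f: "f \<in> mod_hom A T (regular_module A)"
  shows "\<exists>b\<in>carrier A. f = b \<odot>\<^bsub>dual A T\<^esub> embedding"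
proof -
  let ?b = "f \<delta>"
  have bA: "?b \<in> carrier A" using mod_hom_closed[OF f delta_closed] by simp
  have "e \<otimes>\<^bsub>A\<^esub> ?b = ?b"
    using mod_hom_smult[OF f e_closed delta_closed] by (simp add: e_delta)
  then have "?b h = 0" if "h \<notin> Hom C z z" for h
    using that to_z[of h] fun_cong[OF \<open>e \<otimes>\<^bsub>A\<^esub> ?b = ?b\<close>, of h] unfolding e_left Hom_iff
    by (auto split: if_splits)
  then have bc: "?b \<in> corner A e" by (simp add: corner_alg)
  define r where "r = ?b (Ident C z)"
  have "?b g = r" if g: "g \<in> Hom C z z" for g
  proof -
    have gA: "basis_vector (ginv g) \<in> carrier A" using ginv(1)[OF g] by (simp add: basis_closed Hom_iff)
    have "basis_vector (ginv g) \<odot>\<^bsub>T\<^esub> \<delta> = \<delta>"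
      using ginv(1)[OF g] basis_triv[of "ginv g" \<delta>] by (auto simp: Hom_iff \<delta>_def basis_vector_def fun_eq_iff)
    then have "basis_vector (ginv g) \<otimes>\<^bsub>A\<^esub> ?b = ?b"
      using mod_hom_smult[OF f gA delta_closed] by simp
    then show ?thesis using basis_shift[OF g bc] by (simp add: r_def)
  qed
  then have b: "?b = (\<lambda>h. r * norm_element h)" using bc by (auto simp: norm_element_def corner_alg)
  let ?c = "\<lambda>h. r * e h"
  have c: "?c \<in> carrier A" using corner_scaled_e[of r] by (simp add: corner_def)
  have "f = ?c \<odot>\<^bsub>dual A T\<^esub> embedding"
  proof (rule mod_hom_eqI[OF f])
    interpret D: left_module "op_ring A" "dual A T" by (rule left_module_dual[OF triv_left_module])
    show "?c \<odot>\<^bsub>dual A T\<^esub> embedding \<in> mod_hom A T (regular_module A)"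
      using D.smult_closed[of ?c embedding] c embedding_hom by (simp add: dual_simps(1))
    fix v assume v: "v \<in> carrier T"
    note s = section_at[OF v]
    have "f v = section_at v \<otimes>\<^bsub>A\<^esub> ?b" using mod_hom_smult[OF f s(1) delta_closed] s(3) by simp
    also have "\<dots> = (\<lambda>h. r * (section_at v \<otimes>\<^bsub>A\<^esub> norm_element) h)"
      unfolding b by (rule alg_scale_right)
    also have "\<dots> = (\<lambda>h. r * embedding v h)" by (simp add: mult_norm s(3))
    also have "\<dots> = (\<lambda>h. r * (embedding v \<otimes>\<^bsub>A\<^esub> e) h)"
      using embedding_right[OF v ident_hom[OF z]] by simp
    also have "\<dots> = embedding v \<otimes>\<^bsub>A\<^esub> ?c" by (simp add: alg_scale_right)
    finally show "f v = (?c \<odot>\<^bsub>dual A T\<^esub> embedding) v" using v by (simp add: dual_simps)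
  qed
  then show ?thesis using c by blast
qed

lemma embedding_invariant:
  assumes "g \<in> Hom C z z" shows "basis_vector g \<odot>\<^bsub>dual A T\<^esub> embedding = embedding"
proof -
  have "(\<lambda>v\<in>carrier T. embedding v \<otimes>\<^bsub>A\<^esub> basis_vector g) = restrict embedding (carrier T)"
    using embedding_right[OF _ assms] by (intro restrict_ext) simp
  then show ?thesis by (simp add: dual_simps mod_hom_restrict[OF embedding_hom])
qed

lemma Ext_dual_trivial_module:
  assumes "i \<ge> 1"
  shows "trivial_group (Ext (op_ring A) (dual A T) (regular_module (op_ring A)) i)"
proof -
  interpret D: corner_data Aop e "{()}" "\<lambda>_. e" "\<lambda>_ b. b" by (rule corner_data_op)
  have "left_module (op_ring A) (dual A T)" by (rule left_module_dual[OF triv_left_module])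
  then have M: "left_module Aop (dual A T)" unfolding Aop_eq .
  show ?thesis unfolding Aop_eq
  proof (rule D.Ext_regular_trivial[OF M _ _ _ _ assms])
    show "embedding \<in> carrier (dual A T)" by (simp add: dual_simps(1) embedding_hom)
    show "e \<odot>\<^bsub>dual A T\<^esub> embedding = embedding" by (rule embedding_invariant[OF ident_hom[OF z]])
    show "\<exists>b\<in>carrier Aop. f = b \<odot>\<^bsub>dual A T\<^esub> embedding" if "f \<in> carrier (dual A T)" for f
      using dual_spanned that by (simp add: dual_simps(1) Aop_simps)
  qed
qed

text \<open>
  An element of the bidual is determined by its value \<open>u\<close> at the embedding.  As the embedding is fixed by
  \<open>G\<close>, so is \<open>u\<close>, which therefore is constant on every \<open>Hom(z, x)\<close>; such elements are exactly the values
  of the embedding.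
\<close>

lemma evaluation_bijective:
  "bij_betw (evaluation_map A T) (carrier T) (carrier (dual (op_ring A) (dual A T)))"
proof -
  interpret T: left_module A T by (rule triv_left_module)
  interpret D: left_module "op_ring A" "dual A T" by (rule left_module_dual[OF triv_left_module])
  have ev: "evaluation_map A T v f = f v" if "v \<in> carrier T" "f \<in> mod_hom A T (regular_module A)" for v f
    using that by (simp add: evaluation_map_def dual_simps(1))
  have hom: "evaluation_map A T v \<in> mod_hom (op_ring A) (dual A T) (regular_module (op_ring A))"
    if v: "v \<in> carrier T" for v
  proof -
    have "restrict (\<lambda>f. f v) (carrier (dual A T)) \<in> mod_hom (op_ring A) (dual A T) (regular_module (op_ring A))"
      by (rule mod_hom_restrictI[OF D.left_module_axioms])
        (use v in \<open>auto simp: dual_simps dest: mod_hom_closed\<close>)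
    then show ?thesis using v by (simp add: evaluation_map_def)
  qed
  have inj: "v = w" if v: "v \<in> carrier T" and w: "w \<in> carrier T" and eq: "evaluation_map A T v = evaluation_map A T w" for v w
  proof
    fix x
    have "embedding v = embedding w" using ev[OF v embedding_hom] ev[OF w embedding_hom] eq by simp
    then have "embedding v (a x) = embedding w (a x)" by simp
    then show "v x = w x" using v w weight[of x] a_arr[of x]
      by (cases "x \<in> Obj C") (auto simp: embedding_def triv_carrier)
  qed
  have surj: "\<exists>v\<in>carrier T. \<xi> = evaluation_map A T v"
    if \<xi>: "\<xi> \<in> mod_hom (op_ring A) (dual A T) (regular_module (op_ring A))" for \<xi>
  proof -
    let ?u = "\<xi> embedding"
    have emb: "embedding \<in> carrier (dual A T)" by (simp add: dual_simps(1) embedding_hom)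
    have uA: "?u \<in> carrier A" using mod_hom_closed[OF \<xi> emb] by simp
    have ug: "?u \<otimes>\<^bsub>A\<^esub> basis_vector g = ?u" if g: "g \<in> Hom C z z" for g
    proof -
      have "basis_vector g \<in> carrier A" using g by (simp add: basis_closed Hom_iff)
      then show ?thesis using mod_hom_smult[OF \<xi> _ emb, of "basis_vector g"] embedding_invariant[OF g] by simp
    qed
    have u0: "?u f = 0" if "\<not> (f \<in> Arr C \<and> Dom C f = z)" for f
      using that fun_cong[OF ug[OF ident_hom[OF z]], of f] unfolding e_right by (auto split: if_splits)
    have uf: "?u f = ?u (a x)" if f: "f \<in> Hom C z x" for f x
    proof -
      obtain g where g: "g \<in> Hom C z z" "f = a x \<cdot> g" using orbit[OF f] by blast
      have "?u f = (?u \<otimes>\<^bsub>A\<^esub> basis_vector g) f" using ug[OF g(1)] by simp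
      also have "\<dots> = (\<Sum>h\<in>Hom C z z. ?u (f \<cdot> ginv h) * basis_vector g h)"
        by (rule mult_corner_right[OF corner_basis[OF g(1)] f])
      also have "\<dots> = (\<Sum>h\<in>Hom C z z. if h = g then ?u (f \<cdot> ginv g) else 0)"
        by (intro sum.cong refl) (auto simp: basis_vector_def)
      also have "\<dots> = ?u (a x)"
        using g G_finite ginv_cancel(1)[OF g(1) a[OF Hom_Obj[OF f]]] by simp
      finally show ?thesis .
    qed
    define v where "v x = (if x \<in> Obj C then ?u (a x) / weight x else 0)" for x
    have v: "v \<in> carrier T" by (simp add: triv_carrier v_def)
    have "embedding v = ?u"
    proof
      fix f show "embedding v f = ?u f"
      proof (cases "f \<in> Arr C \<and> Dom C f = z")
        case True
        then have f: "f \<in> Hom C z (Cod C f)" by (simp add: Hom_iff)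
        then show ?thesis using True v weight[OF Hom_Obj[OF f]] Hom_Obj[OF f] uf[OF f] by (simp add: embedding_def v_def)
      next
        case False
        then show ?thesis using u0 v by (auto simp: embedding_def)
      qed
    qed
    have "\<xi> = evaluation_map A T v"
    proof (rule mod_hom_eqI[OF \<xi> hom[OF v]])
      fix f assume "f \<in> carrier (dual A T)"
      then have f: "f \<in> mod_hom A T (regular_module A)" by (simp add: dual_simps(1))
      obtain b where b: "b \<in> carrier A" "f = b \<odot>\<^bsub>dual A T\<^esub> embedding" using dual_spanned[OF f] by blast
      have "\<xi> f = ?u \<otimes>\<^bsub>A\<^esub> b" using mod_hom_smult[OF \<xi> _ emb, of b] b by simp
      also have "\<dots> = f v" using b(2) v \<open>embedding v = ?u\<close> by (simp add: dual_simps)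
      also have "\<dots> = evaluation_map A T v f" by (simp add: ev[OF v f])
      finally show "\<xi> f = evaluation_map A T v f" .
    qed
    then show ?thesis using v by blast
  qed
  show ?thesis unfolding bij_betw_def
  proof (intro conjI inj_onI)
    show "evaluation_map A T ` carrier T = carrier (dual (op_ring A) (dual A T))"
      unfolding dual_simps(1)[of "op_ring A"] using hom surj by (auto simp: image_iff)
  qed (rule inj)
qed

lemma trivial_module_gorenstein_projective: "gorenstein_projective A T"
  unfolding gorenstein_projective_def
  using triv_finite_dimensional Ext_trivial_module Ext_dual_trivial_module evaluation_bijective by blast

end

section \<open>Free EI categories\<close>

locale skeletal_EI_category = fin_category C for C :: "('o, 'm) cat" (structure) +
  assumes EI: "f \<in> Hom C x x \<Longrightarrow> iso_arrow C f"
    and skeleton: "f \<in> Hom C x y \<Longrightarrow> iso_arrow C f \<Longrightarrow> x = y"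
begin

lemma iso_inverse:
  assumes "iso_arrow C f" shows "inverse_arrows C f (Inverse C f)"
proof -
  obtain g where g: "inverse_arrows C f g" using assms by (auto simp: iso_arrow_def)
  have unique: "h = g" if h: "inverse_arrows C f h" for h
  proof -
    have f: "f \<in> Arr C" and gh: "g \<in> Hom C (Cod C f) (Dom C f)" "h \<in> Hom C (Cod C f) (Dom C f)"
      using g h by (auto simp: inverse_arrows_def)
    have "h = h \<cdot> (f \<cdot> g)" using comp_ident_right[OF gh(2)] g by (simp add: inverse_arrows_def)
    also have "\<dots> = h \<cdot> f \<cdot> g" using f gh by (intro Comp_assoc) (auto simp: Hom_iff)
    also have "\<dots> = g" using comp_ident_left[OF gh(1)] h by (simp add: inverse_arrows_def)
    finally show ?thesis .
  qed
  show ?thesis unfolding Inverse_def by (rule theI[of "inverse_arrows C f" g, OF g unique])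
qed

text \<open>
  Both composites are invertible endomorphisms, so \<open>f\<close> has a left and a right inverse.
\<close>

lemma no_return:
  assumes f: "f \<in> Hom C x y" and g: "g \<in> Hom C y x" shows "x = y"
proof -
  obtain u where u: "u \<in> Hom C x x" "u \<cdot> (g \<cdot> f) = Ident C x"
    using EI[OF comp_hom[OF f g]] comp_hom[OF f g] by (auto simp: iso_arrow_def inverse_arrows_def Hom_iff)
  obtain w where w: "w \<in> Hom C y y" "f \<cdot> g \<cdot> w = Ident C y"
    using EI[OF comp_hom[OF g f]] comp_hom[OF g f] by (auto simp: iso_arrow_def inverse_arrows_def Hom_iff)
  have l: "u \<cdot> g \<cdot> f = Ident C x" using u comp_assoc[OF f g u(1)] by simp
  have r: "f \<cdot> (g \<cdot> w) = Ident C y" using w comp_assoc[OF w(1) g f] by simp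
  have gw: "g \<cdot> w \<in> Hom C y x" by (rule comp_hom[OF w(1) g])
  have "u \<cdot> g = u \<cdot> g \<cdot> (f \<cdot> (g \<cdot> w))" using comp_ident_right[OF comp_hom[OF g u(1)]] r by simp
  also have "\<dots> = u \<cdot> g \<cdot> f \<cdot> (g \<cdot> w)" by (rule comp_assoc[OF gw f comp_hom[OF g u(1)]])
  also have "\<dots> = g \<cdot> w" using l comp_ident_left[OF gw] by simp
  finally have "inverse_arrows C f (g \<cdot> w)"
    using l r gw f by (auto simp: inverse_arrows_def Hom_iff)
  then show ?thesis using skeleton[OF f] by (auto simp: iso_arrow_def)
qed

lemma iso_iff: "f \<in> Hom C x y \<Longrightarrow> iso_arrow C f \<longleftrightarrow> x = y"
  using EI skeleton by blast

lemma Aut_eq: "carrier (Aut C x) = Hom C x x"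
  using EI by (auto simp: Aut_def)

lemma Aut_inverse:
  assumes "h \<in> Hom C x x"
  shows "Inverse C h \<in> Hom C x x" "Inverse C h \<cdot> h = Ident C x" "h \<cdot> Inverse C h = Ident C x"
  using iso_inverse[OF EI[OF assms]] assms by (auto simp: inverse_arrows_def Hom_iff)

text \<open>
  Both factors of a factorization into non-isomorphisms have strictly fewer objects between their
  ends, because one end of the composite no longer lies between the ends of the factor.
\<close>

lemma factorization_induct [consumes 2, case_names unfactorizable composite]:
  assumes "f \<in> Arr C" "Dom C f \<noteq> Cod C f"
    and unf: "\<And>f. unfactorizable C f \<Longrightarrow> P f"
    and comp: "\<And>g h x y w. g \<in> Hom C x w \<Longrightarrow> h \<in> Hom C w y \<Longrightarrow> x \<noteq> w \<Longrightarrow> w \<noteq> y \<Longrightarrow> x \<noteq> y \<Longrightarrow>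
      P g \<Longrightarrow> P h \<Longrightarrow> P (h \<cdot> g)"
  shows "P f"
  using assms(1,2)
proof (induction "card {w \<in> Obj C. Hom C (Dom C f) w \<noteq> {} \<and> Hom C w (Cod C f) \<noteq> {}}" arbitrary: f rule: less_induct)
  case less
  let ?I = "\<lambda>x y. {w \<in> Obj C. Hom C x w \<noteq> {} \<and> Hom C w y \<noteq> {}}"
  show ?case
  proof (cases "unfactorizable C f")
    case True
    then show ?thesis by (rule unf)
  next
    case False
    have "\<not> iso_arrow C f" using iso_iff[of f] less.prems by (simp add: Hom_iff)
    then obtain g h where gh: "g \<in> Arr C" "h \<in> Arr C" "Dom C h = Cod C g" "f = h \<cdot> g"
      "\<not> iso_arrow C g" "\<not> iso_arrow C h"
      using False less.prems by (auto simp: unfactorizable_def)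
    define x w y where "x = Dom C g" and "w = Cod C g" and "y = Cod C h"
    have g: "g \<in> Hom C x w" and h: "h \<in> Hom C w y" using gh by (auto simp: Hom_iff x_def w_def y_def)
    have f: "f \<in> Hom C x y" using comp_hom[OF g h] gh(4) by simp
    have ne: "x \<noteq> w" "w \<noteq> y" using gh(5,6) iso_iff[OF g] iso_iff[OF h] by auto
    have obj: "x \<in> Obj C" "y \<in> Obj C" "w \<in> Obj C" using g h dom_obj cod_obj by (auto simp: Hom_iff)
    have fxy: "Dom C f = x" "Cod C f = y" using f by (auto simp: Hom_iff)
    have finI: "finite (?I x y)" using fin_Obj by simp
    have "?I x w \<subset> ?I x y"
    proof
      show "?I x w \<subseteq> ?I x y" using comp_hom[OF _ h] by blast
      have "y \<notin> ?I x w" using no_return[OF h] ne by blast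
      moreover have "y \<in> ?I x y" using f ident_hom[OF obj(2)] obj by blast
      ultimately show "?I x w \<noteq> ?I x y" by blast
    qed
    then have "card (?I x w) < card (?I x y)" by (rule psubset_card_mono[OF finI])
    then have Pg: "P g" using less.hyps[of g] g ne by (simp add: fxy Hom_iff)
    have "?I w y \<subset> ?I x y"
    proof
      show "?I w y \<subseteq> ?I x y" using comp_hom[OF g] by blast
      have "x \<notin> ?I w y" using no_return[OF g] ne by blast
      moreover have "x \<in> ?I x y" using f ident_hom[OF obj(1)] obj by blast
      ultimately show "?I w y \<noteq> ?I x y" by blast
    qed
    then have "card (?I w y) < card (?I x y)" by (rule psubset_card_mono[OF finI])
    then have Ph: "P h" using less.hyps[of h] h ne by (simp add: fxy Hom_iff)
    show ?thesis unfolding gh(4) using less.prems fxy by (intro comp[OF g h ne _ Pg Ph]) simp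
  qed
qed

lemma path_comp_cong: "(\<And>i. 1 \<le> i \<Longrightarrow> i \<le> n \<Longrightarrow> a i = b i) \<Longrightarrow> path_comp C x a n = path_comp C x b n"
  by (induction n) auto

lemma path_comp_hom:
  assumes "p 0 \<in> Obj C" "\<And>i. 1 \<le> i \<Longrightarrow> i \<le> n \<Longrightarrow> a i \<in> Hom C (p (i - 1)) (p i)"
  shows "path_comp C (p 0) a n \<in> Hom C (p 0) (p n)"
  using assms(2)
proof (induction n)
  case 0
  show ?case using ident_hom[OF assms(1)] by simp
next
  case (Suc n)
  have "path_comp C (p 0) a n \<in> Hom C (p 0) (p n)" using Suc by simp
  moreover have "a (Suc n) \<in> Hom C (p n) (p (Suc n))" using Suc.prems[of "Suc n"] by simp
  ultimately show ?case by (simp add: comp_hom)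
qed

lemma path_comp_append:
  assumes f: "f \<in> Hom C x (p 0)" and p0: "p 0 \<in> Obj C"
    and b: "\<And>i. 1 \<le> i \<Longrightarrow> i \<le> n \<Longrightarrow> b i \<in> Hom C (p (i - 1)) (p i)"
    and a: "path_comp C x a m = f"
  shows "path_comp C x (\<lambda>i. if i \<le> m then a i else b (i - m)) (m + n) = path_comp C (p 0) b n \<cdot> f"
  using b
proof (induction n)
  case 0
  have "path_comp C x (\<lambda>i. if i \<le> m then a i else b (i - m)) m = f"
    unfolding a[symmetric] by (rule path_comp_cong) simp
  then show ?case using comp_ident_left[OF f] by simp
next
  case (Suc n)
  have "path_comp C (p 0) b n \<in> Hom C (p 0) (p n)" by (rule path_comp_hom[of p, OF p0]) (use Suc.prems in simp)
  moreover have "b (Suc n) \<in> Hom C (p n) (p (Suc n))" using Suc.prems[of "Suc n"] by simp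
  ultimately show ?case using Suc comp_assoc[OF f] by simp
qed

lemma decomposition_exists:
  assumes "f \<in> Arr C" "Dom C f \<noteq> Cod C f"
  shows "\<exists>m p a. unfactorizable_decomposition C f m p a"
  using assms
proof (induction rule: factorization_induct)
  case (unfactorizable f)
  then have f: "f \<in> Arr C" by (simp add: unfactorizable_def)
  have "unfactorizable_decomposition C f 1 (\<lambda>i. if i = 0 then Dom C f else Cod C f) (\<lambda>i. f)"
    using unfactorizable f Comp_Ident[OF f] by (auto simp: unfactorizable_decomposition_def Hom_iff)
  then show ?case by blast
next
  case (composite g h x y w)
  obtain m p a where g: "unfactorizable_decomposition C g m p a" using composite by blast
  obtain n q b where h: "unfactorizable_decomposition C h n q b" using composite by blast
  let ?r = "\<lambda>i. if i \<le> m then p i else q (i - m)" and ?c = "\<lambda>i. if i \<le> m then a i else b (i - m)"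
  have ends: "p 0 = x" "p m = w" "q 0 = w" "q n = y" "1 \<le> m" "1 \<le> n"
    using g h composite(1,2) by (auto simp: unfactorizable_decomposition_def Hom_iff)
  have hg: "h \<cdot> g \<in> Hom C x y" by (rule comp_hom[OF composite(1,2)])
  have "unfactorizable_decomposition C (h \<cdot> g) (m + n) ?r ?c"
    unfolding unfactorizable_decomposition_def
  proof (intro conjI ballI)
    fix i assume i: "i \<in> {1..m + n}"
    show "?c i \<in> Hom C (?r (i - 1)) (?r i)"
    proof (cases "i \<le> m")
      case True
      then show ?thesis using g i by (auto simp: unfactorizable_decomposition_def)
    next
      case False
      have "i - m \<in> {1..n}" using False i by auto
      then have "b (i - m) \<in> Hom C (q (i - m - 1)) (q (i - m))"
        using h unfolding unfactorizable_decomposition_def by blast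
      moreover have "?r (i - 1) = q (i - m - 1)"
        using False ends by (cases "i = Suc m") (auto simp: not_le)
      ultimately show ?thesis using False by simp
    qed
    show "unfactorizable C (?c i)"
    proof (cases "i \<le> m")
      case True
      then show ?thesis using g i by (auto simp: unfactorizable_decomposition_def)
    next
      case False
      then have "i - m \<in> {1..n}" using i by auto
      then show ?thesis using h False by (auto simp: unfactorizable_decomposition_def)
    qed
  next
    have "path_comp C x ?c (m + n) = path_comp C (q 0) b n \<cdot> g"
    proof (rule path_comp_append)
      show "g \<in> Hom C x (q 0)" using composite(1) ends by simp
      show "q 0 \<in> Obj C" using composite(1) ends cod_obj[of g] by (auto simp: Hom_iff)
      show "path_comp C x a m = g"
        using g unfolding unfactorizable_decomposition_def ends(1) by blast
      show "b i \<in> Hom C (q (i - 1)) (q i)" if "1 \<le> i" "i \<le> n" for i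
        using h that unfolding unfactorizable_decomposition_def by (meson atLeastAtMost_iff)
    qed
    also have "path_comp C (q 0) b n = h"
      using h unfolding unfactorizable_decomposition_def by blast
    finally show "path_comp C (?r 0) ?c (m + n) = h \<cdot> g" by (simp add: ends(1))
  qed (use ends hg in \<open>auto simp: Hom_iff\<close>)
  then show ?case by blast
qed

lemma decomposition_extend:
  assumes f: "unfactorizable_decomposition C f m p a" and fh: "f \<in> Hom C x y"
    and g: "unfactorizable C g" "g \<in> Hom C y w"
  shows "unfactorizable_decomposition C (g \<cdot> f) (Suc m) (p(Suc m := w)) (a(Suc m := g))"
proof -
  have gf: "g \<cdot> f \<in> Hom C x w" by (rule comp_hom[OF fh g(2)])
  have "path_comp C (p 0) (a(Suc m := g)) m = path_comp C (p 0) a m" by (rule path_comp_cong) simp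
  also have "\<dots> = f" using f unfolding unfactorizable_decomposition_def by blast
  finally show ?thesis using f g gf fh
    by (auto simp: unfactorizable_decomposition_def Hom_iff le_Suc_eq)
qed

text \<open>
  Decompositions of \<open>g\<close> and \<open>g'\<close>, followed by \<open>f\<close>, are two decompositions of the same morphism.  The
  automorphism that relates them at the domain of \<open>f\<close> fixes \<open>f\<close>, so it is the identity; and the
  relations between the other factors telescope to the statement that it carries \<open>g\<close> to \<open>g'\<close>.
\<close>

lemma unfactorizable_monic:
  assumes free: "free_category C" and act: "aut_acts_freely C x y"
    and f: "unfactorizable C f" "f \<in> Hom C x y"
    and g: "g \<in> Hom C w x" "g' \<in> Hom C w x" and eq: "f \<cdot> g = f \<cdot> g'"
  shows "g = g'"
proof -
  have act: "h = Ident C x" if "h \<in> Hom C x x" "f \<cdot> h = f" for h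
    using act f(2) that by (auto simp: aut_acts_freely_def Aut_eq)
  show ?thesis
  proof (cases "w = x")
    case True
    \<comment> \<open>Isomorphisms have no decomposition, but here the action applies to \<open>g\<close> and \<open>g'\<close> themselves.\<close>
    let ?i = "Inverse C g'"
    have gg: "g \<in> Hom C x x" "g' \<in> Hom C x x" using g True by auto
    note i = Aut_inverse[OF gg(2)]
    have "f \<cdot> (g \<cdot> ?i) = f \<cdot> g \<cdot> ?i" by (rule comp_assoc[OF i(1) gg(1) f(2)])
    also have "\<dots> = f \<cdot> (g' \<cdot> ?i)" unfolding eq by (rule comp_assoc[OF i(1) gg(2) f(2), symmetric])
    also have "\<dots> = f" using i comp_ident_right[OF f(2)] by simp
    finally have gi: "g \<cdot> ?i = Ident C x" by (intro act comp_hom[OF i(1) gg(1)])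
    have "g = g \<cdot> (?i \<cdot> g')" using i comp_ident_right[OF gg(1)] by simp
    also have "\<dots> = g \<cdot> ?i \<cdot> g'" by (rule comp_assoc[OF gg(2) i(1) gg(1)])
    also have "\<dots> = g'" using gi comp_ident_left[OF gg(2)] by simp
    finally show ?thesis .
  next
    case False
    obtain m p a where d: "unfactorizable_decomposition C g m p a"
      using decomposition_exists[of g] g False by (auto simp: Hom_iff)
    obtain n q b where d': "unfactorizable_decomposition C g' n q b"
      using decomposition_exists[of g'] g False by (auto simp: Hom_iff)
    have fg: "f \<cdot> g \<in> Hom C w y" by (rule comp_hom[OF g(1) f(2)])
    have "x \<noteq> y" using f iso_iff[OF f(2)] by (simp add: unfactorizable_def)
    have "w \<noteq> y" using no_return[OF g(1)] f(2) False by blast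
    then have ni: "\<not> iso_arrow C (f \<cdot> g)" using iso_iff[OF fg] by simp
    have D: "unfactorizable_decomposition C (f \<cdot> g) (Suc m) (p(Suc m := y)) (a(Suc m := f))"
      by (rule decomposition_extend[OF d g(1) f])
    have D': "unfactorizable_decomposition C (f \<cdot> g) (Suc n) (q(Suc n := y)) (b(Suc n := f))"
      unfolding eq by (rule decomposition_extend[OF d' g(2) f])
    have m: "1 \<le> m" using d by (simp add: unfactorizable_decomposition_def)
    have ends: "p 0 = w" "p m = x" "q 0 = w" using d d' g by (auto simp: unfactorizable_decomposition_def Hom_iff)
    have fgA: "f \<cdot> g \<in> Arr C" using fg by (simp add: Hom_iff)
    have UF: "Suc m = Suc n \<and> (\<forall>i \<le> Suc n. (p(Suc m := y)) i = (q(Suc n := y)) i) \<and>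
           (2 \<le> Suc n \<longrightarrow>
             (\<exists>h. (\<forall>i \<in> {1..Suc n - 1}. h i \<in> carrier (Aut C ((p(Suc m := y)) i))) \<and>
                (b(Suc n := f)) 1 = h 1 \<cdot> (a(Suc m := f)) 1 \<and>
                (\<forall>i \<in> {2..Suc n - 1}. (b(Suc n := f)) i = h i \<cdot> (a(Suc m := f)) i \<cdot> Inverse C (h (i - 1))) \<and>
                (b(Suc n := f)) (Suc n) = (a(Suc m := f)) (Suc n) \<cdot> Inverse C (h (Suc n - 1))))"
      using free[unfolded free_category_def, rule_format, OF fgA ni conjI[OF D D']] .
    then have nm: "n = m" by simp
    obtain h where h: "\<forall>i \<in> {1..m}. h i \<in> carrier (Aut C ((p(Suc m := y)) i))"
      "(b(Suc m := f)) 1 = h 1 \<cdot> (a(Suc m := f)) 1"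
      "\<forall>i \<in> {2..m}. (b(Suc m := f)) i = h i \<cdot> (a(Suc m := f)) i \<cdot> Inverse C (h (i - 1))"
      "(b(Suc m := f)) (Suc m) = (a(Suc m := f)) (Suc m) \<cdot> Inverse C (h m)"
      using UF m unfolding nm by auto
    have hA: "h i \<in> Hom C (p i) (p i)" if "1 \<le> i" "i \<le> m" for i
      using h(1) that by (simp add: Aut_eq)
    have b1: "b 1 = h 1 \<cdot> a 1" using h(2) m by simp
    have bi: "b i = h i \<cdot> a i \<cdot> Inverse C (h (i - 1))" if "2 \<le> i" "i \<le> m" for i
    proof -
      have "i \<in> {2..m}" "i \<noteq> Suc m" using that by auto
      then show ?thesis using h(3) by (metis fun_upd_other)
    qed
    have f_inv: "f = f \<cdot> Inverse C (h m)" using h(4) by simp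
    have ah: "a i \<in> Hom C (p (i - 1)) (p i)" if "1 \<le> i" "i \<le> m" for i
      using d that by (simp add: unfactorizable_decomposition_def)
    have w: "w \<in> Obj C" using g dom_obj by (auto simp: Hom_iff)
    have tele: "path_comp C w b i = h i \<cdot> path_comp C w a i" if "1 \<le> i" "i \<le> m" for i
      using that
    proof (induction i rule: nat_induct_at_least)
      case base
      have "h 1 \<in> Hom C (p 1) (p 1)" "a 1 \<in> Hom C w (p 1)" using hA[of 1] ah[of 1] m ends by auto
      then show ?case using b1 comp_assoc[OF ident_hom[OF w]] by simp
    next
      case (Suc i)
      have pa: "path_comp C w a i \<in> Hom C w (p i)"
        using path_comp_hom[of p i a] Suc ah w ends by simp
      have hi: "h i \<in> Hom C (p i) (p i)" using hA Suc by simp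
      have hs: "h (Suc i) \<in> Hom C (p (Suc i)) (p (Suc i))" using hA Suc by simp
      have as: "a (Suc i) \<in> Hom C (p i) (p (Suc i))" using ah[of "Suc i"] Suc by simp
      note ii = Aut_inverse[OF hi]
      have hp: "h i \<cdot> path_comp C w a i \<in> Hom C w (p i)" by (rule comp_hom[OF pa hi])
      have "path_comp C w b (Suc i) = (h (Suc i) \<cdot> a (Suc i) \<cdot> Inverse C (h i)) \<cdot> (h i \<cdot> path_comp C w a i)"
        using Suc bi[of "Suc i"] by simp
      also have "\<dots> = (h (Suc i) \<cdot> a (Suc i)) \<cdot> (Inverse C (h i) \<cdot> (h i \<cdot> path_comp C w a i))"
        by (rule comp_assoc[OF hp ii(1) comp_hom[OF as hs], symmetric])
      also have "Inverse C (h i) \<cdot> (h i \<cdot> path_comp C w a i) = path_comp C w a i"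
        using comp_assoc[OF pa hi ii(1)] ii(2) comp_ident_left[OF pa] by simp
      also have "(h (Suc i) \<cdot> a (Suc i)) \<cdot> path_comp C w a i = h (Suc i) \<cdot> path_comp C w a (Suc i)"
        using comp_assoc[OF pa as hs] by simp
      finally show ?case .
    qed
    have hm: "h m \<in> Hom C x x" using hA[of m] m ends by simp
    note im = Aut_inverse[OF hm]
    have "Inverse C (h m) = Ident C x" by (rule act[OF im(1) f_inv[symmetric]])
    then have "h m = Ident C x" using im(3) comp_ident_right[OF hm] by simp
    moreover have "path_comp C w a m = g"
      using d unfolding unfactorizable_decomposition_def ends(1) by blast
    moreover have "path_comp C w b m = g'"
      using d' unfolding unfactorizable_decomposition_def ends(3) nm by blast
    ultimately show ?thesis using tele[OF m] comp_ident_left[OF g(1)] by simp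
  qed
qed

lemma monic:
  assumes free: "free_category C" and act: "\<And>x y. x \<in> Obj C \<Longrightarrow> y \<in> Obj C \<Longrightarrow> aut_acts_freely C x y"
    and f: "f \<in> Hom C x y" and g: "g \<in> Hom C w x" "g' \<in> Hom C w x" and eq: "f \<cdot> g = f \<cdot> g'"
  shows "g = g'"
proof (cases "x = y")
  case True
  then have i: "Inverse C f \<in> Hom C x x" "Inverse C f \<cdot> f = Ident C x" "f \<in> Hom C x x"
    using f Aut_inverse[of f x] by auto
  have "g = Inverse C f \<cdot> (f \<cdot> g)" using comp_assoc[OF g(1) i(3,1)] i comp_ident_left[OF g(1)] by simp
  also have "\<dots> = g'" unfolding eq using comp_assoc[OF g(2) i(3,1)] i comp_ident_left[OF g(2)] by simp
  finally show ?thesis .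
next
  case False
  have "f \<in> Arr C" "Dom C f \<noteq> Cod C f" using f False by (auto simp: Hom_iff)
  then have "\<forall>x y w g g'. f \<in> Hom C x y \<longrightarrow> g \<in> Hom C w x \<longrightarrow> g' \<in> Hom C w x \<longrightarrow> f \<cdot> g = f \<cdot> g' \<longrightarrow> g = g'"
  proof (induction rule: factorization_induct)
    case (unfactorizable f)
    show ?case
    proof (intro allI impI)
      fix x y w g g' assume *: "f \<in> Hom C x y" "g \<in> Hom C w x" "g' \<in> Hom C w x" "f \<cdot> g = f \<cdot> g'"
      have "x \<in> Obj C" "y \<in> Obj C" using *(1) dom_obj cod_obj by (auto simp: Hom_iff)
      then show "g = g'" using unfactorizable_monic[OF free act unfactorizable *] by blast
    qed
  next
    case (composite k h x y v)
    show ?case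
    proof (intro allI impI)
      fix x' y' w g g' assume *: "h \<cdot> k \<in> Hom C x' y'" "g \<in> Hom C w x'" "g' \<in> Hom C w x'" "h \<cdot> k \<cdot> g = h \<cdot> k \<cdot> g'"
      have "x' = x" using *(1) comp_hom[OF composite(1,2)] by (auto simp: Hom_iff)
      then have g: "g \<in> Hom C w x" "g' \<in> Hom C w x" using * by auto
      have "h \<cdot> (k \<cdot> g) = h \<cdot> (k \<cdot> g')"
        using *(4) comp_assoc[OF g(1) composite(1,2)] comp_assoc[OF g(2) composite(1,2)] by simp
      then have "k \<cdot> g = k \<cdot> g'"
        using composite.IH(2) composite(2) comp_hom[OF g(1) composite(1)] comp_hom[OF g(2) composite(1)] by blast
      then show "g = g'" using composite.IH(1) composite(1) g by blast
    qed
  qed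
  then show ?thesis using f g eq by blast
qed

end

section \<open>The trivial module and smallest objects\<close>

lemma connected_invariant:
  assumes conn: "connected_category C" and x: "x \<in> Obj C" "P x" and y: "y \<in> Obj C"
    and step: "\<And>f. f \<in> Arr C \<Longrightarrow> P (Dom C f) \<longleftrightarrow> P (Cod C f)"
  shows "P y"
proof (cases "x = y")
  case False
  then obtain m p where p: "p 0 = x" "p m = y" "\<And>i. i < m \<Longrightarrow> Hom C (p i) (p (Suc i)) \<noteq> {} \<or> Hom C (p (Suc i)) (p i) \<noteq> {}"
    using conn x(1) y unfolding connected_category_def by metis
  have "P (p i)" if "i \<le> m" for i
    using that
  proof (induction i)
    case (Suc i)
    then have "P (p i)" by simp
    moreover obtain h where "h \<in> Hom C (p i) (p (Suc i)) \<or> h \<in> Hom C (p (Suc i)) (p i)"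
      using p(3)[of i] Suc.prems by auto
    ultimately show ?case using step[of h] by (auto simp: Hom_def)
  qed (use p x in simp)
  then show ?thesis using p(2) by blast
qed (use x in simp)

context skeletal_EI_category
begin

text \<open>
  Evaluation being injective, some homomorphism \<open>f\<close> to the algebra is nonzero at a given object \<open>x0\<close>;
  take for \<open>z\<close> the domain of a morphism \<open>k\<close> in the support of its value there.  The property \<open>P\<close> that
  the value of \<open>f\<close> at an object involves a morphism from \<open>z\<close> is passed on in both directions along any
  morphism: forwards because morphisms are monic, backwards because the value at the codomain is the
  composite with the value at the domain.
\<close>

lemma smallest_object_exists:
  assumes free: "free_category C" and act: "\<And>x y. x \<in> Obj C \<Longrightarrow> y \<in> Obj C \<Longrightarrow> aut_acts_freely C x y"
    and conn: "connected_category C" and ne: "Obj C \<noteq> {}"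
    and G: "gorenstein_projective (alg :: ('k::field, 'm \<Rightarrow> 'k) module) triv"
  shows "\<exists>z. smallest_object C z \<and> (\<forall>x \<in> Obj C. card (aut_orbits C z x) = 1)"
proof -
  let ?A = "alg :: ('k, 'm \<Rightarrow> 'k) module"
  let ?T = "triv :: ('m \<Rightarrow> 'k, 'o \<Rightarrow> 'k) module"
  let ?d = "basis_vector :: 'o \<Rightarrow> 'o \<Rightarrow> 'k"
  interpret A: ring ?A by (rule alg_ring)
  interpret T: left_module ?A ?T by (rule triv_left_module)
  interpret reg: left_module ?A "regular_module ?A" by (rule left_module_regular[OF alg_ring])
  have dT: "?d x \<in> carrier ?T" if "x \<in> Obj C" for x using that by (auto simp: triv_carrier basis_vector_def)
  obtain x0 where x0: "x0 \<in> Obj C" using ne by blast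
  have "\<exists>f\<in>mod_hom ?A ?T (regular_module ?A). f (?d x0) \<noteq> \<zero>\<^bsub>?A\<^esub>"
  proof (rule ccontr)
    assume H: "\<not> ?thesis"
    have "evaluation_map ?A ?T (?d x0) = evaluation_map ?A ?T \<zero>\<^bsub>?T\<^esub>"
    proof -
      have "f (?d x0) = f \<zero>\<^bsub>?T\<^esub>" if "f \<in> carrier (dual ?A ?T)" for f
      proof -
        have f: "f \<in> mod_hom ?A ?T (regular_module ?A)" using that by (simp add: dual_simps(1))
        then show ?thesis using H T.mod_hom_zero[OF reg.M.abelian_group_axioms f] by auto
      qed
      then show ?thesis using dT[OF x0] by (auto simp: evaluation_map_def intro!: restrict_ext)
    qed
    moreover have "inj_on (evaluation_map ?A ?T) (carrier ?T)"
      using G by (simp add: gorenstein_projective_def bij_betw_def)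
    ultimately have "?d x0 = \<zero>\<^bsub>?T\<^esub>" using dT[OF x0] T.M.zero_closed by (metis inj_onD)
    then have "?d x0 x0 = 0" by (simp add: triv_zero)
    then show False by (simp add: basis_vector_def)
  qed
  then obtain f where f: "f \<in> mod_hom ?A ?T (regular_module ?A)" and fx0: "f (?d x0) \<noteq> \<zero>\<^bsub>?A\<^esub>" by blast
  \<comment> \<open>The values of \<open>f\<close> at the basis form a natural family of vectors.\<close>
  define b where "b x = f (?d x)" for x
  have natural: "b (Cod C h) = basis_vector h \<otimes>\<^bsub>?A\<^esub> b (Dom C h)" if h: "h \<in> Arr C" for h
  proof -
    have "basis_vector h \<odot>\<^bsub>?T\<^esub> ?d (Dom C h) = ?d (Cod C h)"
      using basis_triv[OF h, of "?d (Dom C h)"] by (auto simp: basis_vector_def fun_eq_iff)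
    then show ?thesis
      using mod_hom_smult[OF f basis_closed[OF h] dT[OF dom_obj[OF h]]] by (simp add: b_def)
  qed
  have coeff: "b (Cod C h) k = (\<Sum>g\<in>Arr C. if Dom C h = Cod C g \<and> h \<cdot> g = k then b (Dom C h) g else 0)"
    if h: "h \<in> Arr C" for h k
    unfolding natural[OF h] by (rule basis_mult_left[OF h])
  have "b x0 \<noteq> (\<lambda>h. 0)" using fx0 by (simp add: b_def alg_zero)
  then obtain k where k: "b x0 k \<noteq> 0" by auto
  have "b x0 = (\<lambda>h. if h \<in> Arr C \<and> Cod C h = x0 then b x0 h else 0)"
    using natural[of "Ident C x0"] Ident_arr[OF x0] ident_mult_left[OF x0, of "b x0"] by simp
  from fun_cong[OF this, of k] k have kA: "k \<in> Arr C" "Cod C k = x0" by (auto split: if_splits)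
  define z where "z = Dom C k"
  have z: "z \<in> Obj C" using kA dom_obj by (simp add: z_def)
  define P where "P x \<longleftrightarrow> (\<exists>g\<in>Hom C z x. b x g \<noteq> 0)" for x
  have "P (Dom C h) \<longleftrightarrow> P (Cod C h)" if h: "h \<in> Arr C" for h
  proof
    assume "P (Dom C h)"
    then obtain g where g: "g \<in> Hom C z (Dom C h)" "b (Dom C h) g \<noteq> 0" by (auto simp: P_def)
    have hh: "h \<in> Hom C (Dom C h) (Cod C h)" using h by (simp add: Hom_iff)
    have gA: "g \<in> Arr C" "Cod C g = Dom C h" using g by (auto simp: Hom_iff)
    have "b (Cod C h) (h \<cdot> g) = (\<Sum>g'\<in>Arr C. if g' = g then b (Dom C h) g else 0)"
      unfolding coeff[OF h]
    proof (intro sum.cong refl)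
      fix g' assume g': "g' \<in> Arr C"
      have "g' = g" if "Dom C h = Cod C g'" "h \<cdot> g' = h \<cdot> g"
      proof -
        have "Dom C g' = Dom C (h \<cdot> g')" using Comp_arr[OF h g'] that by simp
        also have "\<dots> = z" using that(2) comp_hom[OF g(1) hh] by (simp add: Hom_iff)
        finally have "g' \<in> Hom C z (Dom C h)" using g' that by (simp add: Hom_iff)
        then show ?thesis using monic[OF free act hh _ g(1) that(2)] by blast
      qed
      then show "(if Dom C h = Cod C g' \<and> h \<cdot> g' = h \<cdot> g then b (Dom C h) g' else 0) = (if g' = g then b (Dom C h) g else 0)"
        using gA by auto
    qed
    also have "\<dots> = b (Dom C h) g" using gA by (simp add: fin)
    finally show "P (Cod C h)"
      unfolding P_def using g(2) by (intro bexI[OF _ comp_hom[OF g(1) hh]]) simp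
  next
    assume "P (Cod C h)"
    then obtain k where k: "k \<in> Hom C z (Cod C h)" "b (Cod C h) k \<noteq> 0" by (auto simp: P_def)
    from k(2) obtain g where g: "g \<in> Arr C" "(if Dom C h = Cod C g \<and> h \<cdot> g = k then b (Dom C h) g else 0) \<noteq> 0"
      unfolding coeff[OF h] by (rule sum.not_neutral_contains_not_neutral)
    then have "Dom C h = Cod C g" "h \<cdot> g = k" "b (Dom C h) g \<noteq> 0" by (auto split: if_splits)
    then show "P (Dom C h)" using g(1) k(1) Comp_arr[OF h g(1)] by (auto simp: P_def Hom_iff)
  qed
  moreover have "P x0" using k kA by (auto simp: P_def Hom_iff z_def)
  ultimately have P: "P x" if "x \<in> Obj C" for x
    using connected_invariant[OF conn x0, of P x] that by blast
  have "card (aut_orbits C z x) = 1" if x: "x \<in> Obj C" for x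
  proof -
    obtain g where g: "g \<in> Hom C z x" "b x g \<noteq> 0" using P[OF x] by (auto simp: P_def)
    let ?orb = "\<lambda>f. (\<lambda>g. f \<cdot> g) ` Hom C z z"
    have orb: "?orb h = ?orb g" if h: "h \<in> Hom C z x" for h
    proof -
      have hA: "h \<in> Arr C" "Dom C h = z" "Cod C h = x" using h by (auto simp: Hom_iff)
      have "(\<Sum>u\<in>Arr C. if Dom C h = Cod C u \<and> h \<cdot> u = g then b (Dom C h) u else 0) \<noteq> 0"
        using g(2) coeff[OF hA(1), of g] hA(3) by simp
      then obtain u where "u \<in> Arr C" "(if Dom C h = Cod C u \<and> h \<cdot> u = g then b (Dom C h) u else 0) \<noteq> 0"
        by (rule sum.not_neutral_contains_not_neutral)
      then have u: "u \<in> Arr C" "Cod C u = z" "h \<cdot> u = g" using hA by (auto split: if_splits)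
      have "Dom C u = z" using Comp_arr[OF hA(1) u(1)] u hA g(1) by (auto simp: Hom_iff)
      then have uz: "u \<in> Hom C z z" using u by (simp add: Hom_iff)
      note i = Aut_inverse[OF uz]
      show ?thesis
      proof (rule equalityI; rule subsetI)
        fix t assume "t \<in> ?orb h"
        then obtain v where v: "v \<in> Hom C z z" "t = h \<cdot> v" by blast
        have iv: "Inverse C u \<cdot> v \<in> Hom C z z" by (rule comp_hom[OF v(1) i(1)])
        have "g \<cdot> (Inverse C u \<cdot> v) = h \<cdot> (u \<cdot> (Inverse C u \<cdot> v))"
          using comp_assoc[OF iv uz h] u(3) by simp
        also have "\<dots> = t" using comp_assoc[OF v(1) i(1) uz] i(3) comp_ident_left[OF v(1)] v(2) by simp
        finally show "t \<in> ?orb g" using iv by blast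
      next
        fix t assume "t \<in> ?orb g"
        then obtain v where v: "v \<in> Hom C z z" "t = g \<cdot> v" by blast
        have "t = h \<cdot> (u \<cdot> v)" using v(2) comp_assoc[OF v(1) uz h] u(3) by simp
        then show "t \<in> ?orb h" using comp_hom[OF v(1) uz] by blast
      qed
    qed
    have "aut_orbits C z x = (\<lambda>h. ?orb g) ` Hom C z x"
      unfolding aut_orbits_def Aut_eq by (rule image_cong[OF refl orb])
    also have "\<dots> = {?orb g}" using g(1) by blast
    finally show ?thesis by simp
  qed
  moreover have "smallest_object C z" using z P by (auto simp: smallest_object_def P_def)
  ultimately show ?thesis by blast
qed

text \<open>
  One orbit for each object lets every morphism from \<open>z\<close> be compared with a chosen one, and projectivity
  of the bimodules as right modules provides the invertible stabilizers.
\<close>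

lemma gorenstein_projective_if_transitive:
  fixes K :: "'k::field itself"
  assumes proj: "projective_category K C"
    and z: "smallest_object C z" and orb: "\<And>x. x \<in> Obj C \<Longrightarrow> card (aut_orbits C z x) = 1"
  shows "gorenstein_projective (alg :: ('k::field, 'm \<Rightarrow> 'k) module) triv"
proof -
  have zO: "z \<in> Obj C" and zx: "\<And>x. x \<in> Obj C \<Longrightarrow> Hom C z x \<noteq> {}" using z by (auto simp: smallest_object_def)
  interpret G: group_object C z by unfold_locales (use zO EI in auto)
  define a where "a x = (SOME f. f \<in> Hom C z x)" for x
  have a: "a x \<in> Hom C z x" if "x \<in> Obj C" for x
    unfolding a_def using zx[OF that] by (metis ex_in_conv someI_ex)
  interpret transitive_category C z a "TYPE('k)"
  proof
    fix f assume f: "f \<in> Arr C" "Cod C f = z"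
    have "Dom C f \<in> Obj C" using f dom_obj by simp
    then obtain g where "g \<in> Hom C z (Dom C f)" using zx by blast
    then show "Dom C f = z" using no_return[of g z "Dom C f" f] f by (simp add: Hom_iff)
  next
    fix f x assume f: "f \<in> Hom C z x"
    have x: "x \<in> Obj C" using f cod_obj[of f] by (simp add: Hom_iff)
    let ?orb = "\<lambda>f. (\<lambda>g. f \<cdot> g) ` Hom C z z"
    obtain S where S: "aut_orbits C z x = {S}" using orb[OF x] by (auto simp: card_1_singleton_iff)
    have "?orb f \<in> {S}" "?orb (a x) \<in> {S}"
      using f a[OF x] unfolding S[symmetric] aut_orbits_def Aut_eq by auto
    moreover have "f \<in> ?orb f" using comp_ident_right[OF f] ident_hom[OF zO] by force
    ultimately show "\<exists>g\<in>Hom C z z. f = a x \<cdot> g" by blast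
  next
    fix x assume x: "x \<in> Obj C"
    show "a x \<in> Hom C z x" by (rule a[OF x])
    have "projective_module (op_ring (group_algebra (Aut C z) :: ('k, 'm \<Rightarrow> 'k) module)) (hom_right_module C z x)"
      using proj zO x by (simp add: projective_category_def)
    then show "of_nat (card (G.stab (a x))) \<noteq> (0 :: 'k)"
      by (rule G.stabilizer_invertible[OF _ a[OF x]])
  qed
  show ?thesis by (rule trivial_module_gorenstein_projective)
qed

end

theorem corollary3p5:
  fixes C :: "('o, 'm) cat" and k :: "'k::field itself"
  assumes "Obj C \<noteq> {}"
    and "finite_EI_category C"
    and "skeletal C"
    and "connected_category C"
    and "free_category C"
    and "projective_category k C"
  shows
    "((\<exists>z. smallest_object C z \<and> (\<forall>x \<in> Obj C. card (aut_orbits C z x) = 1)) \<longrightarrow>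
        gorenstein_projective (category_algebra C :: ('k, 'm \<Rightarrow> 'k) module) (trivial_module C)) \<and>
     ((\<forall>x \<in> Obj C. \<forall>y \<in> Obj C. aut_acts_freely C x y) \<longrightarrow>
        gorenstein_projective (category_algebra C :: ('k, 'm \<Rightarrow> 'k) module) (trivial_module C) \<longrightarrow>
        (\<exists>z. smallest_object C z \<and> (\<forall>x \<in> Obj C. card (aut_orbits C z x) = 1)))"
proof -
  have cat: "category C" "finite (Arr C)" and EI: "\<And>x f. x \<in> Obj C \<Longrightarrow> f \<in> Hom C x x \<Longrightarrow> iso_arrow C f"
    using assms(2) by (auto simp: finite_EI_category_def finite_category_def)
  interpret category C by (rule cat(1))
  interpret skeletal_EI_category C
  proof
    show "finite (Arr C)" by (rule cat(2))
    show "iso_arrow C f" if "f \<in> Hom C x x" for f x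
      using EI that dom_obj[of f] by (auto simp: Hom_def)
    show "x = y" if "f \<in> Hom C x y" "iso_arrow C f" for f x y
      using assms(3) that dom_obj[of f] cod_obj[of f] by (auto simp: skeletal_def Hom_def)
  qed
  show ?thesis
    using gorenstein_projective_if_transitive[OF assms(6)] smallest_object_exists[OF assms(5) _ assms(4,1)]
    by blast
qed

end
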